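(* Let $\Omega\subset\mathbb{R}^d$ ($d\ge 3$) be a bounded open set with a given Riemannian metric $(g_{ij})$, with Christoffel symbols $\Gamma_{ij}^k$ and Riemann curvature tensor $R_{ijkl}$. Let $(h_{ij}^{a,\varepsilon},\kappa_{lb}^{a,\varepsilon})$, $\varepsilon>0$, be a sequence of fields on $\Omega$, with $h_{ij}^{a,\varepsilon}=h_{ji}^{a,\varepsilon}$ and $\kappa_{kb}^{a,\varepsilon}=-\kappa_{ka}^{b,\varepsilon}$, satisfying the following. (A.1) $\|(h_{ij}^{a,\varepsilon},\kappa_{lb}^{a,\varepsilon})\|_{L^2(\Omega)}\le C$ for some $C>0$ independent of $\varepsilon>0$. (A.2) $\partial_k h_{lj}^{a,\varepsilon}-\partial_l h_{kj}^{a,\varepsilon}$ and $\partial_k\kappa_{lb}^{a,\varepsilon}-\partial_l\kappa_{kb}^{a,\varepsilon}$ are confined in a compact set in $H^{-1}_{loc}(\Omega)$. (A.3) There exist $o_j^\varepsilon(1)$, $j=1,2,3$, with $o_j^\varepsilon(1)\to0$ in the sense of distributions as $\varepsilon\to0$, such that $$\partial_k h_{lj}^{a,\varepsilon}-\partial_l h_{kj}^{a,\varepsilon}+\Gamma_{lj}^m h_{km}^{a,\varepsilon}-\Gamma_{kj}^m h_{lm}^{a,\varepsilon}+\kappa_{kb}^{a,\varepsilon}h_{lj}^{b,\varepsilon}-\kappa_{lb}^{a,\varepsilon}h_{kj}^{b,\varepsilon}=o_1^\varepsilon(1),$$ $$\partial_k\kappa_{lb}^{a,\varepsilon}-\partial_l\kappa_{kb}^{a,\varepsilon}-g^{mn}\big(h_{ml}^{a,\varepsilon}h_{kn}^{b,\varepsilon}-h_{mk}^{a,\varepsilon}h_{ln}^{b,\varepsilon}\big)+\kappa_{kc}^{a,\varepsilon}\kappa_{lb}^{c,\varepsilon}-\kappa_{lc}^{a,\varepsilon}\kappa_{kb}^{c,\varepsilon}=o_2^\varepsilon(1),$$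 $$h_{ji}^{a,\varepsilon}h_{kl}^{a,\varepsilon}-h_{ki}^{a,\varepsilon}h_{jl}^{a,\varepsilon}=R_{ijkl}+o_3^\varepsilon(1).$$ Then there exists a subsequence (still labeled by $\varepsilon$) converging weakly in $L^2(\Omega)$ to some $(h_{ij}^a,\kappa_{lb}^a)$ as $\varepsilon\to0$ such that: (i) $\|(h_{ij}^a,\kappa_{lb}^a)\|_{L^2(\Omega)}\le C$; (ii) the quadratic terms in the Gauss-Codazzi-Ricci system are weakly continuous with respect to this subsequence, i.e. each of $$h_{ji}^{a,\varepsilon}h_{kl}^{a,\varepsilon}-h_{ki}^{a,\varepsilon}h_{jl}^{a,\varepsilon},\quad \kappa_{kb}^{a,\varepsilon}h_{lj}^{b,\varepsilon}-\kappa_{lb}^{a,\varepsilon}h_{kj}^{b,\varepsilon},\quad g^{mn}\big(h_{ml}^{a,\varepsilon}h_{kn}^{b,\varepsilon}-h_{mk}^{a,\varepsilon}h_{ln}^{b,\varepsilon}\big),\quad \kappa_{kc}^{a,\varepsilon}\kappa_{lb}^{c,\varepsilon}-\kappa_{lc}^{a,\varepsilon}\kappa_{kb}^{c,\varepsilon}$$ converges in the sense of distributions to the same expression with $(h^{\varepsilon},\kappa^{\varepsilon})$ replaced by $(h,\kappa)$; (iii) the limit field $(h_{ij}^a,\kappa_{lb}^a)$ satisfies the Gauss-Codazzi-Ricci system. That is, the limit field $(h_{ij}^a,\kappa_{lb}^a)$ is a weak solution of the Gauss-Codazzi-Ricci system.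
   Context: Indices: $i,j,k,l,m,n$ run from $1$ to $d$; the normal indices $a,b,c$ run from $1$ to $N-d$, where $N$ is the dimension of the ambient Euclidean space $\mathbb{R}^N$. Repeated indices in a product are summed (including repeated normal indices, e.g. $h^a_{ji}h^a_{kl}$ is summed over $a$). Equations and conditions are required for all values of the free indices. $\partial_j=\partial/\partial x^j$. $(g_{ij})$ is the given metric, $(g^{ij})$ its inverse, and $$\Gamma_{ij}^k=\tfrac12 g^{kl}(\partial_j g_{il}+\partial_i g_{jl}-\partial_l g_{ij}),\qquad R_{ijkl}=g_{lm}\big(\partial_k\Gamma_{ij}^m-\partial_j\Gamma_{ik}^m+\Gamma_{ij}^n\Gamma_{nk}^m-\Gamma_{ik}^n\Gamma_{nj}^m\big).$$ The Gauss-Codazzi-Ricci system for unknowns $(h_{ij}^a,\kappa_{lb}^a)$ with $h_{ij}^a=h_{ji}^a$ (coefficients of the second fundamental form) and $\kappa_{kb}^a=-\kappa_{ka}^b$ (coefficients of the connection form on the normal bundle) consists of Gauss: $h_{ji}^ah_{kl}^a-h_{ki}^ah_{jl}^a=R_{ijkl}$; Codazzi: $\partial_k h_{lj}^a-\partial_l h_{kj}^a+\Gamma_{lj}^m h_{km}^a-\Gamma_{kj}^m h_{lm}^a+\kappa_{kb}^a h_{lj}^b-\kappa_{lb}^a h_{kj}^b=0$; Ricci: $\partial_k\kappa_{lb}^a-\partial_l\kappa_{kb}^a-g^{mn}(h_{ml}^ah_{kn}^b-h_{mk}^ah_{ln}^b)+\kappa_{kc}^a\kappa_{lb}^c-\kappa_{lc}^a\kappa_{kb}^c=0$.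 A weak solution is a field $(h,\kappa)$ satisfying these equations in the sense of distributions on $\Omega$. *)

theory Defs
  imports "HOL-Analysis.Analysis" "HOL-Library.Function_Algebras"
begin

section \<open>Partial derivatives and test functions\<close>

definition partial_deriv :: "'d \<Rightarrow> (real ^ 'd \<Rightarrow> real) \<Rightarrow> real ^ 'd \<Rightarrow> real" where
  "partial_deriv j f x = deriv (\<lambda>t. f (x + t *\<^sub>R axis j 1)) 0"

text \<open>Meant for open \<open>S\<close>.\<close>

primrec Ck_on :: "nat \<Rightarrow> (real ^ 'd) set \<Rightarrow> (real ^ 'd \<Rightarrow> real) \<Rightarrow> bool" where
  "Ck_on 0 S f \<longleftrightarrow> continuous_on S f"
| "Ck_on (Suc k) S f \<longleftrightarrow> f differentiable_on S \<and> (\<forall>j. Ck_on k S (partial_deriv j f))"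

definition support :: "(real ^ 'd \<Rightarrow> real) \<Rightarrow> (real ^ 'd) set" where
  "support \<phi> = closure {x. \<phi> x \<noteq> 0}"

definition test_functions :: "(real ^ 'd) set \<Rightarrow> (real ^ 'd \<Rightarrow> real) set" where
  "test_functions \<Omega> =
     {\<phi>. (\<forall>k. Ck_on k UNIV \<phi>) \<and> compact (support \<phi>) \<and> support \<phi> \<subseteq> \<Omega>}"


section \<open>Distributions\<close>

text \<open>
  A functional on \<open>test_functions \<Omega>\<close> is encoded as a HOL function that vanishes on all
  other arguments. Equality of distributions is then equality of functions, and the pointwise
  operations on functions are the operations on distributions.
\<close>

type_synonym 'd functional = "(real ^ 'd \<Rightarrow> real) \<Rightarrow> real"

definition linear_functional :: "(real ^ 'd) set \<Rightarrow> 'd functional \<Rightarrow> bool" where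
  "linear_functional \<Omega> T \<longleftrightarrow>
     (\<forall>\<phi>. \<phi> \<notin> test_functions \<Omega> \<longrightarrow> T \<phi> = 0) \<and>
     (\<forall>\<phi>\<in>test_functions \<Omega>. \<forall>\<psi>\<in>test_functions \<Omega>. T (\<lambda>x. \<phi> x + \<psi> x) = T \<phi> + T \<psi>) \<and>
     (\<forall>c. \<forall>\<phi>\<in>test_functions \<Omega>. T (\<lambda>x. c * \<phi> x) = c * T \<phi>)"

definition distribution :: "(real ^ 'd) set \<Rightarrow> 'd functional \<Rightarrow> bool" where
  "distribution \<Omega> T \<longleftrightarrow> linear_functional \<Omega> T \<and>
     (\<forall>K. compact K \<and> K \<subseteq> \<Omega> \<longrightarrow>
       (\<exists>m B. \<forall>\<phi>\<in>test_functions \<Omega>. support \<phi> \<subseteq> K \<longrightarrow>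
          \<bar>T \<phi>\<bar> \<le> B * (\<Sum>js\<in>{js :: 'd list. length js \<le> m}. SUP x. \<bar>foldr partial_deriv js \<phi> x\<bar>)))"

definition regular_dist :: "(real ^ 'd) set \<Rightarrow> (real ^ 'd \<Rightarrow> real) \<Rightarrow> 'd functional" where
  "regular_dist \<Omega> f =
     (\<lambda>\<phi>. if \<phi> \<in> test_functions \<Omega> then integral\<^sup>L (lebesgue_on \<Omega>) (\<lambda>x. f x * \<phi> x) else 0)"

definition dist_deriv :: "(real ^ 'd) set \<Rightarrow> 'd \<Rightarrow> 'd functional \<Rightarrow> 'd functional" where
  "dist_deriv \<Omega> j T = (\<lambda>\<phi>. if \<phi> \<in> test_functions \<Omega> then - T (partial_deriv j \<phi>) else 0)"

definition dist_tendsto ::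
    "(real ^ 'd) set \<Rightarrow> ('e \<Rightarrow> 'd functional) \<Rightarrow> 'd functional \<Rightarrow> 'e filter \<Rightarrow> bool" where
  "dist_tendsto \<Omega> T T' F \<longleftrightarrow> (\<forall>\<phi>\<in>test_functions \<Omega>. ((\<lambda>e. T e \<phi>) \<longlongrightarrow> T' \<phi>) F)"

text \<open>The distribution \<open>\<partial>\<^sub>k u - \<partial>\<^sub>l v\<close>.\<close>

definition curl_dist ::
    "(real ^ 'd) set \<Rightarrow> 'd \<Rightarrow> (real ^ 'd \<Rightarrow> real) \<Rightarrow> 'd \<Rightarrow> (real ^ 'd \<Rightarrow> real) \<Rightarrow> 'd functional" where
  "curl_dist \<Omega> k u l v =
     dist_deriv \<Omega> k (regular_dist \<Omega> u) - dist_deriv \<Omega> l (regular_dist \<Omega> v)"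


section \<open>The spaces \<open>L\<^sup>2(\<Omega>)\<close> and \<open>H\<^sup>-\<^sup>1\<^sub>l\<^sub>o\<^sub>c(\<Omega>)\<close>\<close>

definition in_L2 :: "(real ^ 'd) set \<Rightarrow> (real ^ 'd \<Rightarrow> real) \<Rightarrow> bool" where
  "in_L2 \<Omega> f \<longleftrightarrow> f \<in> borel_measurable (lebesgue_on \<Omega>) \<and> integrable (lebesgue_on \<Omega>) (\<lambda>x. (f x)\<^sup>2)"

definition weakly_in_L2 ::
    "(real ^ 'd) set \<Rightarrow> (nat \<Rightarrow> real ^ 'd \<Rightarrow> real) \<Rightarrow> (real ^ 'd \<Rightarrow> real) \<Rightarrow> bool" where
  "weakly_in_L2 \<Omega> f f' \<longleftrightarrow> (\<forall>n. in_L2 \<Omega> (f n)) \<and> in_L2 \<Omega> f' \<and>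
     (\<forall>\<psi>. in_L2 \<Omega> \<psi> \<longrightarrow>
       (\<lambda>n. integral\<^sup>L (lebesgue_on \<Omega>) (\<lambda>x. f n x * \<psi> x))
         \<longlonglongrightarrow> integral\<^sup>L (lebesgue_on \<Omega>) (\<lambda>x. f' x * \<psi> x))"

definition H1_norm :: "(real ^ 'd) set \<Rightarrow> (real ^ 'd \<Rightarrow> real) \<Rightarrow> real" where
  "H1_norm U \<phi> =
     sqrt (integral\<^sup>L (lebesgue_on U) (\<lambda>x. (\<phi> x)\<^sup>2 + (\<Sum>j\<in>UNIV. (partial_deriv j \<phi> x)\<^sup>2)))"

text \<open>
  \<open>H\<^sup>-\<^sup>1(U)\<close> is the dual of \<open>H\<^sup>1\<^sub>0(U)\<close>, the closure of \<open>test_functions U\<close> in \<open>H\<^sup>1(U)\<close>.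
  So it suffices to bound \<open>T\<close> on test functions, and the dual norm is a supremum over them.
\<close>

definition in_Hneg1 :: "(real ^ 'd) set \<Rightarrow> 'd functional \<Rightarrow> bool" where
  "in_Hneg1 U T \<longleftrightarrow> (\<exists>B. \<forall>\<phi>\<in>test_functions U. \<bar>T \<phi>\<bar> \<le> B * H1_norm U \<phi>)"

definition Hneg1_norm :: "(real ^ 'd) set \<Rightarrow> 'd functional \<Rightarrow> real" where
  "Hneg1_norm U T = (SUP \<phi>\<in>{\<phi> \<in> test_functions U. H1_norm U \<phi> \<le> 1}. \<bar>T \<phi>\<bar>)"

definition inner_subdomain :: "(real ^ 'd) set \<Rightarrow> (real ^ 'd) set \<Rightarrow> bool" where
  "inner_subdomain U \<Omega> \<longleftrightarrow> open U \<and> compact (closure U) \<and> closure U \<subseteq> \<Omega>"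

definition Hneg1_loc :: "(real ^ 'd) set \<Rightarrow> 'd functional set" where
  "Hneg1_loc \<Omega> = {T. distribution \<Omega> T \<and> (\<forall>U. inner_subdomain U \<Omega> \<longrightarrow> in_Hneg1 U T)}"

text \<open>The locally convex topology given by the seminorms \<open>Hneg1_norm U\<close>, \<open>U\<close> relatively compact
  in \<open>\<Omega>\<close>; its points are exactly the elements of \<open>Hneg1_loc \<Omega>\<close>.\<close>

definition Hneg1_loc_topology :: "(real ^ 'd) set \<Rightarrow> 'd functional topology" where
  "Hneg1_loc_topology \<Omega> = topology_generated_by
     {{S \<in> Hneg1_loc \<Omega>. Hneg1_norm U (S - T) < r} | U T r.
        inner_subdomain U \<Omega> \<and> T \<in> Hneg1_loc \<Omega> \<and> r > 0}"


section \<open>Riemannian metrics\<close>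

text \<open>Class \<open>C\<^sup>2\<close> is what the classical formula for the curvature needs.\<close>

definition riemannian_metric :: "(real ^ 'd) set \<Rightarrow> (real ^ 'd \<Rightarrow> real ^ 'd ^ 'd) \<Rightarrow> bool" where
  "riemannian_metric \<Omega> g \<longleftrightarrow>
     (\<forall>i j. Ck_on 2 \<Omega> (\<lambda>x. g x $ i $ j)) \<and>
     (\<forall>x\<in>\<Omega>. transpose (g x) = g x \<and> (\<forall>v. v \<noteq> 0 \<longrightarrow> v \<bullet> (g x *v v) > 0))"

text \<open>\<open>christoffel g k i j\<close> is \<open>\<Gamma>\<^sup>k\<^sub>i\<^sub>j\<close>.\<close>

definition christoffel ::
    "(real ^ 'd \<Rightarrow> real ^ 'd ^ 'd) \<Rightarrow> 'd \<Rightarrow> 'd \<Rightarrow> 'd \<Rightarrow> real ^ 'd \<Rightarrow> real" where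
  "christoffel g k i j x =
     1 / 2 * (\<Sum>l\<in>UNIV. matrix_inv (g x) $ k $ l *
       (partial_deriv j (\<lambda>y. g y $ i $ l) x + partial_deriv i (\<lambda>y. g y $ j $ l) x
          - partial_deriv l (\<lambda>y. g y $ i $ j) x))"

definition riemann ::
    "(real ^ 'd \<Rightarrow> real ^ 'd ^ 'd) \<Rightarrow> 'd \<Rightarrow> 'd \<Rightarrow> 'd \<Rightarrow> 'd \<Rightarrow> real ^ 'd \<Rightarrow> real" where
  "riemann g i j k l x =
     (\<Sum>m\<in>UNIV. g x $ l $ m *
       (partial_deriv k (christoffel g m i j) x - partial_deriv j (christoffel g m i k) x
        + (\<Sum>n\<in>UNIV. christoffel g n i j x * christoffel g m n k x)
        - (\<Sum>n\<in>UNIV. christoffel g n i k x * christoffel g m n j x)))"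


section \<open>The Gauss-Codazzi-Ricci system\<close>

text \<open>
  \<open>h a i j\<close> is \<open>h\<^sup>a\<^sub>i\<^sub>j\<close> and \<open>\<kappa> a l b\<close> is \<open>\<kappa>\<^sup>a\<^sub>l\<^sub>b\<close>. The normal indices run over \<open>{1..p}\<close>, where
  \<open>p = N - d\<close> is the codimension; values at other indices are irrelevant.
\<close>

type_synonym 'd second_form = "nat \<Rightarrow> 'd \<Rightarrow> 'd \<Rightarrow> real ^ 'd \<Rightarrow> real"
type_synonym 'd normal_form = "nat \<Rightarrow> 'd \<Rightarrow> nat \<Rightarrow> real ^ 'd \<Rightarrow> real"

text \<open>Fields are determined up to null sets, so the algebraic symmetries are required almost
  everywhere.\<close>

definition symmetric_field ::
    "(real ^ 'd) set \<Rightarrow> nat \<Rightarrow> 'd second_form \<Rightarrow> 'd normal_form \<Rightarrow> bool" where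
  "symmetric_field \<Omega> p h \<kappa> \<longleftrightarrow>
     (\<forall>a\<in>{1..p}. \<forall>i j. AE x in lebesgue_on \<Omega>. h a i j x = h a j i x) \<and>
     (\<forall>a\<in>{1..p}. \<forall>b\<in>{1..p}. \<forall>k. AE x in lebesgue_on \<Omega>. \<kappa> a k b x = - \<kappa> b k a x)"

definition L2_field ::
    "(real ^ 'd) set \<Rightarrow> nat \<Rightarrow> 'd second_form \<Rightarrow> 'd normal_form \<Rightarrow> bool" where
  "L2_field \<Omega> p h \<kappa> \<longleftrightarrow>
     (\<forall>a\<in>{1..p}. \<forall>i j. in_L2 \<Omega> (h a i j)) \<and>
     (\<forall>a\<in>{1..p}. \<forall>b\<in>{1..p}. \<forall>l. in_L2 \<Omega> (\<kappa> a l b))"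

definition L2_field_norm ::
    "(real ^ 'd) set \<Rightarrow> nat \<Rightarrow> 'd second_form \<Rightarrow> 'd normal_form \<Rightarrow> real" where
  "L2_field_norm \<Omega> p h \<kappa> = sqrt (integral\<^sup>L (lebesgue_on \<Omega>) (\<lambda>x.
     (\<Sum>a\<in>{1..p}. \<Sum>i\<in>UNIV. \<Sum>j\<in>UNIV. (h a i j x)\<^sup>2) +
     (\<Sum>a\<in>{1..p}. \<Sum>l\<in>UNIV. \<Sum>b\<in>{1..p}. (\<kappa> a l b x)\<^sup>2)))"

definition gauss_quad ::
    "nat \<Rightarrow> 'd second_form \<Rightarrow> 'd \<Rightarrow> 'd \<Rightarrow> 'd \<Rightarrow> 'd \<Rightarrow> real ^ 'd \<Rightarrow> real" where
  "gauss_quad p h i j k l x =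
     (\<Sum>a\<in>{1..p}. h a j i x * h a k l x) - (\<Sum>a\<in>{1..p}. h a k i x * h a j l x)"

definition codazzi_quad ::
    "nat \<Rightarrow> 'd second_form \<Rightarrow> 'd normal_form \<Rightarrow> nat \<Rightarrow> 'd \<Rightarrow> 'd \<Rightarrow> 'd \<Rightarrow> real ^ 'd \<Rightarrow> real" where
  "codazzi_quad p h \<kappa> a j k l x =
     (\<Sum>b\<in>{1..p}. \<kappa> a k b x * h b l j x) - (\<Sum>b\<in>{1..p}. \<kappa> a l b x * h b k j x)"

definition ricci_quad_h ::
    "(real ^ 'd \<Rightarrow> real ^ 'd ^ 'd) \<Rightarrow> 'd second_form \<Rightarrow> nat \<Rightarrow> nat \<Rightarrow> 'd \<Rightarrow> 'd
      \<Rightarrow> real ^ 'd \<Rightarrow> real" where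
  "ricci_quad_h g h a b k l x =
     (\<Sum>m\<in>UNIV. \<Sum>n\<in>UNIV. matrix_inv (g x) $ m $ n *
        (h a m l x * h b k n x - h a m k x * h b l n x))"

definition ricci_quad_\<kappa> ::
    "nat \<Rightarrow> 'd normal_form \<Rightarrow> nat \<Rightarrow> nat \<Rightarrow> 'd \<Rightarrow> 'd \<Rightarrow> real ^ 'd \<Rightarrow> real" where
  "ricci_quad_\<kappa> p \<kappa> a b k l x =
     (\<Sum>c\<in>{1..p}. \<kappa> a k c x * \<kappa> c l b x) - (\<Sum>c\<in>{1..p}. \<kappa> a l c x * \<kappa> c k b x)"

definition codazzi_lhs ::
    "(real ^ 'd) set \<Rightarrow> (real ^ 'd \<Rightarrow> real ^ 'd ^ 'd) \<Rightarrow> nat \<Rightarrow> 'd second_form \<Rightarrow> 'd normal_form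
      \<Rightarrow> nat \<Rightarrow> 'd \<Rightarrow> 'd \<Rightarrow> 'd \<Rightarrow> 'd functional" where
  "codazzi_lhs \<Omega> g p h \<kappa> a j k l =
     curl_dist \<Omega> k (h a l j) l (h a k j)
     + regular_dist \<Omega> (\<lambda>x. (\<Sum>m\<in>UNIV. christoffel g m l j x * h a k m x)
                           - (\<Sum>m\<in>UNIV. christoffel g m k j x * h a l m x))
     + regular_dist \<Omega> (codazzi_quad p h \<kappa> a j k l)"

definition ricci_lhs ::
    "(real ^ 'd) set \<Rightarrow> (real ^ 'd \<Rightarrow> real ^ 'd ^ 'd) \<Rightarrow> nat \<Rightarrow> 'd second_form \<Rightarrow> 'd normal_form
      \<Rightarrow> nat \<Rightarrow> nat \<Rightarrow> 'd \<Rightarrow> 'd \<Rightarrow> 'd functional" where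
  "ricci_lhs \<Omega> g p h \<kappa> a b k l =
     curl_dist \<Omega> k (\<kappa> a l b) l (\<kappa> a k b)
     - regular_dist \<Omega> (ricci_quad_h g h a b k l)
     + regular_dist \<Omega> (ricci_quad_\<kappa> p \<kappa> a b k l)"

definition weak_solution_GCR ::
    "(real ^ 'd) set \<Rightarrow> (real ^ 'd \<Rightarrow> real ^ 'd ^ 'd) \<Rightarrow> nat
      \<Rightarrow> 'd second_form \<Rightarrow> 'd normal_form \<Rightarrow> bool" where
  "weak_solution_GCR \<Omega> g p h \<kappa> \<longleftrightarrow> symmetric_field \<Omega> p h \<kappa> \<and>
     (\<forall>i j k l. regular_dist \<Omega> (gauss_quad p h i j k l) = regular_dist \<Omega> (riemann g i j k l)) \<and>
     (\<forall>a\<in>{1..p}. \<forall>j k l. codazzi_lhs \<Omega> g p h \<kappa> a j k l = 0) \<and>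
     (\<forall>a\<in>{1..p}. \<forall>b\<in>{1..p}. \<forall>k l. ricci_lhs \<Omega> g p h \<kappa> a b k l = 0)"

end

theory Submission
  imports Defs "HOL-Library.Diagonal_Subsequence"
begin

text \<open>
  Every quadratic expression of the system is a sum of terms \<open>c (u\<^sub>k v\<^sub>l - u\<^sub>l v\<^sub>k)\<close> with \<open>c\<close> continuous,
  where the curls \<open>\<partial>\<^sub>k u\<^sub>l - \<partial>\<^sub>l u\<^sub>k\<close> and \<open>\<partial>\<^sub>k v\<^sub>l - \<partial>\<^sub>l v\<^sub>k\<close> are precompact in \<open>H\<^sup>-\<^sup>1\<close>. So everything
  follows from the div-curl lemma: such a form passes to the limit along weakly convergent sequences
  in \<open>L\<^sup>2\<close>.

  The div-curl lemma is proved without Fourier analysis. Subtracting the limits one may assume \<open>u\<close> and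
  \<open>v\<close> to tend weakly to \<open>0\<close>, with curls tending to \<open>0\<close> in \<open>H\<^sup>-\<^sup>1\<close>. The functions \<open>\<psi> - \<Delta>\<psi>\<close> with \<open>\<psi>\<close> a test
  function are dense in \<open>L\<^sup>2\<close> (an orthogonal \<open>r\<close> gives bounded solutions of \<open>F = \<Delta>F\<close>, which vanish by
  the maximum principle), and \<open>\<psi> - \<Delta>\<psi>\<close> controls the \<open>H\<^sup>2\<close>-norm of \<open>\<psi>\<close>. Writing the localised \<open>u\<^sub>k\<close> as
  \<open>\<Psi>\<^sub>k - \<Delta>\<Psi>\<^sub>k\<close> up to a small error, the field \<open>\<theta> = \<partial>\<^sub>l \<Psi>\<^sub>k - \<partial>\<^sub>k \<Psi>\<^sub>l\<close> tends to \<open>0\<close> in \<open>H\<^sup>1\<close> since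
  \<open>\<theta> - \<Delta>\<theta>\<close> is the curl of \<open>u\<close>, and the curl condition on \<open>v\<close> turns the integral of \<open>u\<^sub>k v\<^sub>l - u\<^sub>l v\<^sub>k\<close> into
  that of \<open>\<Sum>\<^sub>m v\<^sub>m \<partial>\<^sub>m \<theta>\<close> up to terms that vanish by Rellich's theorem.
\<close>

section \<open>Smooth functions\<close>

text \<open>Two features of the setting shape the div-curl argument. Compactness of the curls is
  known only against test functions supported in an inner subdomain, while the functions \<Psi> and
  their curl \<theta> live on the whole space. Hence both sequences carry a cutoff: one makes the
  curl of \<open>u\<close> testable against \<theta>, the other makes the curl of \<open>v\<close>
  testable against the first derivatives of \<Psi>. Each cutoff leaves commutators of order zero,
  and these are what Rellich's theorem removes. Moreover \<Psi> is chosen anew for every index of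
  the sequence, with an error tending to 0, so only its \<open>H\<^sup>2\<close> bound is available
  and never a convergence of \<Psi> itself. Antisymmetry is decisive: exchanging a derivative index
  of the Laplacian with the index of \<open>v\<close> turns the two products into pairings of
  \<open>v\<^sub>m\<close> with \<open>\<partial>\<^sub>l \<partial>\<^sub>m \<Psi>\<^sub>k\<close>
  and \<open>\<partial>\<^sub>k \<partial>\<^sub>m \<Psi>\<^sub>l\<close>. Neither is small, but
  their difference contains \<Psi> only through \<theta>.\<close>

lemma has_derivative_along_axis:
  assumes "(f has_derivative f') (at (x + t *\<^sub>R axis j 1))"
  shows "((\<lambda>t. f (x + t *\<^sub>R axis j 1)) has_real_derivative f' (axis j 1)) (at t)"
proof -
  have "((\<lambda>t. x + t *\<^sub>R axis j 1) has_derivative (\<lambda>s. s *\<^sub>R axis j 1)) (at t)"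
    by (auto intro!: derivative_eq_intros)
  from has_derivative_compose[OF this assms]
  have "((\<lambda>t. f (x + t *\<^sub>R axis j 1)) has_derivative (\<lambda>s. f' (s *\<^sub>R axis j 1))) (at t)" .
  moreover have "f' (s *\<^sub>R axis j 1) = f' (axis j 1) * s" for s
    using assms by (simp add: has_derivative_def bounded_linear_def linear_cmul)
  ultimately show ?thesis by (simp add: has_field_derivative_def)
qed

lemma partial_deriv_eq:
  assumes "(f has_derivative f') (at x)"
  shows "partial_deriv j f x = f' (axis j 1)"
  unfolding partial_deriv_def
  by (rule DERIV_imp_deriv) (use has_derivative_along_axis[of f f' x 0 j] assms in simp)

lemma has_derivative_partial_deriv:
  assumes "f differentiable (at x)"
  shows "(f has_derivative (\<lambda>v. \<Sum>j\<in>UNIV. v $ j * partial_deriv j f x)) (at x)"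
proof -
  obtain f' where f': "(f has_derivative f') (at x)" using assms differentiable_def by blast
  then have lin: "linear f'" by (simp add: has_derivative_def bounded_linear.linear)
  have "f' v = (\<Sum>j\<in>UNIV. v $ j * partial_deriv j f x)" for v
  proof -
    have "f' v = f' (\<Sum>j\<in>UNIV. (v $ j) *\<^sub>R axis j 1)"
      using basis_expansion[of v] by (simp add: scalar_mult_eq_scaleR)
    also have "\<dots> = (\<Sum>j\<in>UNIV. v $ j * f' (axis j 1))"
      using lin by (simp add: linear_sum linear_cmul)
    finally show ?thesis using partial_deriv_eq[OF f'] by simp
  qed
  then have "f' = (\<lambda>v. \<Sum>j\<in>UNIV. v $ j * partial_deriv j f x)" by auto
  then show ?thesis using f' by simp
qed

lemma partial_deriv_const: "partial_deriv j (\<lambda>x. c) = (\<lambda>x. 0)"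
  by (rule ext, subst partial_deriv_eq[where f'="\<lambda>_. 0"]) auto

lemma partial_deriv_add:
  assumes "f differentiable (at x)" "g differentiable (at x)"
  shows "partial_deriv j (\<lambda>x. f x + g x) x = partial_deriv j f x + partial_deriv j g x"
proof -
  obtain f' g' where d: "(f has_derivative f') (at x)" "(g has_derivative g') (at x)"
    using assms differentiable_def by blast
  show ?thesis
    using partial_deriv_eq[OF has_derivative_add[OF d]] partial_deriv_eq[OF d(1)] partial_deriv_eq[OF d(2)]
    by simp
qed

lemma partial_deriv_mult:
  assumes "f differentiable (at x)" "g differentiable (at x)"
  shows "partial_deriv j (\<lambda>x. f x * g x) x = partial_deriv j f x * g x + f x * partial_deriv j g x"
proof -
  obtain f' g' where d: "(f has_derivative f') (at x)" "(g has_derivative g') (at x)"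
    using assms differentiable_def by blast
  show ?thesis
    using partial_deriv_eq[OF has_derivative_mult[OF d]] partial_deriv_eq[OF d(1)] partial_deriv_eq[OF d(2)]
    by simp
qed

lemma Ck_on_Suc_imp: "Ck_on (Suc k) S f \<Longrightarrow> Ck_on k S f"
  by (induction k arbitrary: f) (auto simp: differentiable_imp_continuous_on)

definition smooth :: "(real ^ 'd \<Rightarrow> real) \<Rightarrow> bool" where
  "smooth f \<longleftrightarrow> (\<forall>k. Ck_on k UNIV f)"

lemma smooth_differentiable: "smooth f \<Longrightarrow> f differentiable (at x)"
  unfolding smooth_def using Ck_on.simps(2)[of 0 UNIV f] by (metis UNIV_I differentiable_on_def)

lemma smooth_continuous: "smooth f \<Longrightarrow> continuous_on S f"
  by (meson continuous_on_subset smooth_def Ck_on.simps(1) top_greatest)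

lemma smooth_partial: "smooth f \<Longrightarrow> smooth (partial_deriv j f)"
  unfolding smooth_def using Ck_on.simps(2) by blast

lemma Ck_on_const: "Ck_on k UNIV (\<lambda>x. c)"
  by (induction k arbitrary: c) (auto simp: partial_deriv_const)

lemma Ck_on_add:
  "Ck_on k UNIV f \<Longrightarrow> Ck_on k UNIV g \<Longrightarrow> Ck_on k UNIV (\<lambda>x. f x + g x)"
proof (induction k arbitrary: f g)
  case 0 then show ?case by (simp add: continuous_on_add continuous_on_mult)
next
  case (Suc k)
  have d: "f differentiable (at x)" "g differentiable (at x)" for x
    using Suc.prems by (simp_all add: differentiable_on_def)
  have *: "partial_deriv j (\<lambda>x. f x + g x) = (\<lambda>x. partial_deriv j f x + partial_deriv j g x)" for j
    by (rule ext) (rule partial_deriv_add[OF d])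
  have "Ck_on k UNIV (partial_deriv j (\<lambda>x. f x + g x))" for j
    unfolding * by (rule Suc.IH) (use Suc.prems in simp_all)
  moreover have "(\<lambda>x. f x + g x) differentiable_on UNIV"
    using Suc.prems by (simp add: differentiable_on_add)
  ultimately show ?case by simp
qed

lemma Ck_on_mult:
  "Ck_on k UNIV f \<Longrightarrow> Ck_on k UNIV g \<Longrightarrow> Ck_on k UNIV (\<lambda>x. f x * g x)"
proof (induction k arbitrary: f g)
  case 0 then show ?case by (simp add: continuous_on_add continuous_on_mult)
next
  case (Suc k)
  have d: "f differentiable (at x)" "g differentiable (at x)" for x
    using Suc.prems by (simp_all add: differentiable_on_def)
  have *: "partial_deriv j (\<lambda>x. f x * g x)
      = (\<lambda>x. partial_deriv j f x * g x + f x * partial_deriv j g x)" for j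
    by (rule ext) (rule partial_deriv_mult[OF d])
  \<comment> \<open>The product rule multiplies a derivative by an undifferentiated factor, so the
    induction hypothesis also needs both factors at the lower order.\<close>
  have fg: "Ck_on k UNIV f" "Ck_on k UNIV g" using Suc.prems Ck_on_Suc_imp by blast+
  have "Ck_on k UNIV (partial_deriv j (\<lambda>x. f x * g x))" for j
    unfolding * by (intro Ck_on_add; rule Suc.IH) (use Suc.prems fg in simp_all)
  moreover have "(\<lambda>x. f x * g x) differentiable_on UNIV"
    using Suc.prems by (simp add: differentiable_on_mult)
  ultimately show ?case by simp
qed

lemma smooth_const: "smooth (\<lambda>x. c)"
  by (simp add: smooth_def Ck_on_const)

lemma smooth_add: "smooth f \<Longrightarrow> smooth g \<Longrightarrow> smooth (\<lambda>x. f x + g x)"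
  by (simp add: smooth_def Ck_on_add)

lemma smooth_mult: "smooth f \<Longrightarrow> smooth g \<Longrightarrow> smooth (\<lambda>x. f x * g x)"
  by (simp add: smooth_def Ck_on_mult)

lemma smooth_diff: "smooth f \<Longrightarrow> smooth g \<Longrightarrow> smooth (\<lambda>x. f x - g x)"
  using smooth_add[of f "\<lambda>x. (-1) * g x"] smooth_mult[OF smooth_const, of g "-1"] by simp

lemma smooth_sum: "(\<And>i. i \<in> I \<Longrightarrow> smooth (f i)) \<Longrightarrow> smooth (\<lambda>x. \<Sum>i\<in>I. f i x)"
  by (induction I rule: infinite_finite_induct) (auto intro: smooth_const smooth_add)

lemma smooth_prod: "(\<And>i. i \<in> I \<Longrightarrow> smooth (f i)) \<Longrightarrow> smooth (\<lambda>x. \<Prod>i\<in>I. f i x)"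
  by (induction I rule: infinite_finite_induct) (auto intro: smooth_const smooth_mult)

lemma smooth_power: "smooth f \<Longrightarrow> smooth (\<lambda>x. f x ^ n)"
  by (induction n) (auto intro: smooth_const smooth_mult)

lemma partial_add: "smooth f \<Longrightarrow> smooth g \<Longrightarrow>
    partial_deriv j (\<lambda>x. f x + g x) = (\<lambda>x. partial_deriv j f x + partial_deriv j g x)"
  by (rule ext) (intro partial_deriv_add smooth_differentiable)

lemma partial_mult: "smooth f \<Longrightarrow> smooth g \<Longrightarrow>
    partial_deriv j (\<lambda>x. f x * g x) = (\<lambda>x. partial_deriv j f x * g x + f x * partial_deriv j g x)"
  by (rule ext) (intro partial_deriv_mult smooth_differentiable)

lemma partial_cmult: "smooth f \<Longrightarrow>
    partial_deriv j (\<lambda>x. c * f x) = (\<lambda>x. c * partial_deriv j f x)"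
  using partial_mult[OF smooth_const, of f j c] by (simp add: partial_deriv_const)

lemma partial_diff: "smooth f \<Longrightarrow> smooth g \<Longrightarrow>
    partial_deriv j (\<lambda>x. f x - g x) = (\<lambda>x. partial_deriv j f x - partial_deriv j g x)"
  using partial_add[of f "\<lambda>x. (-1) * g x" j] partial_cmult[of g j "-1"]
    smooth_mult[OF smooth_const, of g "-1"] by simp

lemma partial_sum: "(\<And>i. i \<in> I \<Longrightarrow> smooth (f i)) \<Longrightarrow>
    partial_deriv j (\<lambda>x. \<Sum>i\<in>I. f i x) = (\<lambda>x. \<Sum>i\<in>I. partial_deriv j (f i) x)"
proof (induction I rule: infinite_finite_induct)
  case (insert i I)
  then show ?case using partial_add[of "f i" "\<lambda>x. \<Sum>i\<in>I. f i x" j] smooth_sum[of I f] by simp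
qed (auto simp: partial_deriv_const)

lemma smooth_DERIV:
  assumes "smooth f"
  shows "((\<lambda>t. f (x + t *\<^sub>R axis j 1)) has_real_derivative
    partial_deriv j f (x + t *\<^sub>R axis j 1)) (at t)"
proof -
  obtain f' where f': "(f has_derivative f') (at (x + t *\<^sub>R axis j 1))"
    using smooth_differentiable[OF assms] differentiable_def by blast
  show ?thesis using has_derivative_along_axis[OF f'] partial_deriv_eq[OF f'] by simp
qed

lemma partial_translation: "partial_deriv j (\<lambda>x. f (x + z)) = (\<lambda>x. partial_deriv j f (x + z))"
  unfolding partial_deriv_def by (simp add: algebra_simps)

lemma smooth_translation: "smooth f \<Longrightarrow> smooth (\<lambda>x. f (x + z))"
proof -
  have "Ck_on k UNIV f \<Longrightarrow> Ck_on k UNIV (\<lambda>x. f (x + z))" for k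
  proof (induction k arbitrary: f)
    case 0 then show ?case by (auto intro!: continuous_on_compose2[of UNIV f] continuous_intros)
  next
    case (Suc k)
    then have "(\<lambda>x. f (x + z)) differentiable_on UNIV"
      using differentiable_compose[of f "\<lambda>x. x + z" _ UNIV] by (auto simp: differentiable_on_def intro!: derivative_intros)
    with Suc show ?case by (simp add: partial_translation)
  qed
  then show "smooth f \<Longrightarrow> smooth (\<lambda>x. f (x + z))" by (simp add: smooth_def)
qed

lemma smooth_linear:
  fixes f :: "real ^ 'd \<Rightarrow> real"
  assumes "bounded_linear f" shows "smooth f"
proof -
  have "Ck_on k UNIV f" for k
  proof (cases k)
    case 0 then show ?thesis using assms by (simp add: linear_continuous_on)
  next
    case (Suc n)
    have "(f has_derivative f) (at x)" for x using assms by (rule bounded_linear_imp_has_derivative)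
    then have "partial_deriv j f = (\<lambda>x. f (axis j 1))" for j
      using partial_deriv_eq by blast
    then show ?thesis using Suc assms
      by (auto simp: Ck_on_const differentiable_on_def intro: bounded_linear_imp_differentiable)
  qed
  then show ?thesis by (simp add: smooth_def)
qed

lemma smooth_polynomial:
  fixes q :: "real ^ 'd \<Rightarrow> real"
  shows "real_polynomial_function q \<Longrightarrow> smooth q"
  by (induction q rule: real_polynomial_function.induct)
     (auto intro: smooth_linear smooth_const smooth_add smooth_mult)

text \<open>The mean value theorem is applied twice: in direction \<open>k\<close> to the increment
  \<open>G\<close> of \<open>f\<close> in direction \<open>j\<close>, then in direction
  \<open>j\<close> to the partial derivative so obtained. Distinct directions give the symmetry of
  second derivatives; \<open>j = k\<close> gives the second differences of the maximum
  principle.\<close>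

lemma second_difference_MVT:
  assumes f: "smooth f" and t: "t > 0"
  shows "\<exists>s r. 0 < s \<and> s < t \<and> 0 < r \<and> r < t \<and>
      f (x + t *\<^sub>R axis j 1 + t *\<^sub>R axis k 1) - f (x + t *\<^sub>R axis j 1) - f (x + t *\<^sub>R axis k 1) + f x
      = t * t * partial_deriv j (partial_deriv k f) (x + r *\<^sub>R axis j 1 + s *\<^sub>R axis k 1)"
proof -
  define G where "G s = f (x + t *\<^sub>R axis j 1 + s *\<^sub>R axis k 1) - f (x + s *\<^sub>R axis k 1)" for s
  have "(G has_real_derivative
     partial_deriv k f (x + t *\<^sub>R axis j 1 + s *\<^sub>R axis k 1) - partial_deriv k f (x + s *\<^sub>R axis k 1)) (at s)" for s
    unfolding G_def by (intro DERIV_diff smooth_DERIV f)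
  from MVT2[of 0 t G, OF t this] obtain s where s: "0 < s" "s < t"
    "G t - G 0 = (t - 0) * (partial_deriv k f (x + t *\<^sub>R axis j 1 + s *\<^sub>R axis k 1) - partial_deriv k f (x + s *\<^sub>R axis k 1))"
    by blast
  have "((\<lambda>r. partial_deriv k f (x + s *\<^sub>R axis k 1 + r *\<^sub>R axis j 1)) has_real_derivative
      partial_deriv j (partial_deriv k f) (x + s *\<^sub>R axis k 1 + r *\<^sub>R axis j 1)) (at r)" for r
    by (intro smooth_DERIV smooth_partial f)
  from MVT2[of 0 t "\<lambda>r. partial_deriv k f (x + s *\<^sub>R axis k 1 + r *\<^sub>R axis j 1)", OF t this]
  obtain r where r: "0 < r" "r < t"
    "partial_deriv k f (x + s *\<^sub>R axis k 1 + t *\<^sub>R axis j 1) - partial_deriv k f (x + s *\<^sub>R axis k 1 + 0 *\<^sub>R axis j 1)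
     = (t - 0) * partial_deriv j (partial_deriv k f) (x + s *\<^sub>R axis k 1 + r *\<^sub>R axis j 1)"
    by blast
  show ?thesis
    by (rule exI[of _ s], rule exI[of _ r]) (use s r in \<open>simp add: G_def algebra_simps\<close>)
qed

text \<open>Both iterated partial derivatives are limits of the same second difference quotient.\<close>

lemma partial_deriv_commute:
  fixes f :: "real ^ 'd \<Rightarrow> real"
  assumes f: "smooth f"
  shows "partial_deriv j (partial_deriv k f) = partial_deriv k (partial_deriv j f)"
proof
  fix x
  define e where "e i = (axis i 1 :: real ^ 'd)" for i :: 'd
  note mv = second_difference_MVT[OF f, folded e_def]
  have lim: "((\<lambda>t. (f (x + t *\<^sub>R e j + t *\<^sub>R e k) - f (x + t *\<^sub>R e j) - f (x + t *\<^sub>R e k) + f x) / (t * t))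
     \<longlongrightarrow> partial_deriv j (partial_deriv k f) x) (at_right 0)" for j k
  proof (rule tendstoI)
    fix \<eta> :: real assume "\<eta> > 0"
    have "isCont (partial_deriv j (partial_deriv k f)) x"
      using smooth_continuous[of _ UNIV] f smooth_partial continuous_on_eq_continuous_at open_UNIV by blast
    then obtain d where d: "d > 0"
      "\<And>y. dist y x < d \<Longrightarrow> dist (partial_deriv j (partial_deriv k f) y) (partial_deriv j (partial_deriv k f) x) < \<eta>"
      using \<open>\<eta> > 0\<close> unfolding continuous_at_eps_delta by blast
    \<comment> \<open>The intermediate point is reached by two axis steps, each shorter than
      \<open>t\<close>, so it is closer than \<open>2 * t\<close> to \<open>x\<close>.\<close>
    have "\<forall>\<^sub>F t::real in at_right 0. t < d / 2" "\<forall>\<^sub>F t::real in at_right 0. t > 0"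
      using d(1) by (auto simp: eventually_at_right_field intro: exI[of _ "d/2"])
    then show "\<forall>\<^sub>F t in at_right 0. dist ((f (x + t *\<^sub>R e j + t *\<^sub>R e k) - f (x + t *\<^sub>R e j) - f (x + t *\<^sub>R e k) + f x) / (t * t))
        (partial_deriv j (partial_deriv k f) x) < \<eta>"
    proof eventually_elim
      case (elim t)
      obtain s r where sr: "0 < s" "s < t" "0 < r" "r < t"
        "f (x + t *\<^sub>R e j + t *\<^sub>R e k) - f (x + t *\<^sub>R e j) - f (x + t *\<^sub>R e k) + f x
      = t * t * partial_deriv j (partial_deriv k f) (x + r *\<^sub>R e j + s *\<^sub>R e k)"
        using mv[OF elim(2)] by blast
      have "dist (x + r *\<^sub>R e j + s *\<^sub>R e k) x = norm (r *\<^sub>R e j + s *\<^sub>R e k)"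
        by (simp add: dist_norm)
      also have "\<dots> \<le> r + s"
        by (rule order_trans[OF norm_triangle_ineq]) (use sr in \<open>simp add: e_def\<close>)
      finally have "dist (x + r *\<^sub>R e j + s *\<^sub>R e k) x < d" using sr elim by simp
      with d(2) sr elim show ?case by simp
    qed
  qed
  have eq: "(\<lambda>t. (f (x + t *\<^sub>R e k + t *\<^sub>R e j) - f (x + t *\<^sub>R e k) - f (x + t *\<^sub>R e j) + f x) / (t * t))
    = (\<lambda>t. (f (x + t *\<^sub>R e j + t *\<^sub>R e k) - f (x + t *\<^sub>R e j) - f (x + t *\<^sub>R e k) + f x) / (t * t))"
    by (rule ext) (simp add: algebra_simps)
  show "partial_deriv j (partial_deriv k f) x = partial_deriv k (partial_deriv j f) x"
    by (rule tendsto_unique[OF _ lim[of j k] lim[of k j, unfolded eq]]) simp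
qed


section \<open>The Hilbert space of square integrable functions\<close>

text \<open>The measure is arbitrary because both \<open>lebesgue_on \<Omega>\<close> and
  \<open>lebesgue\<close> on the whole space occur. Functions are not identified modulo null sets,
  so \<open>nrm\<close> is only a seminorm.\<close>

definition L2 :: "'a measure \<Rightarrow> ('a \<Rightarrow> real) set" where
  "L2 M = {f \<in> borel_measurable M. integrable M (\<lambda>x. (f x)\<^sup>2)}"

definition ip :: "'a measure \<Rightarrow> ('a \<Rightarrow> real) \<Rightarrow> ('a \<Rightarrow> real) \<Rightarrow> real" where
  "ip M f g = (\<integral>x. f x * g x \<partial>M)"

definition nrm :: "'a measure \<Rightarrow> ('a \<Rightarrow> real) \<Rightarrow> real" where
  "nrm M f = sqrt (ip M f f)"

lemma L2_measurable: "f \<in> L2 M \<Longrightarrow> f \<in> borel_measurable M"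
  by (simp add: L2_def)

lemma L2_integrable_mult:
  assumes "f \<in> L2 M" "g \<in> L2 M" shows "integrable M (\<lambda>x. f x * g x)"
proof (rule Bochner_Integration.integrable_bound[where f="\<lambda>x. (f x)\<^sup>2 + (g x)\<^sup>2"])
  show "integrable M (\<lambda>x. (f x)\<^sup>2 + (g x)\<^sup>2)" using assms by (simp add: L2_def)
  show "(\<lambda>x. f x * g x) \<in> borel_measurable M"
    using assms by (simp add: L2_def borel_measurable_times)
  have "\<bar>a * b\<bar> \<le> a\<^sup>2 + b\<^sup>2" for a b :: real
    using sum_squares_bound[of "\<bar>a\<bar>" "\<bar>b\<bar>"] mult_nonneg_nonneg[of "\<bar>a\<bar>" "\<bar>b\<bar>"]
    unfolding abs_mult power2_abs by linarith
  then show "AE x in M. norm (f x * g x) \<le> norm ((f x)\<^sup>2 + (g x)\<^sup>2)" by simp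
qed

lemma L2_add: assumes "f \<in> L2 M" "g \<in> L2 M" shows "(\<lambda>x. f x + g x) \<in> L2 M"
proof -
  have "integrable M (\<lambda>x. (f x)\<^sup>2 + (g x)\<^sup>2 + 2 * (f x * g x))"
    using L2_integrable_mult[OF assms] assms by (simp add: L2_def)
  then have "integrable M (\<lambda>x. (f x + g x)\<^sup>2)" by (simp add: power2_sum mult.assoc)
  then show ?thesis using assms by (simp add: L2_def borel_measurable_add)
qed

lemma L2_cmult: "f \<in> L2 M \<Longrightarrow> (\<lambda>x. c * f x) \<in> L2 M"
  by (simp add: L2_def power_mult_distrib borel_measurable_times)

lemma L2_diff: assumes "f \<in> L2 M" "g \<in> L2 M" shows "(\<lambda>x. f x - g x) \<in> L2 M"
  using L2_add[OF assms(1) L2_cmult[OF assms(2), of "-1"]] by simp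

lemma L2_0: "(\<lambda>x. 0) \<in> L2 M"
  by (simp add: L2_def)

lemma L2_sum: "(\<And>i. i \<in> I \<Longrightarrow> f i \<in> L2 M) \<Longrightarrow> (\<lambda>x. \<Sum>i\<in>I. f i x) \<in> L2 M"
  by (induction I rule: infinite_finite_induct) (auto intro: L2_0 L2_add)

lemma L2_mult_bounded:
  assumes "f \<in> L2 M" "g \<in> borel_measurable M" "\<And>x. \<bar>g x\<bar> \<le> B"
  shows "(\<lambda>x. g x * f x) \<in> L2 M"
proof -
  have "integrable M (\<lambda>x. (g x * f x)\<^sup>2)"
  proof (rule Bochner_Integration.integrable_bound[where f="\<lambda>x. B\<^sup>2 * (f x)\<^sup>2"])
    show "integrable M (\<lambda>x. B\<^sup>2 * (f x)\<^sup>2)" using assms by (simp add: L2_def)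
    show "(\<lambda>x. (g x * f x)\<^sup>2) \<in> borel_measurable M"
      using assms by (simp add: L2_def borel_measurable_times borel_measurable_power)
    have "(g x)\<^sup>2 \<le> B\<^sup>2" for x
      using assms(3)[of x] by (simp add: abs_le_square_iff[symmetric])
    then show "AE x in M. norm ((g x * f x)\<^sup>2) \<le> norm (B\<^sup>2 * (f x)\<^sup>2)"
      by (simp add: power_mult_distrib mult_right_mono)
  qed
  then show ?thesis using assms by (simp add: L2_def borel_measurable_times)
qed

section \<open>Inner product and seminorm\<close>

lemma ip_commute: "ip M f g = ip M g f"
  by (simp add: ip_def mult.commute)

lemma ip_add_left: "f \<in> L2 M \<Longrightarrow> g \<in> L2 M \<Longrightarrow> k \<in> L2 M \<Longrightarrow>
    ip M (\<lambda>x. f x + g x) k = ip M f k + ip M g k"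
  by (simp add: ip_def distrib_right L2_integrable_mult)

lemma ip_diff_left: "f \<in> L2 M \<Longrightarrow> g \<in> L2 M \<Longrightarrow> k \<in> L2 M \<Longrightarrow>
    ip M (\<lambda>x. f x - g x) k = ip M f k - ip M g k"
  by (simp add: ip_def left_diff_distrib L2_integrable_mult)

lemma ip_cmult_left: "ip M (\<lambda>x. c * f x) k = c * ip M f k"
  by (simp add: ip_def mult.assoc)

lemma ip_add_right: "f \<in> L2 M \<Longrightarrow> g \<in> L2 M \<Longrightarrow> k \<in> L2 M \<Longrightarrow>
    ip M k (\<lambda>x. f x + g x) = ip M k f + ip M k g"
  using ip_add_left[of f M g k] by (simp add: ip_commute[of M k])

lemma ip_diff_right: "f \<in> L2 M \<Longrightarrow> g \<in> L2 M \<Longrightarrow> k \<in> L2 M \<Longrightarrow>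
    ip M k (\<lambda>x. f x - g x) = ip M k f - ip M k g"
  using ip_diff_left[of f M g k] by (simp add: ip_commute[of M k])

lemma ip_cmult_right: "ip M k (\<lambda>x. c * f x) = c * ip M k f"
  using ip_cmult_left[of M c f k] by (simp add: ip_commute[of M k])

lemma ip_sum_left: "(\<And>i. i \<in> I \<Longrightarrow> f i \<in> L2 M) \<Longrightarrow> k \<in> L2 M \<Longrightarrow>
    ip M (\<lambda>x. \<Sum>i\<in>I. f i x) k = (\<Sum>i\<in>I. ip M (f i) k)"
  by (simp add: ip_def sum_distrib_right L2_integrable_mult)

lemma ip_nonneg: "ip M f f \<ge> 0"
  by (simp add: ip_def)

lemma nrm_nonneg: "nrm M f \<ge> 0"
  by (simp add: nrm_def ip_nonneg)

lemma nrm_sq: "(nrm M f)\<^sup>2 = ip M f f"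
  by (simp add: nrm_def ip_nonneg)

lemma nrm_le_iff: "0 \<le> B \<Longrightarrow> nrm M f \<le> B \<longleftrightarrow> ip M f f \<le> B\<^sup>2"
  using real_sqrt_le_iff[of "ip M f f" "B\<^sup>2"] by (simp add: nrm_def)

lemma ip_diff_diff:
  assumes "f \<in> L2 M" "g \<in> L2 M"
  shows "ip M (\<lambda>x. f x - c * g x) (\<lambda>x. f x - c * g x) = ip M f f - 2 * c * ip M f g + c\<^sup>2 * ip M g g"
  using assms
  by (simp add: ip_diff_left ip_diff_right ip_cmult_left ip_cmult_right L2_diff L2_cmult ip_commute[of M g f]
      power2_eq_square algebra_simps)

lemma L2_Cauchy_Schwarz:
  assumes "f \<in> L2 M" "g \<in> L2 M"
  shows "\<bar>ip M f g\<bar> \<le> nrm M f * nrm M g"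
proof -
  define a b c where abc: "a = ip M f f" "b = ip M f g" "c = ip M g g"
  have q: "a - 2 * t * b + t\<^sup>2 * c \<ge> 0" for t
    using ip_diff_diff[OF assms, of t] ip_nonneg[of M "\<lambda>x. f x - t * g x"] abc by simp
  have ac: "a \<ge> 0" "c \<ge> 0" using abc ip_nonneg by auto
  have "b\<^sup>2 \<le> a * c"
  proof (cases "c = 0")
    case True
    show ?thesis
    proof (cases "b = 0")
      case False
      \<comment> \<open>For \<open>c = 0\<close> the quadratic in \<open>t\<close> is affine, and
        this \<open>t\<close> would give it the value -1.\<close>
      with q[of "(a + 1) / (2 * b)"] True have "a - (a + 1) \<ge> 0" by (simp add: field_simps)
      then show ?thesis by simp
    qed (use ac in simp)
  next
    case False
    with q[of "b / c"] ac have "a - b\<^sup>2 / c \<ge> 0" by (simp add: power2_eq_square field_simps)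
    then show ?thesis using False ac by (simp add: field_simps)
  qed
  then have "\<bar>b\<bar> \<le> sqrt (a * c)" by (rule real_le_rsqrt[of "\<bar>b\<bar>", simplified])
  then show ?thesis unfolding nrm_def abc by (simp add: real_sqrt_mult)
qed

lemma nrm_triangle:
  assumes "f \<in> L2 M" "g \<in> L2 M"
  shows "nrm M (\<lambda>x. f x + g x) \<le> nrm M f + nrm M g"
proof -
  have "ip M (\<lambda>x. f x + g x) (\<lambda>x. f x + g x) = ip M f f + 2 * ip M f g + ip M g g"
    using assms by (simp add: ip_add_left ip_add_right L2_add ip_commute[of M g f])
  also have "\<dots> \<le> (nrm M f)\<^sup>2 + 2 * (nrm M f * nrm M g) + (nrm M g)\<^sup>2"
    using L2_Cauchy_Schwarz[OF assms] by (simp add: nrm_sq)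
  also have "\<dots> = (nrm M f + nrm M g)\<^sup>2" by (simp add: power2_sum)
  finally show ?thesis by (simp add: nrm_le_iff nrm_nonneg)
qed

lemma nrm_cmult: "nrm M (\<lambda>x. c * f x) = \<bar>c\<bar> * nrm M f"
  unfolding nrm_def by (simp add: ip_cmult_left ip_cmult_right real_sqrt_mult flip: mult.assoc)

lemma nrm_minus_commute: "nrm M (\<lambda>x. f x - g x) = nrm M (\<lambda>x. g x - f x)"
  unfolding nrm_def ip_def by (simp add: algebra_simps)

lemma nrm_triangle_diff:
  assumes "f \<in> L2 M" "g \<in> L2 M"
  shows "nrm M (\<lambda>x. f x - g x) \<le> nrm M f + nrm M g"
  using nrm_triangle[OF assms(1) L2_cmult[OF assms(2)], of "-1"] nrm_cmult[of M "-1" g] by simp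

lemma nrm_le_diff:
  assumes "f \<in> L2 M" "g \<in> L2 M"
  shows "nrm M f \<le> nrm M (\<lambda>x. f x - g x) + nrm M g"
  using nrm_triangle[OF L2_diff[OF assms] assms(2)] by simp

lemma nrm_diff_le:
  assumes "f \<in> L2 M" "g \<in> L2 M" "h \<in> L2 M"
  shows "nrm M (\<lambda>x. f x - h x) \<le> nrm M (\<lambda>x. f x - g x) + nrm M (\<lambda>x. g x - h x)"
  using nrm_triangle[OF L2_diff[OF assms(1,2)] L2_diff[OF assms(2,3)]] by simp

lemma ip_tendsto_left:
  assumes "\<And>n. f n \<in> L2 M" "g \<in> L2 M" "k \<in> L2 M" "(\<lambda>n. nrm M (\<lambda>x. f n x - g x)) \<longlonglongrightarrow> 0"
  shows "(\<lambda>n. ip M (f n) k) \<longlonglongrightarrow> ip M g k"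
proof (rule LIM_zero_cancel, rule tendsto_rabs_zero_cancel, rule tendsto_sandwich[OF _ _ tendsto_const])
  have "ip M (f n) k - ip M g k = ip M (\<lambda>x. f n x - g x) k" for n
    using assms by (simp add: ip_diff_left)
  then show "\<forall>\<^sub>F n in sequentially. \<bar>ip M (f n) k - ip M g k\<bar> \<le> nrm M (\<lambda>x. f n x - g x) * nrm M k"
    using L2_Cauchy_Schwarz[OF L2_diff[OF assms(1,2)] assms(3)] by simp
  show "(\<lambda>n. nrm M (\<lambda>x. f n x - g x) * nrm M k) \<longlonglongrightarrow> 0"
    using tendsto_mult_left_zero[OF assms(4)] by simp
qed auto

text \<open>Weighted by \<open>2 ^ n\<close>, the squared increments still have summable integrals,
  since \<open>2 ^ n * (1/4) ^ n = (1/2) ^ n\<close>. Hence almost everywhere the weighted squares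
  tend to 0, and the increments are eventually dominated by the geometric series of ratio
  \<open>sqrt (1/2)\<close>.\<close>

lemma L2_fast_Cauchy_AE_convergent:
  assumes f: "\<And>n. f n \<in> L2 M" and fast: "\<And>n. nrm M (\<lambda>x. f (Suc n) x - f n x) \<le> (1/2) ^ n"
  shows "AE x in M. convergent (\<lambda>n. f n x)"
proof -
  define D where "D n x = f (Suc n) x - f n x" for n x
  have D: "D n \<in> L2 M" for n unfolding D_def using L2_diff f by blast
  have meas [measurable]: "D n \<in> borel_measurable M" for n using D L2_measurable by blast
  have trm: "(\<integral>\<^sup>+x. ennreal (2 ^ n * (D n x)\<^sup>2) \<partial>M) \<le> ennreal ((1/2) ^ n)" for n
  proof -
    have "(\<integral>\<^sup>+x. ennreal (2 ^ n * (D n x)\<^sup>2) \<partial>M) = ennreal (2 ^ n * ip M (D n) (D n))"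
      using D by (subst nn_integral_eq_integral) (auto simp: L2_def ip_def power2_eq_square)
    also have "\<dots> \<le> ennreal (2 ^ n * ((1/2) ^ n)\<^sup>2)"
      using fast[of n] unfolding D_def[symmetric] by (intro ennreal_leI mult_left_mono) (auto simp: nrm_le_iff)
    also have "(2::real) ^ n * ((1/2) ^ n)\<^sup>2 = (1/2) ^ n"
      by (simp add: power2_eq_square flip: power_mult_distrib)
    finally show ?thesis .
  qed
  have "(\<integral>\<^sup>+x. (\<Sum>n. ennreal (2 ^ n * (D n x)\<^sup>2)) \<partial>M) = (\<Sum>n. \<integral>\<^sup>+x. ennreal (2 ^ n * (D n x)\<^sup>2) \<partial>M)"
    by (rule nn_integral_suminf) measurable
  also have "\<dots> \<le> (\<Sum>n. ennreal ((1/2) ^ n))"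
    by (intro suminf_le trm) auto
  also have "\<dots> = ennreal (\<Sum>n. (1/2) ^ n)"
    by (rule suminf_ennreal2) (auto intro: summable_geometric)
  finally have "(\<integral>\<^sup>+x. (\<Sum>n. ennreal (2 ^ n * (D n x)\<^sup>2)) \<partial>M) \<noteq> \<infinity>" by (auto simp: top_unique)
  then have "AE x in M. (\<Sum>n. ennreal (2 ^ n * (D n x)\<^sup>2)) \<noteq> \<infinity>"
    by (intro nn_integral_PInf_AE) measurable
  then show ?thesis
  proof eventually_elim
    case (elim x)
    then have "summable (\<lambda>n. 2 ^ n * (D n x)\<^sup>2)"
      by (intro summable_suminf_not_top) auto
    then have "(\<lambda>n. 2 ^ n * (D n x)\<^sup>2) \<longlonglongrightarrow> 0" by (rule summable_LIMSEQ_zero)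
    then have "\<forall>\<^sub>F n in sequentially. 2 ^ n * (D n x)\<^sup>2 < 1"
      by (rule order_tendstoD) simp
    then obtain N where N: "\<And>n. n \<ge> N \<Longrightarrow> 2 ^ n * (D n x)\<^sup>2 < 1"
      by (auto simp: eventually_sequentially)
    have Db: "norm (D n x) \<le> (sqrt (1/2)) ^ n" if "n \<ge> N" for n
    proof -
      have "2 ^ n * (D n x)\<^sup>2 \<le> 1" using N[OF that] by simp
      then have "(D n x)\<^sup>2 \<le> (1/2) ^ n" by (simp add: field_simps power_divide)
      then have "\<bar>D n x\<bar> \<le> sqrt ((1/2) ^ n)" by (rule real_le_rsqrt[of "\<bar>D n x\<bar>", simplified])
      then show ?thesis by (simp add: real_sqrt_power)
    qed
    have "summable (\<lambda>n. sqrt (1/2) ^ n)"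
      by (rule summable_geometric) (simp add: real_sqrt_divide)
    then have "summable (\<lambda>n. D n x)"
      by (rule summable_comparison_test'[of _ N]) (rule Db)
    then have "convergent (\<lambda>n. \<Sum>i<n. D i x)" by (simp add: summable_iff_convergent)
    moreover have "(\<Sum>i<n. D i x) = f n x - f 0 x" for n
      unfolding D_def by (rule sum_lessThan_telescope)
    ultimately have "convergent (\<lambda>n. f n x - f 0 x)" by simp
    then have "convergent (\<lambda>n. (f n x - f 0 x) + f 0 x)" by (intro convergent_add convergent_const)
    then show ?case by simp
  qed
qed

text \<open>The limit is the pointwise limit of a rapidly converging subsequence; Fatou's lemma
  turns the Cauchy estimates between members of the sequence into estimates of their distance to
  that limit.\<close>

lemma L2_complete:
  assumes f: "\<And>n. f n \<in> L2 M"
    and cauchy: "\<And>e. e > 0 \<Longrightarrow> \<exists>N. \<forall>m\<ge>N. \<forall>n\<ge>N. nrm M (\<lambda>x. f m x - f n x) < e"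
  shows "\<exists>g\<in>L2 M. (\<lambda>n. nrm M (\<lambda>x. f n x - g x)) \<longlonglongrightarrow> 0"
proof -
  have "\<forall>k. \<exists>N. \<forall>m\<ge>N. \<forall>n\<ge>N. nrm M (\<lambda>x. f m x - f n x) < (1/2) ^ k"
    using cauchy by simp
  then obtain N where N: "\<And>k m n. m \<ge> N k \<Longrightarrow> n \<ge> N k \<Longrightarrow> nrm M (\<lambda>x. f m x - f n x) < (1/2) ^ k"
    by metis
  \<comment> \<open>Summing the thresholds puts both \<open>r k\<close> and \<open>r (Suc k)\<close>
    beyond \<open>N k\<close>; the summand \<open>k\<close> makes the indices tend to
    infinity.\<close>
  define r where "r k = (\<Sum>i\<le>k. N i) + k" for k
  have rN: "r k \<ge> N k" "r (Suc k) \<ge> N k" "r k \<ge> k" for k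
    unfolding r_def using member_le_sum[of k "{..k}" N] by auto
  have "AE x in M. convergent (\<lambda>n. f (r n) x)"
    by (rule L2_fast_Cauchy_AE_convergent[OF f]) (use N rN in \<open>auto intro: less_imp_le\<close>)
  then have AE: "AE x in M. (\<lambda>n. f (r n) x) \<longlonglongrightarrow> lim (\<lambda>n. f (r n) x)"
    by eventually_elim (simp add: convergent_LIMSEQ_iff)
  \<comment> \<open>Where the subsequence diverges \<open>lim\<close> is an unspecified number, but
    it is measurable in \<open>x\<close> and the exceptional points form a null set.\<close>
  define g where "g x = lim (\<lambda>n. f (r n) x)" for x
  have fm [measurable]: "f n \<in> borel_measurable M" for n using f L2_measurable by blast
  have gm [measurable]: "g \<in> borel_measurable M"
    unfolding g_def by (rule borel_measurable_lim_metric) measurable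
  have bound: "(\<integral>\<^sup>+x. ennreal ((f m x - g x)\<^sup>2) \<partial>M) \<le> ennreal (e\<^sup>2)"
    if e: "\<And>n. n \<ge> N0 \<Longrightarrow> nrm M (\<lambda>x. f m x - f n x) \<le> e" for m e N0
  proof -
    have "e \<ge> 0" using e[of N0] nrm_nonneg order_trans by blast
    have "AE x in M. ennreal ((f m x - g x)\<^sup>2) = liminf (\<lambda>n. ennreal ((f m x - f (r n) x)\<^sup>2))"
      using AE
    proof eventually_elim
      case (elim x)
      then have "(\<lambda>n. ennreal ((f m x - f (r n) x)\<^sup>2)) \<longlonglongrightarrow> ennreal ((f m x - g x)\<^sup>2)"
        unfolding g_def by (intro tendsto_intros tendsto_ennrealI)
      then show ?case by (intro lim_imp_Liminf[symmetric]) auto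
    qed
    then have "(\<integral>\<^sup>+x. ennreal ((f m x - g x)\<^sup>2) \<partial>M)
        = (\<integral>\<^sup>+x. liminf (\<lambda>n. ennreal ((f m x - f (r n) x)\<^sup>2)) \<partial>M)"
      by (rule nn_integral_cong_AE)
    also have "\<dots> \<le> liminf (\<lambda>n. \<integral>\<^sup>+x. ennreal ((f m x - f (r n) x)\<^sup>2) \<partial>M)"
      by (rule nn_integral_liminf) measurable
    also have "\<dots> \<le> ennreal (e\<^sup>2)"
    proof (rule Liminf_le)
      show "\<forall>\<^sub>F n in sequentially. (\<integral>\<^sup>+x. ennreal ((f m x - f (r n) x)\<^sup>2) \<partial>M) \<le> ennreal (e\<^sup>2)"
        using eventually_ge_at_top[of N0]
      proof eventually_elim
        case (elim n)
        then have "nrm M (\<lambda>x. f m x - f (r n) x) \<le> e" using e rN(3)[of n] by simp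
        then have "ip M (\<lambda>x. f m x - f (r n) x) (\<lambda>x. f m x - f (r n) x) \<le> e\<^sup>2"
          using \<open>e \<ge> 0\<close> by (simp add: nrm_le_iff)
        moreover have "(\<integral>\<^sup>+x. ennreal ((f m x - f (r n) x)\<^sup>2) \<partial>M)
          = ennreal (ip M (\<lambda>x. f m x - f (r n) x) (\<lambda>x. f m x - f (r n) x))"
          using L2_diff[OF f f, of m "r n"]
          by (subst nn_integral_eq_integral) (auto simp: L2_def ip_def power2_eq_square)
        ultimately show ?case by (simp add: ennreal_leI)
      qed
    qed auto
    finally show ?thesis .
  qed
  have diffL2: "(\<lambda>x. f m x - g x) \<in> L2 M \<and> nrm M (\<lambda>x. f m x - g x) \<le> e"
    if e: "\<And>n. n \<ge> N0 \<Longrightarrow> nrm M (\<lambda>x. f m x - f n x) \<le> e" for m e N0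
  proof -
    have "e \<ge> 0" using e[of N0] nrm_nonneg order_trans by blast
    have b: "(\<integral>\<^sup>+x. ennreal ((f m x - g x)\<^sup>2) \<partial>M) \<le> ennreal (e\<^sup>2)" using bound e by blast
    then have "(\<integral>\<^sup>+x. ennreal ((f m x - g x)\<^sup>2) \<partial>M) < \<infinity>" using le_less_trans by fastforce
    then have int: "integrable M (\<lambda>x. (f m x - g x)\<^sup>2)"
      by (intro integrableI_nonneg) auto
    then have "ennreal (ip M (\<lambda>x. f m x - g x) (\<lambda>x. f m x - g x)) \<le> ennreal (e\<^sup>2)"
      using b by (subst (asm) nn_integral_eq_integral) (auto simp: ip_def power2_eq_square)
    then have "ip M (\<lambda>x. f m x - g x) (\<lambda>x. f m x - g x) \<le> e\<^sup>2" by (simp add: ennreal_le_iff)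
    then show ?thesis using int \<open>e \<ge> 0\<close> by (simp add: L2_def nrm_le_iff)
  qed
  \<comment> \<open>A single square integrable difference places \<open>g\<close> itself in
    \<open>L2 M\<close>.\<close>
  have "(\<lambda>x. f (N 0) x - g x) \<in> L2 M"
    using diffL2[of "N 0" "N 0" "1"] N[of 0 "N 0"] less_imp_le by fastforce
  from L2_diff[OF f[of "N 0"] this] have g: "g \<in> L2 M" by simp
  have "(\<lambda>n. nrm M (\<lambda>x. f n x - g x)) \<longlonglongrightarrow> 0"
  proof (rule LIMSEQ_I)
    fix e :: real assume "e > 0"
    then obtain K where K: "\<And>m n. m \<ge> K \<Longrightarrow> n \<ge> K \<Longrightarrow> nrm M (\<lambda>x. f m x - f n x) < e / 2"
      using cauchy[of "e/2"] by auto
    have "norm (nrm M (\<lambda>x. f m x - g x) - 0) < e" if "m \<ge> K" for m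
    proof -
      have "nrm M (\<lambda>x. f m x - g x) \<le> e / 2"
        using diffL2[of K m "e/2"] K[OF that] less_imp_le by blast
      then show ?thesis using \<open>e > 0\<close> nrm_nonneg[of M "\<lambda>x. f m x - g x"] by simp
    qed
    then show "\<exists>no. \<forall>n\<ge>no. norm (nrm M (\<lambda>x. f n x - g x) - 0) < e" by blast
  qed
  with g show ?thesis by blast
qed


text \<open>The functional \<open>J s = \<parallel>s\<parallel>\<^sup>2 - 2 \<Lambda> s\<close> is
  bounded below. By the parallelogram law a minimising sequence is Cauchy, and vanishing of the
  first variation at its limit says that the limit represents \<Lambda>. As \<open>S\<close> may
  fail to be closed, the approximating sequence in \<open>S\<close> is part of the conclusion. With
  \<Lambda> an inner product the lemma gives the orthogonal projection onto the closure of
  \<open>S\<close>.\<close>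

lemma L2_Riesz_subspace:
  assumes S: "S \<subseteq> L2 M" "(\<lambda>x. 0) \<in> S"
    and add: "\<And>s t. s \<in> S \<Longrightarrow> t \<in> S \<Longrightarrow> (\<lambda>x. s x + t x) \<in> S"
    and scale: "\<And>c s. s \<in> S \<Longrightarrow> (\<lambda>x. c * s x) \<in> S"
    and \<Lambda>_add: "\<And>s t. s \<in> S \<Longrightarrow> t \<in> S \<Longrightarrow> \<Lambda> (\<lambda>x. s x + t x) = \<Lambda> s + \<Lambda> t"
    and \<Lambda>_scale: "\<And>c s. s \<in> S \<Longrightarrow> \<Lambda> (\<lambda>x. c * s x) = c * \<Lambda> s"
    and \<Lambda>_bound: "\<And>s. s \<in> S \<Longrightarrow> \<bar>\<Lambda> s\<bar> \<le> C * nrm M s"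
  shows "\<exists>f \<sigma>. f \<in> L2 M \<and> (\<forall>n. \<sigma> n \<in> S) \<and> (\<lambda>n. nrm M (\<lambda>x. \<sigma> n x - f x)) \<longlonglongrightarrow> 0
    \<and> (\<forall>s\<in>S. ip M f s = \<Lambda> s)"
proof -
  define J where "J s = ip M s s - 2 * \<Lambda> s" for s
  have SL: "s \<in> S \<Longrightarrow> s \<in> L2 M" for s using S by blast
  have J_bound: "J s \<ge> - C\<^sup>2" if "s \<in> S" for s
  proof -
    have "J s \<ge> (nrm M s)\<^sup>2 - 2 * (C * nrm M s)"
      using \<Lambda>_bound[OF that] by (simp add: J_def nrm_sq)
    moreover have "(nrm M s - C)\<^sup>2 \<ge> 0" by simp
    ultimately show ?thesis by (simp add: power2_diff algebra_simps)
  qed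
  define d where "d = Inf (J ` S)"
  have bdd: "bdd_below (J ` S)" using J_bound by (intro bdd_belowI2[of _ "- C\<^sup>2"])
  have dJ: "d \<le> J s" if "s \<in> S" for s unfolding d_def using that bdd by (simp add: cINF_lower)
  have "\<exists>s\<in>S. J s < d + 1 / real (Suc n)" for n
  proof -
    have "Inf (J ` S) < d + 1 / real (Suc n)" by (simp add: d_def)
    then show ?thesis using S(2) bdd by (subst (asm) cInf_less_iff) auto
  qed
  then obtain \<sigma> where \<sigma>: "\<And>n. \<sigma> n \<in> S" "\<And>n. J (\<sigma> n) < d + 1 / real (Suc n)" by metis
  have J_expand: "J (\<lambda>x. s x + c * t x) = J s + 2 * c * (ip M s t - \<Lambda> t) + c\<^sup>2 * ip M t t"
    if "s \<in> S" "t \<in> S" for s t c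
  proof -
    note L = SL[OF that(1)] SL[OF that(2)]
    have "ip M (\<lambda>x. s x - (- c) * t x) (\<lambda>x. s x - (- c) * t x) = ip M s s + 2 * c * ip M s t + c\<^sup>2 * ip M t t"
      using ip_diff_diff[OF L, of "- c"] by simp
    then show ?thesis
      using \<Lambda>_add[OF that(1) scale[OF that(2)]] \<Lambda>_scale[OF that(2)] by (simp add: J_def algebra_simps)
  qed
  have parallelogram: "ip M (\<lambda>x. s x - t x) (\<lambda>x. s x - t x) \<le> 2 * (J s - d) + 2 * (J t - d)"
    if "s \<in> S" "t \<in> S" for s t
  proof -
    note L = SL[OF that(1)] SL[OF that(2)]
    \<comment> \<open>The midpoint lies in \<open>S\<close>, so \<open>J u\<close> cannot be below
      the infimum \<open>d\<close>; this is where the parallelogram law enters.\<close>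
    define u where "u x = (1/2) * s x + (1/2) * t x" for x
    have "u \<in> S" unfolding u_def using add[OF scale[OF that(1)] scale[OF that(2)]] .
    have uu: "ip M u u = (1/2) * ((1/2) * ip M s s + (1/2) * ip M s t) + (1/2) * ((1/2) * ip M s t + (1/2) * ip M t t)"
      unfolding u_def using L
      by (simp add: ip_add_left ip_add_right L2_add L2_cmult ip_cmult_left ip_cmult_right ip_commute[of M t s]
          del: times_divide_eq_left mult_1 times_divide_eq_right)
    have "\<Lambda> u = (1/2) * \<Lambda> s + (1/2) * \<Lambda> t"
      unfolding u_def using \<Lambda>_add[OF scale[OF that(1)] scale[OF that(2)], of "1/2" "1/2"]
      unfolding \<Lambda>_scale[OF that(1)] \<Lambda>_scale[OF that(2)] .
    moreover have "x - 2 * l = (1/4) * (a + 2 * b + c) - (p + q)"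
      if "x = (1/2) * ((1/2) * a + (1/2) * b) + (1/2) * ((1/2) * b + (1/2) * c)" "l = (1/2) * p + (1/2) * q"
      for x a b c l p q :: real using that by (simp add: field_simps)
    ultimately have Ju: "J u = (1/4) * (ip M s s + 2 * ip M s t + ip M t t) - (\<Lambda> s + \<Lambda> t)"
      unfolding J_def using uu by blast
    have "ip M (\<lambda>x. s x - t x) (\<lambda>x. s x - t x) = ip M s s - 2 * ip M s t + ip M t t"
      using ip_diff_diff[OF L, of 1] by simp
    then show ?thesis using dJ[OF \<open>u \<in> S\<close>] Ju by (simp add: J_def algebra_simps)
  qed
  have "\<exists>N. \<forall>m\<ge>N. \<forall>n\<ge>N. nrm M (\<lambda>x. \<sigma> m x - \<sigma> n x) < e" if "e > 0" for e :: real
  proof -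
    \<comment> \<open>Each of the two excesses over \<open>d\<close> counts twice in
      \<open>parallelogram\<close>, which makes \<open>4 / (N + 1)\<close> in total.\<close>
    obtain N where N: "1 / real (Suc N) < e\<^sup>2 / 4"
      using nat_approx_posE[of "e\<^sup>2 / 4"] \<open>e > 0\<close> by (metis zero_less_divide_iff zero_less_numeral zero_less_power)
    have "nrm M (\<lambda>x. \<sigma> m x - \<sigma> n x) < e" if "m \<ge> N" "n \<ge> N" for m n
    proof -
      have le: "1 / real (Suc m) \<le> 1 / real (Suc N)" "1 / real (Suc n) \<le> 1 / real (Suc N)"
        using that by (simp_all add: frac_le)
      have "(nrm M (\<lambda>x. \<sigma> m x - \<sigma> n x))\<^sup>2 < e\<^sup>2"
        using parallelogram[OF \<sigma>(1)[of m] \<sigma>(1)[of n]] \<sigma>(2)[of m] \<sigma>(2)[of n] N le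
        by (simp add: nrm_sq)
      then show ?thesis using \<open>e > 0\<close> by (simp add: power2_less_imp_less)
    qed
    then show ?thesis by blast
  qed
  from L2_complete[OF SL[OF \<sigma>(1)] this]
  obtain f where f: "f \<in> L2 M" "(\<lambda>n. nrm M (\<lambda>x. \<sigma> n x - f x)) \<longlonglongrightarrow> 0" by blast
  have "ip M f s = \<Lambda> s" if s: "s \<in> S" for s
  proof -
    define b where "b = ip M f s - \<Lambda> s"
    \<comment> \<open>First variation: \<open>J\<close> at \<sigma> n plus \<open>c\<close> times
      \<open>s\<close> is at least \<open>d\<close>, which exceeds
      \<open>J (\<sigma> n) - 1 / (n + 1)\<close>; then \<open>n\<close> tends to infinity.\<close>
    have q: "2 * c * b + c\<^sup>2 * ip M s s \<ge> 0" for c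
    proof -
      have A: "(\<lambda>n. 2 * c * (ip M (\<sigma> n) s - \<Lambda> s) + c\<^sup>2 * ip M s s + 1 / real (Suc n)) \<longlonglongrightarrow> 2 * c * b + c\<^sup>2 * ip M s s + 0"
        unfolding b_def
        by (intro tendsto_intros ip_tendsto_left SL[OF \<sigma>(1)] f SL[OF s] LIMSEQ_Suc lim_const_over_n[of 1, simplified] lim_1_over_n)
      have B: "0 \<le> 2 * c * (ip M (\<sigma> n) s - \<Lambda> s) + c\<^sup>2 * ip M s s + 1 / real (Suc n)" for n
        using dJ[OF add[OF \<sigma>(1) scale[OF s]], of n c] J_expand[OF \<sigma>(1) s, of n c] \<sigma>(2)[of n] by linarith
      show ?thesis using LIMSEQ_le_const[OF A, of 0] B by simp
    qed
    have "b = 0"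
    proof (rule ccontr)
      assume "b \<noteq> 0"
      \<comment> \<open>A number strictly above \<open>ip M s s\<close> can be divided by even when
        \<open>s\<close> has norm 0; at \<open>c = - b / a\<close> the quadratic would be
        negative.\<close>
      define a where "a = ip M s s + 1"
      have a: "a > 0" "ip M s s < a" using ip_nonneg[of M s] by (simp_all add: a_def)
      have "2 * (- b / a) * b + (- b / a)\<^sup>2 * ip M s s < 2 * (- b / a) * b + (- b / a)\<^sup>2 * a"
        using a \<open>b \<noteq> 0\<close> by simp
      also have "\<dots> = - b\<^sup>2 / a" using a by (simp add: power2_eq_square field_simps)
      also have "\<dots> < 0" using a \<open>b \<noteq> 0\<close> by simp
      finally show False using q[of "- b / a"] by simp
    qed
    then show ?thesis by (simp add: b_def)
  qed
  with f \<sigma> show ?thesis by blast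
qed

section \<open>Weak convergence and weak sequential compactness\<close>

definition weakly_L2 :: "'a measure \<Rightarrow> (nat \<Rightarrow> 'a \<Rightarrow> real) \<Rightarrow> ('a \<Rightarrow> real) \<Rightarrow> bool" where
  "weakly_L2 M f f' \<longleftrightarrow> (\<forall>n. f n \<in> L2 M) \<and> f' \<in> L2 M \<and> (\<forall>\<psi>\<in>L2 M. (\<lambda>n. ip M (f n) \<psi>) \<longlonglongrightarrow> ip M f' \<psi>)"

lemma weakly_L2_subseq: "weakly_L2 M f f' \<Longrightarrow> strict_mono r \<Longrightarrow> weakly_L2 M (\<lambda>n. f (r n)) f'"
  unfolding weakly_L2_def using LIMSEQ_subseq_LIMSEQ[of "\<lambda>n. ip M (f n) _" _ r] by (auto simp: o_def)

text \<open>The vectors whose pairings with \<open>f n\<close> converge form a closed subspace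
  \<open>S\<close> containing every \<open>f m\<close>. An arbitrary \<psi> may be replaced by its
  projection onto \<open>S\<close>, since the difference is orthogonal to all \<open>f n\<close>.
  The sequence itself thus plays the part of a countable dense set.\<close>

lemma weakly_L2_of_convergent:
  assumes f: "\<And>n. f n \<in> L2 M" and bound: "\<And>n. nrm M (f n) \<le> C"
    and conv: "\<And>m. convergent (\<lambda>n. ip M (f n) (f m))"
  shows "\<exists>f'. weakly_L2 M f f'"
proof -
  have "C \<ge> 0" using bound[of 0] nrm_nonneg order_trans by blast
  define S where "S = {s \<in> L2 M. convergent (\<lambda>n. ip M (f n) s)}"
  define \<Lambda> where "\<Lambda> s = lim (\<lambda>n. ip M (f n) s)" for s
  have lim: "(\<lambda>n. ip M (f n) s) \<longlonglongrightarrow> \<Lambda> s" if "s \<in> S" for s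
    using that by (simp add: S_def \<Lambda>_def convergent_LIMSEQ_iff)
  have SL: "S \<subseteq> L2 M" by (auto simp: S_def)
  have zero: "(\<lambda>x. 0) \<in> S" by (simp add: S_def L2_0 ip_def convergent_const)
  have limadd: "(\<lambda>n. ip M (f n) (\<lambda>x. s x + t x)) \<longlonglongrightarrow> \<Lambda> s + \<Lambda> t" if "s \<in> S" "t \<in> S" for s t
    using tendsto_add[OF lim[OF that(1)] lim[OF that(2)]] that SL f by (simp add: ip_add_right subset_iff)
  have limscale: "(\<lambda>n. ip M (f n) (\<lambda>x. c * s x)) \<longlonglongrightarrow> c * \<Lambda> s" if "s \<in> S" for s c
    using tendsto_mult_left[OF lim[OF that], of c] by (simp add: ip_cmult_right)
  have add: "(\<lambda>x. s x + t x) \<in> S" if "s \<in> S" "t \<in> S" for s t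
    using limadd[OF that] that SL by (auto simp: S_def L2_add convergent_def)
  have scale: "(\<lambda>x. c * s x) \<in> S" if "s \<in> S" for s c
    using limscale[OF that] that SL by (auto simp: S_def L2_cmult convergent_def)
  have ip_bound: "\<bar>ip M (f n) s\<bar> \<le> C * nrm M s" if "s \<in> L2 M" for n s
    using L2_Cauchy_Schwarz[OF f that, of n] mult_right_mono[OF bound nrm_nonneg, of n M s] by linarith
  have bd: "\<bar>\<Lambda> s\<bar> \<le> C * nrm M s" if "s \<in> S" for s
    using LIMSEQ_le_const2[OF tendsto_rabs[OF lim[OF that]]] ip_bound that SL by blast
  have "\<Lambda> (\<lambda>x. s x + t x) = \<Lambda> s + \<Lambda> t" if "s \<in> S" "t \<in> S" for s t
    using LIMSEQ_unique[OF lim[OF add[OF that]] limadd[OF that]] .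
  moreover have "\<Lambda> (\<lambda>x. c * s x) = c * \<Lambda> s" if "s \<in> S" for s c
    using LIMSEQ_unique[OF lim[OF scale[OF that]] limscale[OF that]] .
  ultimately obtain g \<sigma> where g: "g \<in> L2 M" "\<And>n. \<sigma> n \<in> S" "(\<lambda>n. nrm M (\<lambda>x. \<sigma> n x - g x)) \<longlonglongrightarrow> 0"
      "\<And>s. s \<in> S \<Longrightarrow> ip M g s = \<Lambda> s"
    using L2_Riesz_subspace[OF SL zero add scale _ _ bd] by blast
  \<comment> \<open>The bound on the norms of \<open>f n\<close> makes the approximation of
    \<open>k\<close> by a member of \<open>S\<close> uniform in \<open>n\<close>; the rest is an
    \<open>e / 3\<close> argument.\<close>
  have closed: "k \<in> S" if k: "k \<in> L2 M" "\<And>n. \<tau> n \<in> S" "(\<lambda>n. nrm M (\<lambda>x. \<tau> n x - k x)) \<longlonglongrightarrow> 0" for k \<tau>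
  proof -
    have "Cauchy (\<lambda>n. ip M (f n) k)"
    proof (rule metric_CauchyI)
      fix e :: real assume "e > 0"
      have "(\<lambda>n. C * nrm M (\<lambda>x. \<tau> n x - k x)) \<longlonglongrightarrow> C * 0" by (intro tendsto_intros k)
      then have "\<forall>\<^sub>F n in sequentially. C * nrm M (\<lambda>x. \<tau> n x - k x) < e / 3"
        using \<open>e > 0\<close> by (intro order_tendstoD) auto
      then obtain p where p: "C * nrm M (\<lambda>x. \<tau> p x - k x) < e / 3"
        using eventually_happens'[OF sequentially_bot] by blast
      have "Cauchy (\<lambda>n. ip M (f n) (\<tau> p))" using lim[OF k(2)] by (rule LIMSEQ_imp_Cauchy)
      then obtain N where N: "\<And>m n. m \<ge> N \<Longrightarrow> n \<ge> N \<Longrightarrow> dist (ip M (f m) (\<tau> p)) (ip M (f n) (\<tau> p)) < e / 3"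
        using metric_CauchyD[of _ "e/3"] \<open>e > 0\<close> by (metis divide_pos_pos zero_less_numeral)
      have close: "\<bar>ip M (f n) (\<tau> p) - ip M (f n) k\<bar> < e / 3" for n
        using ip_bound[OF L2_diff, of "\<tau> p" k n] ip_diff_right[of "\<tau> p" M k "f n"] k SL f p by (simp add: subset_iff)
      have "dist (ip M (f m) k) (ip M (f n) k) < e" if "m \<ge> N" "n \<ge> N" for m n
        using N[OF that] close[of m] close[of n] unfolding dist_real_def by linarith
      then show "\<exists>N. \<forall>m\<ge>N. \<forall>n\<ge>N. dist (ip M (f m) k) (ip M (f n) k) < e" by blast
    qed
    then show ?thesis using k by (simp add: S_def Cauchy_convergent_iff)
  qed
  have gS: "g \<in> S" using closed g by blast
  have fS: "f m \<in> S" for m using conv f by (simp add: S_def)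
  have "(\<lambda>n. ip M (f n) \<psi>) \<longlonglongrightarrow> ip M g \<psi>" if \<psi>: "\<psi> \<in> L2 M" for \<psi>
  proof -
    \<comment> \<open>Projection of \<psi>: the representer of the pairing with \<psi>, restricted
      to \<open>S\<close>, lies in \<open>S\<close> because \<open>S\<close> is closed.\<close>
    have "\<exists>k \<tau>. k \<in> L2 M \<and> (\<forall>n. \<tau> n \<in> S) \<and> (\<lambda>n. nrm M (\<lambda>x. \<tau> n x - k x)) \<longlonglongrightarrow> 0
       \<and> (\<forall>s\<in>S. ip M k s = ip M \<psi> s)"
    proof (rule L2_Riesz_subspace[OF SL zero add scale])
      show "ip M \<psi> (\<lambda>x. s x + t x) = ip M \<psi> s + ip M \<psi> t" if "s \<in> S" "t \<in> S" for s t
        using that \<psi> SL by (intro ip_add_right) auto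
      show "ip M \<psi> (\<lambda>x. c * s x) = c * ip M \<psi> s" for s c by (rule ip_cmult_right)
      show "\<bar>ip M \<psi> s\<bar> \<le> nrm M \<psi> * nrm M s" if "s \<in> S" for s
        using that \<psi> SL by (intro L2_Cauchy_Schwarz) auto
    qed
    then obtain k where k: "k \<in> S" "\<And>s. s \<in> S \<Longrightarrow> ip M k s = ip M \<psi> s" using closed by blast
    have "(\<lambda>n. ip M (f n) k) \<longlonglongrightarrow> ip M g k" using lim[OF k(1)] g(4)[OF k(1)] by simp
    moreover have "ip M (f n) k = ip M (f n) \<psi>" for n
      using k(2)[OF fS] by (simp add: ip_commute[of M "f n"])
    moreover have "ip M g k = ip M g \<psi>" using k(2)[OF gS] by (simp add: ip_commute[of M g])
    ultimately show ?thesis by simp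
  qed
  with f g(1) show ?thesis unfolding weakly_L2_def by blast
qed

text \<open>For each \<open>m\<close> the pairings with \<open>f m\<close> are bounded scalars, so
  Bolzano-Weierstrass applies at every stage of a diagonal extraction.\<close>

lemma L2_weakly_compact:
  fixes f :: "nat \<Rightarrow> 'a \<Rightarrow> real"
  assumes f: "\<And>n. f n \<in> L2 M" and bound: "\<And>n. nrm M (f n) \<le> C"
  shows "\<exists>r f'. strict_mono r \<and> weakly_L2 M (\<lambda>n. f (r n)) f'"
proof -
  interpret subseqs "\<lambda>m r. convergent (\<lambda>n. ip M (f (r n)) (f m))"
  proof
    fix m and s :: "nat \<Rightarrow> nat"
    have "\<bar>ip M (f (s n)) (f m)\<bar> \<le> C * C" for n
      using L2_Cauchy_Schwarz[OF f f, of "s n" m] mult_mono[OF bound bound _ nrm_nonneg, of "s n" m]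
        order_trans[OF nrm_nonneg bound] by (meson order_trans)
    then have "bounded (range (\<lambda>n. ip M (f (s n)) (f m)))"
      unfolding bounded_iff by (intro exI[of _ "C * C"]) auto
    then obtain l r where "strict_mono r" "((\<lambda>n. ip M (f (s n)) (f m)) \<circ> r) \<longlonglongrightarrow> l"
      using bounded_imp_convergent_subsequence by blast
    then show "\<exists>r'. strict_mono r' \<and> convergent (\<lambda>n. ip M (f ((s \<circ> r') n)) (f m))"
      by (auto simp: o_def convergent_def)
  qed
  have "convergent (\<lambda>n. ip M (f (diagseq n)) (f m))" for m
  proof -
    \<comment> \<open>Only the part of the diagonal sequence from index \<open>Suc m\<close> on is a
      subsequence of the sequence chosen at stage \<open>m\<close>.\<close>
    have "convergent (\<lambda>n. ip M (f ((diagseq \<circ> (+) (Suc m)) n)) (f m))"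
    proof (rule diagseq_holds)
      fix r s :: "nat \<Rightarrow> nat" and n assume "strict_mono r" "convergent (\<lambda>k. ip M (f (s k)) (f n))"
      then show "convergent (\<lambda>k. ip M (f ((s \<circ> r) k)) (f n))"
        using convergent_subseq_convergent[of "\<lambda>k. ip M (f (s k)) (f n)" r] by (simp add: o_def)
    qed
    then have "convergent (\<lambda>n. ip M (f (diagseq (n + Suc m))) (f m))" by (simp add: o_def add.commute)
    then show ?thesis using convergent_ignore_initial_segment[of "\<lambda>n. ip M (f (diagseq n)) (f m)" "Suc m"] by blast
  qed
  then have "\<exists>f'. weakly_L2 M (\<lambda>n. f (diagseq n)) f'"
    by (intro weakly_L2_of_convergent[where C=C] f bound)
  then show ?thesis using subseq_diagseq by blast
qed

lemma L2_weakly_compact_finite: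
  fixes f :: "'i \<Rightarrow> nat \<Rightarrow> 'a \<Rightarrow> real"
  assumes "finite I" "\<And>i n. i \<in> I \<Longrightarrow> f i n \<in> L2 M" "\<And>i n. i \<in> I \<Longrightarrow> nrm M (f i n) \<le> C"
  shows "\<exists>r f'. strict_mono r \<and> (\<forall>i\<in>I. weakly_L2 M (\<lambda>n. f i (r n)) (f' i))"
  using assms
proof (induction I rule: finite_induct)
  case empty
  have "strict_mono (id :: nat \<Rightarrow> nat)" by (simp add: strict_mono_def)
  then show ?case by (auto intro!: exI[of _ "id :: nat \<Rightarrow> nat"])
next
  case (insert i I)
  have "\<exists>r f'. strict_mono r \<and> (\<forall>i\<in>I. weakly_L2 M (\<lambda>n. f i (r n)) (f' i))"
    by (rule insert.IH) (use insert.prems in auto)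
  then obtain r f' where r: "strict_mono r" "\<And>j. j \<in> I \<Longrightarrow> weakly_L2 M (\<lambda>n. f j (r n)) (f' j)"
    by blast
  obtain s g where s: "strict_mono s" "weakly_L2 M (\<lambda>n. f i (r (s n))) g"
    using L2_weakly_compact[of "\<lambda>n. f i (r n)" M C] insert.prems by auto
  have "weakly_L2 M (\<lambda>n. f j (r (s n))) ((f'(i := g)) j)" if "j \<in> insert i I" for j
    using that s(2) weakly_L2_subseq[OF r(2) s(1)] insert.hyps by (cases "j = i") auto
  then show ?case using strict_mono_o[OF r(1) s(1)] by (intro exI[of _ "r \<circ> s"] exI[of _ "f'(i := g)"]) (simp add: o_def)
qed


section \<open>Test functions and integration by parts\<close>

lemma support_subset: "closed C \<Longrightarrow> (\<And>x. x \<notin> C \<Longrightarrow> f x = 0) \<Longrightarrow> support f \<subseteq> C"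
  unfolding support_def by (rule closure_minimal) auto

lemma not_in_support: "x \<notin> support f \<Longrightarrow> f x = 0"
  unfolding support_def using closure_subset[of "{x. f x \<noteq> 0}"] by auto

lemma test_functions_iff:
  "\<phi> \<in> test_functions \<Omega> \<longleftrightarrow> smooth \<phi> \<and> compact (support \<phi>) \<and> support \<phi> \<subseteq> \<Omega>"
  by (auto simp: test_functions_def smooth_def)

lemma test_functionsI:
  assumes "smooth \<phi>" "compact C" "C \<subseteq> \<Omega>" "\<And>x. x \<notin> C \<Longrightarrow> \<phi> x = 0"
  shows "\<phi> \<in> test_functions \<Omega>"
proof -
  have "support \<phi> \<subseteq> C" using assms by (intro support_subset compact_imp_closed)
  moreover from this have "compact (support \<phi>)"
    using assms(2) compact_Int_closed[of C "support \<phi>"] by (simp add: support_def Int_absorb1)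
  ultimately show ?thesis using assms by (auto simp: test_functions_iff)
qed

lemma test_smooth: "\<phi> \<in> test_functions \<Omega> \<Longrightarrow> smooth \<phi>"
  by (simp add: test_functions_iff)

lemma test_outside: "\<phi> \<in> test_functions \<Omega> \<Longrightarrow> x \<notin> \<Omega> \<Longrightarrow> \<phi> x = 0"
  using not_in_support by (auto simp: test_functions_iff)

lemma test_mono: "\<phi> \<in> test_functions U \<Longrightarrow> support \<phi> \<subseteq> V \<Longrightarrow> \<phi> \<in> test_functions V"
  by (simp add: test_functions_iff)

lemma test_UNIV: "\<phi> \<in> test_functions U \<Longrightarrow> \<phi> \<in> test_functions UNIV"
  by (simp add: test_functions_iff)

lemma partial_outside_support:
  assumes "x \<notin> support f" shows "partial_deriv j f x = 0"
proof -
  have "open (- support f)" by (simp add: support_def open_Compl)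
  then have "(f has_derivative (\<lambda>_. 0)) (at x)"
    using assms not_in_support
    by (intro has_derivative_transform_within_open[of "\<lambda>_. 0" "\<lambda>_. 0" x UNIV "- support f" f]) auto
  then show ?thesis using partial_deriv_eq by blast
qed

lemma test_partial: "\<phi> \<in> test_functions \<Omega> \<Longrightarrow> partial_deriv j \<phi> \<in> test_functions \<Omega>"
  using partial_outside_support
  by (intro test_functionsI[of _ "support \<phi>"]) (auto simp: test_functions_iff smooth_partial)

lemma test_mult_left: "smooth f \<Longrightarrow> \<phi> \<in> test_functions \<Omega> \<Longrightarrow> (\<lambda>x. f x * \<phi> x) \<in> test_functions \<Omega>"
  using not_in_support[of _ \<phi>]
  by (intro test_functionsI[of _ "support \<phi>"]) (auto simp: test_functions_iff smooth_mult)

lemma test_mult_right: "\<phi> \<in> test_functions \<Omega> \<Longrightarrow> smooth f \<Longrightarrow> (\<lambda>x. \<phi> x * f x) \<in> test_functions \<Omega>"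
  using test_mult_left[of f \<phi> \<Omega>] by (simp add: mult.commute)

lemma test_cmult: "\<phi> \<in> test_functions \<Omega> \<Longrightarrow> (\<lambda>x. c * \<phi> x) \<in> test_functions \<Omega>"
  by (rule test_mult_left[OF smooth_const])

lemma test_zero: "(\<lambda>x. 0) \<in> test_functions \<Omega>"
  by (rule test_functionsI[of _ "{}"]) (auto simp: smooth_const)

lemma test_add:
  "\<phi> \<in> test_functions \<Omega> \<Longrightarrow> \<psi> \<in> test_functions \<Omega> \<Longrightarrow> (\<lambda>x. \<phi> x + \<psi> x) \<in> test_functions \<Omega>"
  using not_in_support[of _ \<phi>] not_in_support[of _ \<psi>]
  by (intro test_functionsI[of _ "support \<phi> \<union> support \<psi>"]) (auto simp: test_functions_iff smooth_add)

lemma test_diff: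
  "\<phi> \<in> test_functions \<Omega> \<Longrightarrow> \<psi> \<in> test_functions \<Omega> \<Longrightarrow> (\<lambda>x. \<phi> x - \<psi> x) \<in> test_functions \<Omega>"
  using test_add[of \<phi> \<Omega> "\<lambda>x. (-1) * \<psi> x"] test_cmult[of \<psi> \<Omega> "-1"] by simp

lemma test_sum:
  "(\<And>i. i \<in> I \<Longrightarrow> f i \<in> test_functions \<Omega>) \<Longrightarrow> (\<lambda>x. \<Sum>i\<in>I. f i x) \<in> test_functions \<Omega>"
  by (induction I rule: infinite_finite_induct) (auto intro: test_zero test_add)

lemma test_translation:
  assumes "\<phi> \<in> test_functions UNIV" shows "(\<lambda>x. \<phi> (x + z)) \<in> test_functions UNIV"
proof (rule test_functionsI[of _ "(\<lambda>x. x - z) ` support \<phi>"])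
  show "compact ((\<lambda>x. x - z) ` support \<phi>)"
    using assms by (intro compact_continuous_image continuous_intros) (simp add: test_functions_iff)
  fix x assume "x \<notin> (\<lambda>x. x - z) ` support \<phi>"
  then have "x + z \<notin> support \<phi>" by (metis add_diff_cancel_right' image_eqI)
  then show "\<phi> (x + z) = 0" by (rule not_in_support)
qed (use assms smooth_translation in \<open>auto simp: test_functions_iff\<close>)

lemma test_bounded:
  assumes "\<phi> \<in> test_functions \<Omega>"
  obtains B where "B > 0" "\<And>x. \<bar>\<phi> x\<bar> \<le> B"
proof -
  have "compact (\<phi> ` support \<phi>)"
    using assms by (intro compact_continuous_image smooth_continuous) (auto simp: test_functions_iff)
  then obtain B where B: "B > 0" "\<And>y. y \<in> \<phi> ` support \<phi> \<Longrightarrow> norm y \<le> B"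
    using compact_imp_bounded[of "\<phi> ` support \<phi>"] unfolding bounded_pos by blast
  have "\<bar>\<phi> x\<bar> \<le> B" for x
    using B not_in_support[of x \<phi>] by (cases "x \<in> support \<phi>") auto
  then show ?thesis by (rule that[OF B(1)])
qed

lemma test_bounded_support:
  assumes "\<phi> \<in> test_functions \<Omega>"
  obtains R where "R > 0" "\<And>x. norm x > R \<Longrightarrow> \<phi> x = 0"
proof -
  obtain R where R: "R > 0" "\<And>x. x \<in> support \<phi> \<Longrightarrow> norm x \<le> R"
    using assms compact_imp_bounded[of "support \<phi>"] by (auto simp: test_functions_iff bounded_pos)
  have "\<phi> x = 0" if "norm x > R" for x
    by (rule not_in_support) (use R(2)[of x] that in force)
  then show ?thesis by (rule that[OF R(1)])
qed

section \<open>Integrals of test functions and integration by parts\<close>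

lemma smooth_borel: "smooth f \<Longrightarrow> f \<in> borel_measurable borel"
  by (intro borel_measurable_continuous_onI smooth_continuous)

lemma smooth_lebesgue: "smooth f \<Longrightarrow> f \<in> borel_measurable lebesgue"
  by (rule measurable_completion) (simp add: smooth_borel)

lemma integrable_bounded_support:
  fixes f :: "'a::euclidean_space \<Rightarrow> real"
  assumes "f \<in> borel_measurable lebesgue" "\<And>x. \<bar>f x\<bar> \<le> B" "\<And>x. norm x > R \<Longrightarrow> f x = 0"
  shows "integrable lebesgue f"
proof (rule integrableI_bounded_set[where A="cball 0 R" and B=B])
  show "emeasure lebesgue (cball 0 R :: 'a set) < \<infinity>"
    using emeasure_bounded_finite[of "cball 0 R :: 'a set"] by simp
qed (use assms in auto)

lemma test_integrable:
  assumes "\<phi> \<in> test_functions \<Omega>" shows "integrable lebesgue \<phi>"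
proof -
  obtain B where B: "B > 0" "\<And>x. \<bar>\<phi> x\<bar> \<le> B" using test_bounded[OF assms] by blast
  obtain R where R: "R > 0" "\<And>x. norm x > R \<Longrightarrow> \<phi> x = 0" using test_bounded_support[OF assms] by blast
  from B(2) R(2) show ?thesis using smooth_lebesgue[OF test_smooth[OF assms]] by (intro integrable_bounded_support)
qed

lemma test_L2: "\<phi> \<in> test_functions \<Omega> \<Longrightarrow> \<phi> \<in> L2 lebesgue"
  using test_integrable[OF test_mult_left[OF test_smooth], of \<phi> \<Omega> \<phi> \<Omega>] smooth_lebesgue[OF test_smooth, of \<phi> \<Omega>]
  by (simp add: L2_def power2_eq_square)

text \<open>For a Borel function the integral may be taken over \<open>lborel\<close>, whose
  invariance is an equality of measures. This is why Borel representatives are chosen later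
  on.\<close>

lemma integral_lebesgue_translation:
  fixes f :: "'a::euclidean_space \<Rightarrow> real"
  assumes "f \<in> borel_measurable borel"
  shows "(\<integral>x. f (x + z) \<partial>lebesgue) = (\<integral>x. f x \<partial>lebesgue)"
proof -
  have m: "(\<lambda>x. f (x + z)) \<in> borel_measurable borel" using assms by measurable
  have "(\<integral>x. f (x + z) \<partial>lebesgue) = (\<integral>x. f (z + x) \<partial>lborel)"
    using m by (simp add: integral_completion add.commute)
  also have "\<dots> = (\<integral>x. f x \<partial>distr lborel borel ((+) z))"
    using assms by (subst integral_distr) auto
  also have "\<dots> = (\<integral>x. f x \<partial>lebesgue)" using assms by (simp add: lborel_distr_plus integral_completion)
  finally show ?thesis .
qed

lemma axis_difference_quotient_bound:
  assumes "smooth f" "\<And>x. \<bar>partial_deriv j f x\<bar> \<le> B"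
  shows "\<bar>f (x + t *\<^sub>R axis j 1) - f x\<bar> \<le> B * \<bar>t\<bar>"
proof -
  have "norm (f (x + t *\<^sub>R axis j 1) - f (x + 0 *\<^sub>R axis j 1)) \<le> B * norm (t - 0)"
    by (rule field_differentiable_bound[where S=UNIV and f="\<lambda>t. f (x + t *\<^sub>R axis j 1)"])
       (use smooth_DERIV[OF assms(1)] assms(2) in auto)
  then show ?thesis by simp
qed

text \<open>By translation invariance every difference quotient of \<phi> has integral 0, and
  dominated convergence carries this over to the derivative. No iterated integral is
  involved.\<close>

lemma integral_partial_deriv:
  assumes \<phi>: "\<phi> \<in> test_functions \<Omega>"
  shows "(\<integral>x. partial_deriv j \<phi> x \<partial>lebesgue) = 0"
proof -
  define e where "e = axis j (1::real)"
  note sm = test_smooth[OF \<phi>]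
  obtain B where "B > 0" and B: "\<And>x. \<bar>partial_deriv j \<phi> x\<bar> \<le> B" using test_bounded[OF test_partial[OF \<phi>, of j]] by blast
  obtain R where "R > 0" and R: "\<And>x. norm x > R \<Longrightarrow> \<phi> x = 0" using test_bounded_support[OF \<phi>] by blast
  \<comment> \<open>Steps of length at most 1 keep all quotients supported in the ball of radius
    \<open>R + 1\<close>.\<close>
  define t where "t n = 1 / real (Suc n)" for n
  define q where "q n x = (\<phi> (x + t n *\<^sub>R e) - \<phi> x) / t n" for n x
  have t: "t n > 0" "t n \<le> 1" for n by (auto simp: t_def)
  have int: "integrable lebesgue (\<lambda>x. \<phi> (x + z))" for z
    using test_integrable[OF test_translation[OF test_UNIV[OF \<phi>]]] .
  have "(\<integral>x. q n x \<partial>lebesgue) = 0" for n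
    unfolding q_def using int[of "t n *\<^sub>R e"] int[of 0]
    by (simp add: integral_lebesgue_translation smooth_borel sm)
  moreover have "(\<lambda>n. \<integral>x. q n x \<partial>lebesgue) \<longlonglongrightarrow> (\<integral>x. partial_deriv j \<phi> x \<partial>lebesgue)"
  proof (rule integral_dominated_convergence[where w="\<lambda>x. B * indicator (cball 0 (R + 1)) x"])
    show "partial_deriv j \<phi> \<in> borel_measurable lebesgue" by (intro smooth_lebesgue smooth_partial sm)
    show "q n \<in> borel_measurable lebesgue" for n
      unfolding q_def using int[of "t n *\<^sub>R e"] int[of 0] by (intro borel_measurable_divide borel_measurable_diff) auto
    show "integrable lebesgue (\<lambda>x. B * indicator (cball 0 (R + 1)) x :: real)"
      using emeasure_bounded_finite[OF bounded_cball[of 0 "R + 1"]]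
      by (intro integrable_mult_right integrable_real_indicator) auto
    have "(\<lambda>n. q n x) \<longlonglongrightarrow> partial_deriv j \<phi> x" for x
    proof -
      have "((\<lambda>h. (\<phi> (x + (0 + h) *\<^sub>R e) - \<phi> (x + 0 *\<^sub>R e)) / h) \<longlongrightarrow> partial_deriv j \<phi> x) (at 0)"
        using smooth_DERIV[OF sm, of x j 0] unfolding DERIV_def e_def by simp
      moreover have "filterlim t (at 0) sequentially"
        unfolding filterlim_at t_def using LIMSEQ_Suc[OF lim_1_over_n] by auto
      ultimately show ?thesis unfolding q_def
        using filterlim_compose[of "\<lambda>h. (\<phi> (x + (0 + h) *\<^sub>R e) - \<phi> (x + 0 *\<^sub>R e)) / h"] by fastforce
    qed
    then show "AE x in lebesgue. (\<lambda>n. q n x) \<longlonglongrightarrow> partial_deriv j \<phi> x" by simp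
    have "norm (q n x) \<le> B * indicator (cball 0 (R + 1)) x" for n x
    proof (cases "norm x \<le> R + 1")
      case True
      have "\<bar>\<phi> (x + t n *\<^sub>R e) - \<phi> x\<bar> \<le> B * t n"
        using axis_difference_quotient_bound[OF sm B, of x "t n"] t[of n] by (simp add: e_def)
      then show ?thesis using True t[of n] by (simp add: q_def field_simps)
    next
      case False
      have "norm x - norm (t n *\<^sub>R e) \<le> norm (x + t n *\<^sub>R e)" by (metis norm_diff_ineq)
      moreover have "norm (t n *\<^sub>R e) \<le> 1" using t[of n] by (simp add: e_def)
      ultimately have "norm (x + t n *\<^sub>R e) > R" using False by linarith
      with False R show ?thesis by (simp add: q_def)
    qed
    then show "AE x in lebesgue. norm (q n x) \<le> B * indicator (cball 0 (R + 1)) x" for n by simp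
  qed
  ultimately show ?thesis by (simp add: LIMSEQ_const_iff)
qed

lemma integration_by_parts:
  assumes "smooth f" "\<phi> \<in> test_functions \<Omega>"
  shows "ip lebesgue f (partial_deriv j \<phi>) = - ip lebesgue (partial_deriv j f) \<phi>"
proof -
  have "integrable lebesgue (\<lambda>x. f x * partial_deriv j \<phi> x)" "integrable lebesgue (\<lambda>x. partial_deriv j f x * \<phi> x)"
    using assms by (auto intro!: test_integrable test_mult_left test_partial smooth_partial)
  moreover have "(\<integral>x. partial_deriv j (\<lambda>x. f x * \<phi> x) x \<partial>lebesgue) = 0"
    using integral_partial_deriv[OF test_mult_left[OF assms]] .
  ultimately show ?thesis
    unfolding ip_def using assms by (simp add: partial_mult test_smooth)
qed

text \<open>The square of the \<open>H\<^sup>1\<close> norm on the whole space; without the root it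
  is the quadratic form of the operator \<open>helmholtz\<close>.\<close>

definition H1 :: "(real ^ 'd \<Rightarrow> real) \<Rightarrow> real" where
  "H1 \<phi> = ip lebesgue \<phi> \<phi> + (\<Sum>j\<in>UNIV. ip lebesgue (partial_deriv j \<phi>) (partial_deriv j \<phi>))"

definition helmholtz :: "(real ^ 'd \<Rightarrow> real) \<Rightarrow> real ^ 'd \<Rightarrow> real" where
  "helmholtz \<phi> x = \<phi> x - (\<Sum>j\<in>UNIV. partial_deriv j (partial_deriv j \<phi>) x)"

lemma ip_le_H1: "ip lebesgue \<phi> \<phi> \<le> H1 \<phi>"
  by (simp add: H1_def sum_nonneg ip_nonneg)

lemma ip_partial_le_H1: "ip lebesgue (partial_deriv j \<phi>) (partial_deriv j \<phi>) \<le> H1 \<phi>"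
proof -
  have "ip lebesgue (partial_deriv j \<phi>) (partial_deriv j \<phi>)
      \<le> (\<Sum>j\<in>UNIV. ip lebesgue (partial_deriv j \<phi>) (partial_deriv j \<phi>))"
    by (rule member_le_sum) (auto simp: ip_nonneg)
  then show ?thesis using ip_nonneg[of lebesgue \<phi>] by (simp add: H1_def)
qed

lemma H1_nonneg: "H1 \<phi> \<ge> 0"
  by (rule order_trans[OF ip_nonneg ip_le_H1])

lemma test_helmholtz: "\<phi> \<in> test_functions \<Omega> \<Longrightarrow> helmholtz \<phi> \<in> test_functions \<Omega>"
  unfolding helmholtz_def[abs_def] by (intro test_diff test_sum test_partial)

lemma helmholtz_energy:
  assumes \<phi>: "\<phi> \<in> test_functions \<Omega>"
  shows "ip lebesgue (helmholtz \<phi>) \<phi> = H1 \<phi>"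
proof -
  have "ip lebesgue (helmholtz \<phi>) \<phi> = ip lebesgue \<phi> \<phi> - (\<Sum>j\<in>UNIV. ip lebesgue (partial_deriv j (partial_deriv j \<phi>)) \<phi>)"
    unfolding helmholtz_def[abs_def] using \<phi>
    by (subst ip_diff_left, (intro test_L2[of _ \<Omega>] test_sum test_partial; assumption)+,
        subst ip_sum_left) (auto intro!: test_L2 test_partial)
  moreover have "ip lebesgue (partial_deriv j (partial_deriv j \<phi>)) \<phi> = - ip lebesgue (partial_deriv j \<phi>) (partial_deriv j \<phi>)" for j
    using integration_by_parts[OF smooth_partial[OF test_smooth[OF \<phi>]] \<phi>] by simp
  ultimately show ?thesis by (simp add: H1_def sum_negf)
qed

text \<open>One integration by parts turns the mixed term into twice the squared gradient. Two of
  them, with commuting derivatives, move one \<open>\<partial>\<^sub>j\<close> and one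
  \<open>\<partial>\<^sub>k\<close> across the product of
  \<open>\<partial>\<^sub>j \<partial>\<^sub>j \<phi>\<close> and
  \<open>\<partial>\<^sub>k \<partial>\<^sub>k \<phi>\<close>, so that the squared Laplacian becomes
  the sum of all squared second derivatives.\<close>

lemma helmholtz_norm:
  assumes \<phi>: "\<phi> \<in> test_functions \<Omega>"
  shows "ip lebesgue (helmholtz \<phi>) (helmholtz \<phi>) = ip lebesgue \<phi> \<phi>
    + 2 * (\<Sum>j\<in>UNIV. ip lebesgue (partial_deriv j \<phi>) (partial_deriv j \<phi>))
    + (\<Sum>j\<in>UNIV. \<Sum>k\<in>UNIV. ip lebesgue (partial_deriv j (partial_deriv k \<phi>)) (partial_deriv j (partial_deriv k \<phi>)))"
proof -
  define L where "L x = (\<Sum>j\<in>UNIV. partial_deriv j (partial_deriv j \<phi>) x)" for x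
  have L: "L \<in> test_functions \<Omega>" unfolding L_def[abs_def] using \<phi> by (intro test_sum test_partial)
  have "ip lebesgue (helmholtz \<phi>) (helmholtz \<phi>) = ip lebesgue (helmholtz \<phi>) \<phi> - ip lebesgue (helmholtz \<phi>) L"
    using \<phi> L test_helmholtz[OF \<phi>] by (subst (2) helmholtz_def[abs_def]) (simp add: ip_diff_right test_L2 flip: L_def)
  also have "ip lebesgue (helmholtz \<phi>) \<phi> = H1 \<phi>" using helmholtz_energy[OF \<phi>] .
  also have "ip lebesgue (helmholtz \<phi>) L = ip lebesgue \<phi> L - ip lebesgue L L"
    using \<phi> L by (subst helmholtz_def[abs_def]) (simp add: ip_diff_left test_L2 flip: L_def)
  also have "ip lebesgue \<phi> L = - (\<Sum>j\<in>UNIV. ip lebesgue (partial_deriv j \<phi>) (partial_deriv j \<phi>))"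
  proof -
    have "ip lebesgue \<phi> L = (\<Sum>j\<in>UNIV. ip lebesgue (partial_deriv j (partial_deriv j \<phi>)) \<phi>)"
      unfolding ip_commute[of _ \<phi>] L_def[abs_def] using \<phi>
      by (intro ip_sum_left) (auto intro!: test_L2 test_partial)
    also have "\<dots> = (\<Sum>j\<in>UNIV. - ip lebesgue (partial_deriv j \<phi>) (partial_deriv j \<phi>))"
      using integration_by_parts[OF smooth_partial[OF test_smooth[OF \<phi>]] \<phi>] by simp
    finally show ?thesis by (simp add: sum_negf)
  qed
  also have "ip lebesgue L L = (\<Sum>j\<in>UNIV. \<Sum>k\<in>UNIV. ip lebesgue (partial_deriv j (partial_deriv k \<phi>)) (partial_deriv j (partial_deriv k \<phi>)))"
  proof -
    note t = test_partial[OF \<phi>]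
    have sm: "smooth \<phi>" using \<phi> test_smooth by blast
    have *: "ip lebesgue (partial_deriv j (partial_deriv j \<phi>)) (partial_deriv k (partial_deriv k \<phi>))
       = ip lebesgue (partial_deriv j (partial_deriv k \<phi>)) (partial_deriv j (partial_deriv k \<phi>))" for j k
    proof -
      have "ip lebesgue (partial_deriv j (partial_deriv j \<phi>)) (partial_deriv k (partial_deriv k \<phi>))
        = - ip lebesgue (partial_deriv j \<phi>) (partial_deriv j (partial_deriv k (partial_deriv k \<phi>)))"
        using integration_by_parts[OF test_smooth[OF t] test_partial[OF t[of k], of k], of j j] by simp
      also have "partial_deriv j (partial_deriv k (partial_deriv k \<phi>)) = partial_deriv k (partial_deriv j (partial_deriv k \<phi>))"
        by (rule partial_deriv_commute) (intro smooth_partial sm)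
      also have "- ip lebesgue (partial_deriv j \<phi>) \<dots> = ip lebesgue (partial_deriv k (partial_deriv j \<phi>)) (partial_deriv j (partial_deriv k \<phi>))"
        using integration_by_parts[OF test_smooth[OF t] test_partial[OF t[of k], of j], of j k] by simp
      also have "partial_deriv k (partial_deriv j \<phi>) = partial_deriv j (partial_deriv k \<phi>)"
        by (rule partial_deriv_commute[OF sm])
      finally show ?thesis .
    qed
    have "ip lebesgue L L = (\<Sum>j\<in>UNIV. ip lebesgue (partial_deriv j (partial_deriv j \<phi>)) L)"
      by (subst L_def[abs_def], rule ip_sum_left) (auto intro!: test_L2[OF test_partial[OF t]] test_L2[OF L])
    also have "\<dots> = (\<Sum>j\<in>UNIV. \<Sum>k\<in>UNIV. ip lebesgue (partial_deriv k (partial_deriv k \<phi>)) (partial_deriv j (partial_deriv j \<phi>)))"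
      unfolding ip_commute[of _ _ L]
      by (intro sum.cong refl, subst L_def[abs_def], rule ip_sum_left) (auto intro!: test_L2[OF test_partial[OF t]])
    also have "\<dots> = (\<Sum>k\<in>UNIV. \<Sum>j\<in>UNIV. ip lebesgue (partial_deriv k (partial_deriv k \<phi>)) (partial_deriv j (partial_deriv j \<phi>)))"
      by (rule sum.swap)
    also have "\<dots> = (\<Sum>k\<in>UNIV. \<Sum>j\<in>UNIV. ip lebesgue (partial_deriv k (partial_deriv j \<phi>)) (partial_deriv k (partial_deriv j \<phi>)))"
      by (intro sum.cong refl *)
    finally show ?thesis .
  qed
  finally show ?thesis by (simp add: H1_def)
qed

lemma H1_le_helmholtz:
  assumes "\<phi> \<in> test_functions \<Omega>"
  shows "H1 \<phi> \<le> (nrm lebesgue (helmholtz \<phi>))\<^sup>2"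
  unfolding nrm_sq helmholtz_norm[OF assms] H1_def by (simp add: sum_nonneg ip_nonneg)

text \<open>This bound admits the first derivatives of \<Psi> as test sequences in the curl
  conditions.\<close>

lemma H1_partial_le_helmholtz:
  assumes "\<phi> \<in> test_functions \<Omega>"
  shows "H1 (partial_deriv k \<phi>) \<le> (nrm lebesgue (helmholtz \<phi>))\<^sup>2"
proof -
  have "ip lebesgue (partial_deriv k \<phi>) (partial_deriv k \<phi>) \<le> (\<Sum>j\<in>UNIV. ip lebesgue (partial_deriv j \<phi>) (partial_deriv j \<phi>))"
    by (rule member_le_sum) (auto simp: ip_nonneg)
  moreover have "ip lebesgue (partial_deriv j (partial_deriv k \<phi>)) (partial_deriv j (partial_deriv k \<phi>))
    \<le> (\<Sum>k\<in>UNIV. ip lebesgue (partial_deriv j (partial_deriv k \<phi>)) (partial_deriv j (partial_deriv k \<phi>)))" for j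
    by (rule member_le_sum) (auto simp: ip_nonneg)
  then have "(\<Sum>j\<in>UNIV. ip lebesgue (partial_deriv j (partial_deriv k \<phi>)) (partial_deriv j (partial_deriv k \<phi>)))
    \<le> (\<Sum>j\<in>UNIV. \<Sum>k\<in>UNIV. ip lebesgue (partial_deriv j (partial_deriv k \<phi>)) (partial_deriv j (partial_deriv k \<phi>)))"
    by (rule sum_mono)
  ultimately show ?thesis
    unfolding nrm_sq helmholtz_norm[OF assms] H1_def
    using ip_nonneg[of lebesgue \<phi>]
      sum_nonneg[of UNIV "\<lambda>j. ip lebesgue (partial_deriv j \<phi>) (partial_deriv j \<phi>)", OF ip_nonneg]
    by linarith
qed


section \<open>Bump functions and density of test functions\<close>

text \<open>This family contains the standard mollifier profile and is closed under differentiation up to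
  linear combinations.\<close>

definition flat :: "nat \<Rightarrow> real \<Rightarrow> real" where
  "flat n t = (if t > 0 then exp (- 1 / t) / t ^ n else 0)"

text \<open>Substituting \<open>s = 1 / t\<close> on the right of 0 reduces the claim to the decay
  of \<open>s ^ n / exp s\<close>.\<close>

lemma flat_tendsto_0: "(flat n \<longlongrightarrow> 0) (at 0)"
proof -
  have lim: "((\<lambda>t::real. inverse t ^ n / exp (inverse t)) \<longlongrightarrow> 0) (at_right 0)"
    using filterlim_compose[OF tendsto_power_div_exp_0 filterlim_inverse_at_top_right] .
  have "((\<lambda>t. flat n t) \<longlongrightarrow> 0) (at_right 0)"
  proof (rule Lim_transform_eventually[OF lim])
    show "\<forall>\<^sub>F t in at_right 0. inverse t ^ n / exp (inverse t) = flat n t"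
      by (auto simp: eventually_at_right_field flat_def exp_minus field_simps power_inverse intro!: exI[of _ 1])
  qed
  moreover have "((\<lambda>t. flat n t) \<longlongrightarrow> 0) (at_left 0)"
    by (rule tendsto_eventually) (auto simp: eventually_at_left_field flat_def intro!: exI[of _ "-1"])
  ultimately show ?thesis by (simp add: filterlim_split_at)
qed

text \<open>Away from 0 this is a computation. At 0 the difference quotient of \<open>flat n\<close>
  is exactly \<open>flat (Suc n)\<close>, which has just been shown to vanish in the limit.\<close>

lemma flat_DERIV:
  "(flat n has_real_derivative (flat (n + 2) t - real n * flat (n + 1) t)) (at t)"
proof -
  consider "t > 0" | "t < 0" | "t = 0" by linarith
  then show ?thesis
  proof cases
    case 1
    have "((\<lambda>t. exp (- 1 / t) / t ^ n) has_real_derivative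
       (exp (- 1 / t) * (1 / t\<^sup>2) * t ^ n - exp (- 1 / t) * (real n * t ^ (n - 1))) / (t ^ n * t ^ n)) (at t)"
      using 1 by (auto intro!: derivative_eq_intros simp: power2_eq_square)
    moreover have "(exp (- 1 / t) * (1 / t\<^sup>2) * t ^ n - exp (- 1 / t) * (real n * t ^ (n - 1))) / (t ^ n * t ^ n)
       = flat (n + 2) t - real n * flat (n + 1) t"
      using 1 by (cases n) (simp_all add: flat_def field_simps power2_eq_square)
    ultimately have "((\<lambda>t. exp (- 1 / t) / t ^ n) has_real_derivative (flat (n + 2) t - real n * flat (n + 1) t)) (at t)"
      by simp
    then show ?thesis
      by (rule has_field_derivative_transform_within_open[of _ _ _ "{0<..}"]) (use 1 in \<open>auto simp: flat_def\<close>)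
  next
    case 2
    have "((\<lambda>t. 0) has_real_derivative (flat (n + 2) t - real n * flat (n + 1) t)) (at t)"
      using 2 by (simp add: flat_def)
    then show ?thesis
      by (rule has_field_derivative_transform_within_open[of _ _ _ "{..<0}"]) (use 2 in \<open>auto simp: flat_def\<close>)
  next
    case 3
    have "((\<lambda>h. (flat n (0 + h) - flat n 0) / h) \<longlongrightarrow> 0) (at 0)"
    proof (rule Lim_transform_eventually[OF flat_tendsto_0[of "Suc n"]])
      show "\<forall>\<^sub>F h in at 0. flat (Suc n) h = (flat n (0 + h) - flat n 0) / h"
        by (auto simp: eventually_at flat_def field_simps intro!: exI[of _ 1])
    qed
    then show ?thesis using 3 by (simp add: DERIV_def flat_def)
  qed
qed

lemma flat_bounds: "flat 0 t \<ge> 0" "flat 0 t \<le> 1" "flat 0 t > 0 \<longleftrightarrow> t > 0"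
  by (auto simp: flat_def)

text \<open>The induction on the order must leave \<open>n\<close> free, since each derivative
  raises it. The slopes \<open>c = 1\<close> and \<open>c = - 1\<close> produce the two opposite
  faces of a box.\<close>

lemma smooth_flat: "smooth (\<lambda>x::real^'d. flat n (c * x $ j + a))"
proof -
  have d: "((\<lambda>x::real^'d. flat n (c * x $ j + a)) has_derivative
      (\<lambda>v. (flat (n + 2) (c * x $ j + a) - real n * flat (n + 1) (c * x $ j + a)) * (c * v $ j))) (at x)" for x n
  proof -
    have "((\<lambda>x::real^'d. c * x $ j + a) has_derivative (\<lambda>v. c * v $ j)) (at x)"
      by (auto intro!: derivative_eq_intros bounded_linear_imp_has_derivative bounded_linear_vec_nth)
    from has_derivative_compose[OF this flat_DERIV[unfolded has_field_derivative_def]]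
    show ?thesis by (simp add: o_def)
  qed
  have "Ck_on k UNIV (\<lambda>x::real^'d. flat n (c * x $ j + a))" for k n
  proof (induction k arbitrary: n)
    case 0
    show ?case using d by (auto intro!: has_derivative_continuous_on)
  next
    case (Suc k)
    have "partial_deriv i (\<lambda>x::real^'d. flat n (c * x $ j + a))
      = (\<lambda>x. (c * axis i 1 $ j) * (flat (n + 2) (c * x $ j + a) + (- real n) * flat (n + 1) (c * x $ j + a)))" for i
      by (rule ext) (subst partial_deriv_eq[OF d], simp add: algebra_simps)
    moreover have "Ck_on k UNIV (\<lambda>x::real^'d. (c * axis i 1 $ j) * (flat (n + 2) (c * x $ j + a) + (- real n) * flat (n + 1) (c * x $ j + a)))" for i
      by (intro Ck_on_mult Ck_on_const Ck_on_add Suc.IH)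
    moreover have "(\<lambda>x::real^'d. flat n (c * x $ j + a)) differentiable_on UNIV"
      using d by (auto simp: differentiable_on_def differentiable_def)
    ultimately show ?case by simp
  qed
  then show ?thesis by (simp add: smooth_def)
qed

definition box_bump :: "real ^ 'd \<Rightarrow> real ^ 'd \<Rightarrow> real ^ 'd \<Rightarrow> real" where
  "box_bump a b x = (\<Prod>j\<in>UNIV. flat 0 (x $ j - a $ j) * flat 0 (b $ j - x $ j))"

lemma smooth_box_bump: "smooth (box_bump a b)"
proof -
  have "smooth (\<lambda>x. flat 0 (1 * x $ j + - a $ j) * flat 0 ((- 1) * x $ j + b $ j))" for j
    by (intro smooth_mult smooth_flat)
  then have "smooth (\<lambda>x. \<Prod>j\<in>UNIV. flat 0 (1 * x $ j + - a $ j) * flat 0 ((- 1) * x $ j + b $ j))"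
    by (intro smooth_prod)
  then show ?thesis by (simp add: box_bump_def[abs_def])
qed

lemma box_bump_nonneg: "box_bump a b x \<ge> 0"
  unfolding box_bump_def by (intro prod_nonneg) (auto simp: flat_bounds)

lemma box_bump_le_1: "box_bump a b x \<le> 1"
  unfolding box_bump_def by (intro prod_le_1) (auto simp: flat_bounds mult_le_one)

lemma box_bump_pos: "x \<in> box a b \<Longrightarrow> box_bump a b x > 0"
  unfolding box_bump_def by (intro prod_pos) (auto simp: flat_bounds mem_box_cart)

lemma box_bump_outside: "x \<notin> box a b \<Longrightarrow> box_bump a b x = 0"
  unfolding box_bump_def by (auto simp: mem_box_cart flat_def)

lemma box_bump_test: "cbox a b \<subseteq> \<Omega> \<Longrightarrow> box_bump a b \<in> test_functions \<Omega>"
  using box_bump_outside[of _ a b] box_subset_cbox[of a b]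
  by (intro test_functionsI[of _ "cbox a b"]) (auto simp: smooth_box_bump subset_iff)

section \<open>Functions orthogonal to every test function vanish\<close>

lemma indicator_L2:
  assumes "bounded A" "A \<in> sets lebesgue"
  shows "(indicator A :: 'a::euclidean_space \<Rightarrow> real) \<in> L2 lebesgue"
proof -
  have "A \<in> lmeasurable" using assms by (simp add: bounded_set_imp_lmeasurable)
  then have "integrable lebesgue (indicator A :: 'a \<Rightarrow> real)"
    by (auto simp: fmeasurable_def)
  moreover have "(\<lambda>x::'a. (indicator A x :: real)\<^sup>2) = indicator A"
    by (auto simp: indicator_def)
  ultimately show ?thesis using assms by (simp add: L2_def)
qed

text \<open>For the bump \<open>P\<close>, with \<open>0 < P \<le> 1\<close> in the box and
  \<open>P = 0\<close> outside, the functions \<open>1 - (1 - P) ^ n\<close> are test functions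
  below the indicator of the box and converge to it pointwise.\<close>

lemma orthogonal_to_tests_imp_box_integral_0:
  fixes r :: "real ^ 'd \<Rightarrow> real"
  assumes r: "r \<in> L2 lebesgue" and orth: "\<And>\<rho>. \<rho> \<in> test_functions UNIV \<Longrightarrow> ip lebesgue r \<rho> = 0"
  shows "ip lebesgue r (indicator (box a b)) = 0"
proof -
  define P where "P = box_bump a b"
  note meas [measurable] = L2_measurable[OF r]
  have P: "P \<in> test_functions UNIV" unfolding P_def by (simp add: box_bump_test)
  define f where "f n x = 1 - (1 - P x) ^ n" for n x
  have bx: "f n x \<ge> 0" "f n x \<le> indicator (box a b) x" for n x
  proof -
    have "0 \<le> 1 - P x" "1 - P x \<le> 1" unfolding P_def using box_bump_le_1[of a b x] box_bump_nonneg[of a b x] by auto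
    then have "0 \<le> (1 - P x) ^ n" "(1 - P x) ^ n \<le> 1" by (auto simp: power_le_one)
    then show "f n x \<ge> 0" "f n x \<le> indicator (box a b) x"
      using box_bump_outside[of x a b] by (auto simp: f_def indicator_def P_def)
  qed
  have "f n \<in> test_functions UNIV" for n
  proof (rule test_functionsI[of _ "cbox a b"])
    show "smooth (f n)" unfolding f_def[abs_def] P_def
      by (intro smooth_diff smooth_const smooth_power smooth_box_bump)
    show "f n x = 0" if "x \<notin> cbox a b" for x
      using bx[of n x] that box_subset_cbox[of a b] by (simp add: indicator_def subset_iff) (metis of_bool_eq(1) order_antisym)
  qed auto
  then have "ip lebesgue r (f n) = 0" and fm [measurable]: "f n \<in> borel_measurable lebesgue" for n
    using orth test_L2 L2_measurable by blast+
  moreover have "(\<lambda>n. \<integral>x. r x * f n x \<partial>lebesgue) \<longlonglongrightarrow> (\<integral>x. r x * indicator (box a b) x \<partial>lebesgue)"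
  proof (rule integral_dominated_convergence[where w="\<lambda>x. \<bar>r x * indicator (box a b) x\<bar>"])
    show "integrable lebesgue (\<lambda>x. \<bar>r x * indicator (box a b) x\<bar>)"
      by (intro integrable_abs L2_integrable_mult r indicator_L2) auto
    show "(\<lambda>x. r x * indicator (box a b) x) \<in> borel_measurable lebesgue" "\<And>n. (\<lambda>x. r x * f n x) \<in> borel_measurable lebesgue"
      by (intro borel_measurable_times meas fm L2_measurable[OF indicator_L2]; simp)+
    have "(\<lambda>n. f n x) \<longlonglongrightarrow> indicator (box a b) x" for x
    proof (cases "x \<in> box a b")
      case True
      then have "\<bar>1 - P x\<bar> < 1" unfolding P_def using box_bump_pos[of x a b] box_bump_le_1[of a b x] by simp
      then have "(\<lambda>n. 1 - (1 - P x) ^ n) \<longlonglongrightarrow> 1 - 0" by (intro tendsto_intros LIMSEQ_power_zero) auto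
      then show ?thesis using True by (simp add: f_def)
    next
      case False
      then show ?thesis by (simp add: f_def P_def box_bump_outside)
    qed
    then show "AE x in lebesgue. (\<lambda>n. r x * f n x) \<longlonglongrightarrow> r x * indicator (box a b) x"
      by (auto intro!: tendsto_intros)
    have "\<bar>f n x\<bar> \<le> \<bar>indicator (box a b) x\<bar>" for n x using bx[of n x] by simp
    then show "AE x in lebesgue. norm (r x * f n x) \<le> \<bar>r x * indicator (box a b) x\<bar>" for n
      by (auto simp: abs_mult intro!: mult_left_mono)
  qed
  ultimately show ?thesis by (simp add: ip_def LIMSEQ_const_iff)
qed

text \<open>Boxes are an intersection-stable generator of the Borel sets, so a Dynkin argument
  extends the vanishing of the integral to all of them. The total integral is what handles
  complements.\<close>

lemma integral_box_0_imp_AE_0: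
  fixes f :: "real ^ 'd \<Rightarrow> real"
  assumes f: "integrable lborel f" and total: "integral\<^sup>L lborel f = 0"
    and box: "\<And>a b. (LINT x:box a b|lborel. f x) = 0"
  shows "AE x in lborel. f x = 0"
proof (rule sigma_finite_measure.density_zero[OF lborel.sigma_finite_measure_axioms f])
  fix A :: "(real ^ 'd) set" assume "A \<in> sets lborel"
  have si: "set_integrable lborel B f" if "B \<in> sets borel" for B
    unfolding set_integrable_def using that by (intro integrable_mult_indicator f) auto
  have eq: "sigma_sets UNIV (range (\<lambda>(a, b). box a b)) = sets (borel :: (real ^ 'd) measure)"
    by (simp add: borel_eq_box)
  have A: "A \<in> sigma_sets UNIV (range (\<lambda>(a, b). box a b :: (real ^ 'd) set))"
    using \<open>A \<in> sets lborel\<close> by (simp add: eq)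
  have stable: "Int_stable (range (\<lambda>(a, b). box a b :: (real ^ 'd) set))"
    by (auto simp: Int_stable_def box_Int_box)
  have "range (\<lambda>(a, b). box a b :: (real ^ 'd) set) \<subseteq> Pow UNIV" by simp
  from stable this A show "(LINT x:A|lborel. f x) = 0"
  proof (induction rule: sigma_sets_induct_disjoint)
    case (compl A)
    then have "A \<in> sets borel" by (simp add: eq)
    then have "(LINT x:A \<union> (UNIV - A)|lborel. f x) = (LINT x:A|lborel. f x) + (LINT x:(UNIV - A)|lborel. f x)"
      by (intro set_integral_Un si) auto
    then show ?case using compl total by (simp add: set_lebesgue_integral_def)
  next
    case (union A)
    then have b: "A i \<in> sets borel" for i by (auto simp: eq)
    have "(LINT x:(\<Union>i. A i)|lborel. f x) = (\<Sum>i. LINT x:A i|lborel. f x)"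
    proof (rule lebesgue_integral_countable_add)
      show "set_integrable lborel (\<Union>i. A i) f" using b by (intro si) auto
      show "A i \<inter> A j = {}" if "i \<noteq> j" for i j
        using union(1) that by (auto simp: disjoint_family_on_def)
    qed (use b in auto)
    then show ?case using union by simp
  qed (use box in \<open>auto simp: set_lebesgue_integral_def\<close>)
qed

text \<open>A square integrable \<open>r\<close> need not be integrable, so it is cut off to the
  boxes \<open>Q m\<close>, which exhaust the space. The cut-off function again has zero integral
  over boxes because two boxes intersect in a box.\<close>

lemma orthogonal_to_tests_imp_AE_0:
  fixes r :: "real ^ 'd \<Rightarrow> real"
  assumes r: "r \<in> L2 lebesgue" and orth: "\<And>\<rho>. \<rho> \<in> test_functions UNIV \<Longrightarrow> ip lebesgue r \<rho> = 0"
  shows "AE x in lebesgue. r x = 0"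
proof -
  obtain r' where r' [measurable]: "r' \<in> borel_measurable lborel" and eq: "AE x in lborel. r x = r' x"
    using completion_ex_borel_measurable_real[OF L2_measurable[OF r]] by blast
  have eq': "AE x in lebesgue. r x = r' x" using eq by (rule AE_completion)
  define Q where "Q m = (box (\<chi> i. - real m) (\<chi> i. real m) :: (real ^ 'd) set)" for m
  have int0: "(\<integral>x. r' x * indicator (box a b) x \<partial>lborel) = 0" "integrable lborel (\<lambda>x. r' x * indicator (box a b) x)" for a b
  proof -
    have "r' \<in> borel_measurable lebesgue" "r \<in> borel_measurable lebesgue"
      using r' L2_measurable[OF r] by (auto intro: measurable_completion)
    then have ml: "(\<lambda>x. r' x * indicator (box a b) x) \<in> borel_measurable lebesgue"
        "(\<lambda>x. r x * indicator (box a b) x) \<in> borel_measurable lebesgue"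
      by (intro borel_measurable_times L2_measurable[OF indicator_L2]; simp)+
    have cong: "AE x in lebesgue. r x * indicator (box a b) x = r' x * indicator (box a b) x"
      using eq' by eventually_elim simp
    have m: "(\<lambda>x. r' x * indicator (box a b) x) \<in> borel_measurable lborel" by measurable
    have "(\<integral>x. r' x * indicator (box a b) x \<partial>lborel) = (\<integral>x. r' x * indicator (box a b) x \<partial>lebesgue)"
      using m by (simp add: integral_completion)
    also have "\<dots> = (\<integral>x. r x * indicator (box a b) x \<partial>lebesgue)"
      using cong by (intro integral_cong_AE ml) auto
    also have "\<dots> = 0" using orthogonal_to_tests_imp_box_integral_0[OF r orth] by (simp add: ip_def)
    finally show "(\<integral>x. r' x * indicator (box a b) x \<partial>lborel) = 0" .
    have "integrable lebesgue (\<lambda>x. r x * indicator (box a b) x)"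
      by (intro L2_integrable_mult r indicator_L2) auto
    then have "integrable lebesgue (\<lambda>x. r' x * indicator (box a b) x)"
      using integrable_cong_AE[OF ml(2,1) cong] by blast
    then show "integrable lborel (\<lambda>x. r' x * indicator (box a b) x)"
      using m by (simp add: integrable_completion)
  qed
  have "AE x in lborel. r' x * indicator (Q m) x = 0" for m
  proof (rule integral_box_0_imp_AE_0)
    show "integrable lborel (\<lambda>x. r' x * indicator (Q m) x)" "integral\<^sup>L lborel (\<lambda>x. r' x * indicator (Q m) x) = 0"
      unfolding Q_def using int0 by auto
    fix a b :: "real ^ 'd"
    obtain c d where cd: "Q m \<inter> box a b = box c d" unfolding Q_def box_Int_box by blast
    have "(LINT x:box a b|lborel. r' x * indicator (Q m) x) = (\<integral>x. r' x * indicator (box c d) x \<partial>lborel)"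
      unfolding cd[symmetric] set_lebesgue_integral_def
      by (intro Bochner_Integration.integral_cong) (auto simp: indicator_def)
    then show "(LINT x:box a b|lborel. r' x * indicator (Q m) x) = 0" using int0 by simp
  qed
  then have "AE x in lborel. \<forall>m. r' x * indicator (Q m) x = 0" by (subst AE_all_countable) blast
  then have "AE x in lborel. r' x = 0"
  proof eventually_elim
    case (elim x)
    obtain m where m: "norm x < real m" using reals_Archimedean2 by blast
    have "x \<in> Q m" unfolding Q_def mem_box_cart
      using component_le_norm_cart[of x] m by (auto simp: abs_le_iff) (smt (verit))+
    then show ?case using elim[rule_format, of m] by simp
  qed
  then have "AE x in lebesgue. r' x = 0" by (rule AE_completion)
  with eq' show ?thesis by eventually_elim simp
qed


section \<open>Translations\<close>

lemma ip_translation: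
  assumes "smooth f" "smooth g"
  shows "ip lebesgue (\<lambda>x. f (x + z)) (\<lambda>x. g (x + z)) = ip lebesgue f g"
  unfolding ip_def
  using integral_lebesgue_translation[of "\<lambda>x. f x * g x" z] smooth_borel[OF smooth_mult[OF assms]] by simp

lemma nrm_translation:
  assumes "smooth f" shows "nrm lebesgue (\<lambda>x. f (x + z)) = nrm lebesgue f"
  unfolding nrm_def by (simp add: ip_translation assms)

lemma ip_mono_abs:
  assumes "f \<in> L2 M" "g \<in> L2 M" "\<And>x. \<bar>f x\<bar> \<le> \<bar>g x\<bar>"
  shows "ip M f f \<le> ip M g g"
  unfolding ip_def
proof (rule integral_mono)
  show "integrable M (\<lambda>x. f x * f x)" "integrable M (\<lambda>x. g x * g x)" using assms L2_integrable_mult by blast+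
  show "f x * f x \<le> g x * g x" for x
    using assms(3)[of x] by (simp add: abs_le_square_iff flip: power2_eq_square)
qed

lemma nrm_mono_abs:
  assumes "f \<in> L2 M" "g \<in> L2 M" "\<And>x. \<bar>f x\<bar> \<le> \<bar>g x\<bar>"
  shows "nrm M f \<le> nrm M g"
  using ip_mono_abs[OF assms] by (simp add: nrm_def)

lemma test_Lipschitz:
  assumes \<phi>: "\<phi> \<in> test_functions \<Omega>"
  obtains L where "L \<ge> 0" "\<And>x y. \<bar>\<phi> x - \<phi> y\<bar> \<le> L * norm (x - y)"
proof -
  have "\<exists>B>0. \<forall>x. \<bar>partial_deriv j \<phi> x\<bar> \<le> B" for j
    using test_bounded[OF test_partial[OF \<phi>]] by blast
  then obtain B where B: "\<And>j. B j > 0" "\<And>j x. \<bar>partial_deriv j \<phi> x\<bar> \<le> B j" by metis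
  define L where "L = (\<Sum>j\<in>UNIV. B j)"
  have "norm (\<phi> x - \<phi> y) \<le> L * norm (x - y)" for x y
  proof (rule differentiable_bound[of UNIV])
    show "(\<phi> has_derivative (\<lambda>v. \<Sum>j\<in>UNIV. v $ j * partial_deriv j \<phi> x)) (at x within UNIV)" for x
      using has_derivative_partial_deriv[OF smooth_differentiable[OF test_smooth[OF \<phi>]]] by simp
    show "onorm (\<lambda>v. \<Sum>j\<in>UNIV. v $ j * partial_deriv j \<phi> x) \<le> L" for x
    proof (rule onorm_le)
      fix v
      have "norm (\<Sum>j\<in>UNIV. v $ j * partial_deriv j \<phi> x) \<le> (\<Sum>j\<in>UNIV. norm v * B j)"
        by (intro order_trans[OF norm_sum] sum_mono)
           (auto simp: abs_mult intro!: mult_mono component_le_norm_cart B(2))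
      then show "norm (\<Sum>j\<in>UNIV. v $ j * partial_deriv j \<phi> x) \<le> L * norm v"
        by (simp add: L_def sum_distrib_left mult.commute)
    qed
  qed auto
  moreover have "L \<ge> 0" unfolding L_def using B(1) by (intro sum_nonneg) (auto intro: less_imp_le)
  ultimately show ?thesis using that by simp
qed

text \<open>Telescoping into \<open>n\<close> equal steps, all of the same norm by translation
  invariance, reduces a finite translation to an arbitrarily short one.\<close>

lemma translation_norm_le_steps:
  assumes \<phi>: "\<phi> \<in> test_functions UNIV"
  shows "nrm lebesgue (\<lambda>x. \<phi> (x + real n *\<^sub>R w) - \<phi> x) \<le> real n * nrm lebesgue (\<lambda>x. \<phi> (x + w) - \<phi> x)"
proof (induction n)
  case 0 then show ?case by (simp add: nrm_def ip_def)
next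
  case (Suc n)
  note t = test_translation[OF \<phi>]
  have "nrm lebesgue (\<lambda>x. \<phi> (x + real (Suc n) *\<^sub>R w) - \<phi> x)
      \<le> nrm lebesgue (\<lambda>x. \<phi> (x + real (Suc n) *\<^sub>R w) - \<phi> (x + real n *\<^sub>R w)) + nrm lebesgue (\<lambda>x. \<phi> (x + real n *\<^sub>R w) - \<phi> x)"
    by (rule nrm_diff_le) (rule test_L2[OF t] test_L2[OF \<phi>])+
  also have "nrm lebesgue (\<lambda>x. \<phi> (x + real (Suc n) *\<^sub>R w) - \<phi> (x + real n *\<^sub>R w)) = nrm lebesgue (\<lambda>x. \<phi> (x + w) - \<phi> x)"
    using nrm_translation[OF test_smooth[OF test_diff[OF t[of w] \<phi>]], of "real n *\<^sub>R w"]
    by (simp add: algebra_simps)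
  finally show ?case using Suc by (simp add: algebra_simps)
qed

lemma ip_directional_derivative_le:
  assumes \<phi>: "\<phi> \<in> test_functions \<Omega>"
  shows "ip lebesgue (\<lambda>x. \<Sum>j\<in>UNIV. z $ j * partial_deriv j \<phi> x) (\<lambda>x. \<Sum>j\<in>UNIV. z $ j * partial_deriv j \<phi> x)
    \<le> (norm z)\<^sup>2 * H1 \<phi>"
proof -
  have int: "integrable lebesgue (\<lambda>x. partial_deriv j \<phi> x * partial_deriv j \<phi> x)" for j
    by (intro L2_integrable_mult test_L2[OF test_partial[OF \<phi>]])
  have D: "(\<lambda>x. \<Sum>j\<in>UNIV. z $ j * partial_deriv j \<phi> x) \<in> L2 lebesgue"
    by (intro L2_sum L2_cmult test_L2[OF test_partial[OF \<phi>]])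
  have "(\<Sum>j\<in>UNIV. z $ j * a j)\<^sup>2 \<le> (norm z)\<^sup>2 * (\<Sum>j\<in>UNIV. a j * a j)" for a
  proof -
    have "\<bar>z \<bullet> (\<chi> j. a j)\<bar> \<le> norm z * norm (\<chi> j. a j)" by (rule Cauchy_Schwarz_ineq2)
    then have "(z \<bullet> (\<chi> j. a j))\<^sup>2 \<le> (norm z * norm (\<chi> j. a j))\<^sup>2" by (rule power2_le_iff_abs_le[THEN iffD2, rotated]) simp
    then show ?thesis
      by (simp add: power_mult_distrib inner_vec_def power2_norm_eq_inner)
  qed
  then have "ip lebesgue (\<lambda>x. \<Sum>j\<in>UNIV. z $ j * partial_deriv j \<phi> x) (\<lambda>x. \<Sum>j\<in>UNIV. z $ j * partial_deriv j \<phi> x)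
    \<le> (\<integral>x. (norm z)\<^sup>2 * (\<Sum>j\<in>UNIV. partial_deriv j \<phi> x * partial_deriv j \<phi> x) \<partial>lebesgue)"
    unfolding ip_def
    by (intro integral_mono L2_integrable_mult D integrable_mult_right Bochner_Integration.integrable_sum int)
       (simp add: power2_eq_square)
  also have "\<dots> = (norm z)\<^sup>2 * (\<Sum>j\<in>UNIV. ip lebesgue (partial_deriv j \<phi>) (partial_deriv j \<phi>))"
    using int by (simp add: ip_def)
  also have "\<dots> \<le> (norm z)\<^sup>2 * H1 \<phi>"
    by (intro mult_left_mono) (simp_all add: H1_def ip_nonneg)
  finally show ?thesis .
qed

text \<open>After splitting \<open>z\<close> into \<open>Suc n\<close> equal steps, the step
  estimate is the norm of the difference quotient \<open>q n\<close> along \<open>z\<close>. As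
  \<open>n\<close> grows this norm tends to that of the directional derivative.\<close>

lemma translation_norm_le_H1:
  assumes \<phi>: "\<phi> \<in> test_functions UNIV"
  shows "nrm lebesgue (\<lambda>x. \<phi> (x + z) - \<phi> x) \<le> norm z * sqrt (H1 \<phi>)"
proof -
  define D where "D x = (\<Sum>j\<in>UNIV. z $ j * partial_deriv j \<phi> x)" for x
  define t where "t n = 1 / real (Suc n)" for n
  have t: "t n > 0" "t n \<le> 1" for n by (auto simp: t_def)
  define q where "q n x = (\<phi> (x + t n *\<^sub>R z) - \<phi> x) / t n" for n x
  note sm = test_smooth[OF \<phi>]
  obtain L where L: "L \<ge> 0" "\<And>x y. \<bar>\<phi> x - \<phi> y\<bar> \<le> L * norm (x - y)" using test_Lipschitz[OF \<phi>] by blast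
  obtain R where R: "R > 0" "\<And>x. norm x > R \<Longrightarrow> \<phi> x = 0" using test_bounded_support[OF \<phi>] by blast
  define K where "K = cball (0 :: real ^ 'a) (R + norm z)"
  have q_le: "nrm lebesgue (\<lambda>x. \<phi> (x + z) - \<phi> x) \<le> nrm lebesgue (q n)" for n
  proof -
    have "nrm lebesgue (\<lambda>x. \<phi> (x + real (Suc n) *\<^sub>R (t n *\<^sub>R z)) - \<phi> x) \<le> real (Suc n) * nrm lebesgue (\<lambda>x. \<phi> (x + t n *\<^sub>R z) - \<phi> x)"
      by (rule translation_norm_le_steps[OF \<phi>])
    also have "\<dots> = nrm lebesgue (q n)"
      using nrm_cmult[of lebesgue "1 / t n" "\<lambda>x. \<phi> (x + t n *\<^sub>R z) - \<phi> x"] t[of n]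
      by (simp add: q_def[abs_def] t_def mult.commute)
    finally show ?thesis by (simp add: t_def)
  qed
  have qL2: "q n \<in> L2 lebesgue" for n
    using L2_cmult[OF test_L2[OF test_diff[OF test_translation[OF \<phi>] \<phi>]], of "1 / t n" "t n *\<^sub>R z"]
    by (simp add: q_def[abs_def])
  have "D \<in> test_functions UNIV" unfolding D_def[abs_def] by (intro test_sum test_cmult test_partial \<phi>)
  then have DL2: "D \<in> L2 lebesgue" by (rule test_L2)
  have qD: "(\<lambda>n. q n x) \<longlonglongrightarrow> D x" for x
  proof -
    have A: "(\<phi> has_derivative (\<lambda>v. \<Sum>j\<in>UNIV. v $ j * partial_deriv j \<phi> x)) (at (x + 0 *\<^sub>R z))"
      using has_derivative_partial_deriv[OF smooth_differentiable[OF sm], of x] by simp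
    have B: "((\<lambda>s. x + s *\<^sub>R z) has_derivative (\<lambda>s. s *\<^sub>R z)) (at 0)"
      by (auto intro!: derivative_eq_intros)
    have "((\<lambda>s. \<phi> (x + s *\<^sub>R z)) has_derivative (\<lambda>s. \<Sum>j\<in>UNIV. (s *\<^sub>R z) $ j * partial_deriv j \<phi> x)) (at 0)"
      by (rule has_derivative_compose[OF B A])
    moreover have "(\<lambda>s. \<Sum>j\<in>UNIV. (s *\<^sub>R z) $ j * partial_deriv j \<phi> x) = (*) (D x)"
      by (auto simp: D_def sum_distrib_right sum_distrib_left mult_ac)
    ultimately have "((\<lambda>s. \<phi> (x + s *\<^sub>R z)) has_real_derivative D x) (at 0)"
      by (simp add: has_field_derivative_def)
    then have "((\<lambda>h. (\<phi> (x + h *\<^sub>R z) - \<phi> x) / h) \<longlongrightarrow> D x) (at 0)"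
      by (simp add: DERIV_def)
    moreover have "filterlim t (at 0) sequentially"
      unfolding filterlim_at t_def using LIMSEQ_Suc[OF lim_1_over_n] by auto
    ultimately show ?thesis unfolding q_def
      using filterlim_compose[of "\<lambda>h. (\<phi> (x + h *\<^sub>R z) - \<phi> x) / h"] by fastforce
  qed
  have q_bound: "\<bar>q n x\<bar> \<le> (L * norm z) * indicator K x" for n x
  proof (cases "x \<in> K")
    case True
    have "\<bar>\<phi> (x + t n *\<^sub>R z) - \<phi> x\<bar> \<le> L * norm z * t n"
      using L(2)[of "x + t n *\<^sub>R z" x] t[of n] by (simp add: mult_ac)
    then show ?thesis using True t[of n] by (simp add: q_def divide_le_eq)
  next
    case False
    have "norm x - norm (t n *\<^sub>R z) \<le> norm (x + t n *\<^sub>R z)" by (metis norm_diff_ineq)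
    moreover have "norm (t n *\<^sub>R z) \<le> norm z" using t[of n] by (simp add: mult_left_le_one_le)
    ultimately have "norm (x + t n *\<^sub>R z) > R" "norm x > R" using False by (auto simp: K_def) (smt (verit) norm_ge_zero)+
    then show ?thesis using R(2) False by (simp add: q_def)
  qed
  have "(\<lambda>n. \<integral>x. q n x * q n x \<partial>lebesgue) \<longlonglongrightarrow> (\<integral>x. D x * D x \<partial>lebesgue)"
  proof (rule integral_dominated_convergence[where w="\<lambda>x. ((L * norm z) * indicator K x) * ((L * norm z) * indicator K x)"])
    show "(\<lambda>x. D x * D x) \<in> borel_measurable lebesgue" "(\<lambda>x. q n x * q n x) \<in> borel_measurable lebesgue" for n
      by (intro borel_measurable_times L2_measurable DL2 qL2)+
    show "integrable lebesgue (\<lambda>x. ((L * norm z) * indicator K x) * ((L * norm z) * indicator K x))"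
      by (intro L2_integrable_mult L2_cmult indicator_L2) (auto simp: K_def)
    show "AE x in lebesgue. (\<lambda>n. q n x * q n x) \<longlonglongrightarrow> D x * D x"
      by (intro always_eventually allI tendsto_intros qD)
    have "\<bar>q n x\<bar> * \<bar>q n x\<bar> \<le> ((L * norm z) * indicator K x) * ((L * norm z) * indicator K x)" for n x
      using q_bound[of n x] by (intro mult_mono) (auto intro: order_trans[OF abs_ge_zero])
    then show "AE x in lebesgue. norm (q n x * q n x) \<le> ((L * norm z) * indicator K x) * ((L * norm z) * indicator K x)" for n
      by (simp add: abs_mult)
  qed
  then have "(\<lambda>n. nrm lebesgue (q n)) \<longlonglongrightarrow> nrm lebesgue D"
    unfolding nrm_def ip_def by (rule tendsto_real_sqrt)
  then have "nrm lebesgue (\<lambda>x. \<phi> (x + z) - \<phi> x) \<le> nrm lebesgue D"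
    by (rule LIMSEQ_le_const) (use q_le in auto)
  also have "\<dots> \<le> sqrt ((norm z)\<^sup>2 * H1 \<phi>)"
    unfolding nrm_def D_def[abs_def] by (intro real_sqrt_le_mono ip_directional_derivative_le[OF \<phi>])
  also have "\<dots> = norm z * sqrt (H1 \<phi>)" by (simp add: real_sqrt_mult)
  finally show ?thesis .
qed


section \<open>Density of the range of the operator 1 minus Laplacian\<close>

lemma helmholtz_translation: "helmholtz (\<lambda>x. \<phi> (x + z)) = (\<lambda>x. helmholtz \<phi> (x + z))"
  by (rule ext) (simp add: helmholtz_def partial_translation)

text \<open>By \<open>second_difference_MVT\<close>, started at \<open>y - t e\<close>, the second
  difference is \<open>t\<^sup>2\<close> times a value of the second derivative near
  \<open>y\<close>, and that derivative is Lipschitz. For \<open>t \<le> 1\<close> all supports lie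
  in one ball, so the pointwise bound becomes an \<open>L\<^sup>2\<close> bound. The maximum
  principle divides by \<open>t\<^sup>2\<close> and lives on the remaining factor
  \<open>t\<close>.\<close>

lemma second_difference_error:
  assumes \<rho>: "\<rho> \<in> test_functions UNIV"
  shows "\<exists>C. \<forall>t. 0 < t \<longrightarrow> t \<le> 1 \<longrightarrow>
    nrm lebesgue (\<lambda>y. (\<rho> (y + t *\<^sub>R axis j 1) + \<rho> (y + (- t) *\<^sub>R axis j 1) - 2 * \<rho> y)
      - t\<^sup>2 * partial_deriv j (partial_deriv j \<rho>) y) \<le> C * t ^ 3"
proof -
  define e where "e = axis j (1::real)"
  define D where "D = partial_deriv j (partial_deriv j \<rho>)"
  have D: "D \<in> test_functions UNIV" unfolding D_def by (intro test_partial \<rho>)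
  obtain L where L: "L \<ge> 0" "\<And>x y. \<bar>D x - D y\<bar> \<le> L * norm (x - y)" using test_Lipschitz[OF D] by blast
  obtain R1 where R1: "R1 > 0" "\<And>x. norm x > R1 \<Longrightarrow> \<rho> x = 0" using test_bounded_support[OF \<rho>] by blast
  obtain R2 where R2: "R2 > 0" "\<And>x. norm x > R2 \<Longrightarrow> D x = 0" using test_bounded_support[OF D] by blast
  define K where "K = cball (0 :: real ^ 'a) (R1 + R2 + 1)"
  have "nrm lebesgue (\<lambda>y. (\<rho> (y + t *\<^sub>R e) + \<rho> (y + (- t) *\<^sub>R e) - 2 * \<rho> y) - t\<^sup>2 * D y)
     \<le> (L * nrm lebesgue (indicator K)) * t ^ 3" if t: "0 < t" "t \<le> 1" for t
  proof -
    have "\<bar>(\<rho> (y + t *\<^sub>R e) + \<rho> (y + (- t) *\<^sub>R e) - 2 * \<rho> y) - t\<^sup>2 * D y\<bar> \<le> \<bar>(L * t ^ 3) * indicator K y\<bar>" for y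
    proof (cases "y \<in> K")
      case True
      obtain s r where sr: "0 < s" "s < t" "0 < r" "r < t"
        "\<rho> ((y - t *\<^sub>R e) + t *\<^sub>R e + t *\<^sub>R e) - \<rho> ((y - t *\<^sub>R e) + t *\<^sub>R e) - \<rho> ((y - t *\<^sub>R e) + t *\<^sub>R e) + \<rho> (y - t *\<^sub>R e)
          = t * t * D ((y - t *\<^sub>R e) + r *\<^sub>R e + s *\<^sub>R e)"
        using second_difference_MVT[OF test_smooth[OF \<rho>] t(1), of "y - t *\<^sub>R e" j j] unfolding D_def e_def by blast
      define y' where "y' = (y - t *\<^sub>R e) + r *\<^sub>R e + s *\<^sub>R e"
      \<comment> \<open>Since \<open>r\<close> and \<open>s\<close> lie between 0 and
        \<open>t\<close>, the sum \<open>r + s - t\<close> lies between \<open>- t\<close> and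
        \<open>t\<close>.\<close>
      have "y' - y = (r + s - t) *\<^sub>R e" by (simp add: y'_def algebra_simps)
      then have "norm (y' - y) \<le> t" using sr by (simp add: e_def)
      then have "L * norm (y' - y) \<le> L * t" using L(1) by (rule mult_left_mono)
      then have Dd: "\<bar>D y' - D y\<bar> \<le> L * t" using L(2)[of y' y] by linarith
      have "(\<rho> (y + t *\<^sub>R e) + \<rho> (y + (- t) *\<^sub>R e) - 2 * \<rho> y) - t\<^sup>2 * D y = t\<^sup>2 * (D y' - D y)"
        using sr(5) unfolding y'_def[symmetric] by (simp add: power2_eq_square algebra_simps)
      then have "\<bar>(\<rho> (y + t *\<^sub>R e) + \<rho> (y + (- t) *\<^sub>R e) - 2 * \<rho> y) - t\<^sup>2 * D y\<bar> \<le> t\<^sup>2 * (L * t)"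
        using Dd by (simp add: abs_mult mult_left_mono)
      also have "\<dots> = \<bar>(L * t ^ 3) * indicator K y\<bar>"
        using True t L by (simp add: power2_eq_square power3_eq_cube abs_mult)
      finally show ?thesis .
    next
      case False
      have "norm y - norm (t *\<^sub>R e) \<le> norm (y + t *\<^sub>R e)" by (rule norm_diff_ineq)
      moreover have "norm y - norm (t *\<^sub>R e) \<le> norm (y + (- t) *\<^sub>R e)"
        using norm_triangle_ineq2[of y "t *\<^sub>R e"] by simp
      moreover have "norm (t *\<^sub>R e) \<le> 1" using t by (simp add: e_def)
      moreover have "norm y > R1 + R2 + 1" using False by (simp add: K_def)
      ultimately have "norm (y + t *\<^sub>R e) > R1" "norm (y + (- t) *\<^sub>R e) > R1" "norm y > R1" "norm y > R2"
        using R1(1) R2(1) by linarith+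
      then have "\<rho> (y + t *\<^sub>R e) = 0" "\<rho> (y + (- t) *\<^sub>R e) = 0" "\<rho> y = 0" "D y = 0" using R1(2) R2(2) by blast+
      then show ?thesis by simp
    qed
    then have "nrm lebesgue (\<lambda>y. (\<rho> (y + t *\<^sub>R e) + \<rho> (y + (- t) *\<^sub>R e) - 2 * \<rho> y) - t\<^sup>2 * D y)
      \<le> nrm lebesgue (\<lambda>y. (L * t ^ 3) * indicator K y)"
      by (intro nrm_mono_abs L2_diff L2_add L2_cmult test_L2[OF test_translation[OF \<rho>]] test_L2[OF \<rho>] test_L2[OF D] indicator_L2)
         (auto simp: K_def)
    also have "\<dots> = (L * nrm lebesgue (indicator K)) * t ^ 3"
      using t L by (simp add: nrm_cmult)
    finally show ?thesis .
  qed
  then show ?thesis unfolding D_def e_def by blast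
qed

text \<open>Maximum principle: \<open>F x = \<langle>r, \<rho>(\<cdot> + x)\<rangle>\<close> is bounded and satisfies \<open>F = \<Delta> F\<close> in the
  sense of second difference quotients.\<close>

lemma orthogonal_to_helmholtz_nonpos:
  fixes r :: "real ^ 'd \<Rightarrow> real"
  assumes r: "r \<in> L2 lebesgue" and orth: "\<And>\<psi>. \<psi> \<in> test_functions UNIV \<Longrightarrow> ip lebesgue r (helmholtz \<psi>) = 0"
    and \<rho>: "\<rho> \<in> test_functions UNIV"
  shows "ip lebesgue r \<rho> \<le> 0"
proof -
  define F where "F x = ip lebesgue r (\<lambda>y. \<rho> (y + x))" for x
  define D where "D j = partial_deriv j (partial_deriv j \<rho>)" for j
  have D: "D j \<in> test_functions UNIV" for j unfolding D_def by (intro test_partial \<rho>)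
  note t\<rho> = test_L2[OF test_translation[OF \<rho>]] and tD = test_L2[OF test_translation[OF D]]
  have "\<forall>j. \<exists>C. \<forall>t. 0 < t \<longrightarrow> t \<le> 1 \<longrightarrow>
      nrm lebesgue (\<lambda>y. (\<rho> (y + t *\<^sub>R axis j 1) + \<rho> (y + (- t) *\<^sub>R axis j 1) - 2 * \<rho> y) - t\<^sup>2 * D j y) \<le> C * t ^ 3"
    unfolding D_def by (intro allI second_difference_error[OF \<rho>])
  then obtain C where C: "\<forall>j t. 0 < t \<longrightarrow> t \<le> 1 \<longrightarrow>
      nrm lebesgue (\<lambda>y. (\<rho> (y + t *\<^sub>R axis j 1) + \<rho> (y + (- t) *\<^sub>R axis j 1) - 2 * \<rho> y) - t\<^sup>2 * D j y) \<le> C j * t ^ 3"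
    by (rule choice[THEN exE])
  define B where "B = nrm lebesgue r * nrm lebesgue \<rho>"
  have F_bound: "\<bar>F x\<bar> \<le> B" for x
    using L2_Cauchy_Schwarz[OF r t\<rho>, of x] by (simp add: F_def B_def nrm_translation test_smooth[OF \<rho>])
  have F_diff: "\<bar>F x' - F x\<bar> \<le> nrm lebesgue r * sqrt (H1 \<rho>) * norm (x' - x)" for x x'
  proof -
    have "F x' - F x = ip lebesgue r (\<lambda>y. \<rho> (y + x') - \<rho> (y + x))"
      unfolding F_def by (rule ip_diff_right[symmetric]) (rule t\<rho> r)+
    also have "\<bar>\<dots>\<bar> \<le> nrm lebesgue r * nrm lebesgue (\<lambda>y. \<rho> (y + x') - \<rho> (y + x))"
      by (intro L2_Cauchy_Schwarz r L2_diff t\<rho>)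
    also have "nrm lebesgue (\<lambda>y. \<rho> (y + x') - \<rho> (y + x)) = nrm lebesgue (\<lambda>y. \<rho> (y + (x' - x)) - \<rho> y)"
      using nrm_translation[OF test_smooth[OF test_diff[OF test_translation[OF \<rho>, of "x' - x"] \<rho>]], of x]
      by (simp add: algebra_simps)
    also have "nrm lebesgue r * \<dots> \<le> nrm lebesgue r * (norm (x' - x) * sqrt (H1 \<rho>))"
      by (intro mult_left_mono translation_norm_le_H1[OF \<rho>] nrm_nonneg)
    finally show ?thesis by (simp add: mult_ac)
  qed
  have F_cont: "continuous_on UNIV F"
  proof -
    have "(F \<longlongrightarrow> F x) (at x)" for x
    proof (rule LIM_zero_cancel, rule tendsto_rabs_zero_cancel, rule tendsto_sandwich[OF _ _ tendsto_const])
      have "((\<lambda>x'. nrm lebesgue r * sqrt (H1 \<rho>) * norm (x' - x)) \<longlongrightarrow> nrm lebesgue r * sqrt (H1 \<rho>) * norm (x - x)) (at x)"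
        by (intro tendsto_intros)
      then show "((\<lambda>x'. nrm lebesgue r * sqrt (H1 \<rho>) * norm (x' - x)) \<longlongrightarrow> 0) (at x)" by simp
      show "\<forall>\<^sub>F x' in at x. \<bar>F x' - F x\<bar> \<le> nrm lebesgue r * sqrt (H1 \<rho>) * norm (x' - x)"
        using F_diff by simp
    qed auto
    then show ?thesis by (simp add: continuous_on_def)
  qed
  have F_eq: "F x = (\<Sum>j\<in>UNIV. ip lebesgue r (\<lambda>y. D j (y + x)))" for x
  proof -
    have "0 = ip lebesgue r (\<lambda>y. \<rho> (y + x) - (\<Sum>j\<in>UNIV. D j (y + x)))"
      using orth[OF test_translation[OF \<rho>], of x] unfolding helmholtz_translation by (simp add: helmholtz_def D_def)
    also have "\<dots> = F x - ip lebesgue r (\<lambda>y. \<Sum>j\<in>UNIV. D j (y + x))"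
      unfolding F_def by (rule ip_diff_right) (rule t\<rho> r L2_sum tD)+
    also have "ip lebesgue r (\<lambda>y. \<Sum>j\<in>UNIV. D j (y + x)) = (\<Sum>j\<in>UNIV. ip lebesgue r (\<lambda>y. D j (y + x)))"
      unfolding ip_commute[of lebesgue r] by (rule ip_sum_left) (rule tD r)+
    finally show ?thesis by simp
  qed
  \<comment> \<open>In each direction the 2 comes from the quadratic penalty below, the other term
    from the discretisation error.\<close>
  define C' where "C' = (\<Sum>j\<in>UNIV. 2 + nrm lebesgue r * C j)"
  have main: "F 0 \<le> C' * \<eta>" if \<eta>: "0 < \<eta>" "\<eta> \<le> 1" for \<eta>
  proof -
    \<comment> \<open>\<open>F\<close> is bounded but need not attain its supremum; the penalty
      forces a maximum. Its coefficient \<eta> is also the step of the second differences, so all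
      errors have order \<open>\<eta> ^ 3\<close>, and division by \<open>\<eta>\<^sup>2\<close>
      leaves a multiple of \<eta>.\<close>
    define G where "G x = F x - \<eta> * (norm x)\<^sup>2" for x
    \<comment> \<open>Beyond this radius the penalty is at least \<open>2 * B\<close>, which bounds
      the oscillation of \<open>F\<close>; the 1 keeps \<open>R\<close> positive when
      \<open>B = 0\<close>.\<close>
    define R where "R = sqrt (2 * B / \<eta>) + 1"
    have "B \<ge> 0" using F_bound[of 0] by linarith
    have "R > 0" unfolding R_def using \<open>B \<ge> 0\<close> \<eta> by (simp add: add_nonneg_pos)
    have "continuous_on (cball 0 R) G" unfolding G_def
      by (intro continuous_intros continuous_on_subset[OF F_cont]) auto
    then obtain x0 where x0: "x0 \<in> cball 0 R" "\<And>x. x \<in> cball 0 R \<Longrightarrow> G x \<le> G x0"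
      using continuous_attains_sup[of "cball 0 R" G] \<open>R > 0\<close> by fastforce
    have G_max: "G x \<le> G x0" for x
    proof (cases "x \<in> cball 0 R")
      case False
      then have "norm x > sqrt (2 * B / \<eta>)" by (simp add: R_def)
      then have "(sqrt (2 * B / \<eta>))\<^sup>2 \<le> (norm x)\<^sup>2" using \<open>B \<ge> 0\<close> \<eta> by (intro power_mono) auto
      then have "2 * B / \<eta> \<le> (norm x)\<^sup>2" using \<open>B \<ge> 0\<close> \<eta> by simp
      then have "2 * B \<le> \<eta> * (norm x)\<^sup>2" using \<eta> by (simp add: field_simps)
      moreover have "G 0 \<le> G x0" using x0(2)[of 0] \<open>R > 0\<close> by simp
      ultimately show ?thesis using F_bound[of x] F_bound[of 0] by (simp add: G_def)
    qed (use x0 in blast)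
    have "ip lebesgue r (\<lambda>y. D j (y + x0)) \<le> (2 + nrm lebesgue r * C j) * \<eta>" for j
    proof -
      define e where "e = axis j (1::real)"
      define q where "q y = (\<rho> (y + \<eta> *\<^sub>R e) + \<rho> (y + (- \<eta>) *\<^sub>R e) - 2 * \<rho> y) - \<eta>\<^sup>2 * D j y" for y
      have q: "q \<in> test_functions UNIV" unfolding q_def[abs_def]
        by (rule test_diff test_add test_cmult test_translation \<rho> D)+
      \<comment> \<open>Parallelogram law: in a unit direction the second difference of the penalty
        is exactly \<open>2 * \<eta> ^ 3\<close>.\<close>
      have "norm (x0 + \<eta> *\<^sub>R e) ^ 2 + norm (x0 + (- \<eta>) *\<^sub>R e) ^ 2 = 2 * (norm x0)\<^sup>2 + 2 * \<eta>\<^sup>2"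
        unfolding power2_norm_eq_inner by (simp add: inner_add_left inner_add_right inner_diff_left inner_diff_right inner_commute e_def inner_axis_axis power2_eq_square)
      then have "\<eta> * norm (x0 + \<eta> *\<^sub>R e) ^ 2 + \<eta> * norm (x0 + (- \<eta>) *\<^sub>R e) ^ 2 = 2 * (\<eta> * (norm x0)\<^sup>2) + 2 * \<eta> ^ 3"
        unfolding distrib_left[symmetric] by (simp add: power3_eq_cube power2_eq_square algebra_simps)
      then have Fd: "F (x0 + \<eta> *\<^sub>R e) + F (x0 + (- \<eta>) *\<^sub>R e) - 2 * F x0 \<le> 2 * \<eta> ^ 3"
        using G_max[of "x0 + \<eta> *\<^sub>R e"] G_max[of "x0 + (- \<eta>) *\<^sub>R e"] unfolding G_def by linarith
      have "ip lebesgue r (\<lambda>y. q (y + x0)) = ip lebesgue r (\<lambda>y. (\<rho> (y + (x0 + \<eta> *\<^sub>R e)) + \<rho> (y + (x0 + (- \<eta>) *\<^sub>R e)) - 2 * \<rho> (y + x0)) - \<eta>\<^sup>2 * D j (y + x0))"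
        by (simp add: q_def add.assoc add_diff_eq)
      also have "\<dots> = F (x0 + \<eta> *\<^sub>R e) + F (x0 + (- \<eta>) *\<^sub>R e) - 2 * F x0 - \<eta>\<^sup>2 * ip lebesgue r (\<lambda>y. D j (y + x0))"
        unfolding F_def
        by (subst ip_diff_right, (rule t\<rho> tD r L2_add L2_diff L2_cmult)+, subst ip_diff_right, (rule t\<rho> tD r L2_add L2_diff L2_cmult)+,
            subst ip_add_right, (rule t\<rho> tD r)+) (simp add: ip_cmult_right)
      finally have "\<eta>\<^sup>2 * ip lebesgue r (\<lambda>y. D j (y + x0)) \<le> 2 * \<eta> ^ 3 + \<bar>ip lebesgue r (\<lambda>y. q (y + x0))\<bar>"
        using Fd by linarith
      also have "\<bar>ip lebesgue r (\<lambda>y. q (y + x0))\<bar> \<le> nrm lebesgue r * nrm lebesgue q"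
        using L2_Cauchy_Schwarz[OF r test_L2[OF test_translation[OF q]], of x0] by (simp add: nrm_translation test_smooth[OF q])
      also have "\<dots> \<le> nrm lebesgue r * (C j * \<eta> ^ 3)"
        using C[rule_format, OF \<eta>, of j] unfolding q_def[abs_def] e_def by (intro mult_left_mono nrm_nonneg)
      finally have "\<eta>\<^sup>2 * ip lebesgue r (\<lambda>y. D j (y + x0)) \<le> \<eta>\<^sup>2 * ((2 + nrm lebesgue r * C j) * \<eta>)"
        by (simp add: power2_eq_square power3_eq_cube algebra_simps)
      then show ?thesis using \<eta> by simp
    qed
    then have "F x0 \<le> (\<Sum>j\<in>UNIV. (2 + nrm lebesgue r * C j) * \<eta>)"
      unfolding F_eq by (rule sum_mono)
    also have "\<dots> = C' * \<eta>" by (simp add: C'_def sum_distrib_right)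
    finally have "G x0 \<le> C' * \<eta>" using \<eta> by (simp add: G_def) (smt (verit) mult_nonneg_nonneg zero_le_power2)
    then show ?thesis using G_max[of 0] by (simp add: G_def)
  qed
  have "(\<lambda>n. C' * (1 / real (Suc n))) \<longlonglongrightarrow> C' * 0" by (intro tendsto_intros LIMSEQ_Suc[OF lim_1_over_n])
  then have "F 0 \<le> C' * 0"
    by (rule LIMSEQ_le_const) (intro exI[of _ 0] allI impI main, simp_all)
  then show ?thesis by (simp add: F_def)
qed

text \<open>The one-sided estimate is applied to \<rho> and to its negative.\<close>

lemma orthogonal_to_helmholtz_imp_AE_0:
  fixes r :: "real ^ 'd \<Rightarrow> real"
  assumes r: "r \<in> L2 lebesgue" and orth: "\<And>\<psi>. \<psi> \<in> test_functions UNIV \<Longrightarrow> ip lebesgue r (helmholtz \<psi>) = 0"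
  shows "AE x in lebesgue. r x = 0"
proof (rule orthogonal_to_tests_imp_AE_0[OF r])
  fix \<rho> :: "real ^ 'd \<Rightarrow> real" assume \<rho>: "\<rho> \<in> test_functions UNIV"
  have "ip lebesgue r \<rho> \<le> 0" using orthogonal_to_helmholtz_nonpos[OF r orth \<rho>] .
  moreover have "ip lebesgue r (\<lambda>x. (- 1) * \<rho> x) \<le> 0"
    by (rule orthogonal_to_helmholtz_nonpos[OF r orth test_cmult[OF \<rho>]])
  then have "ip lebesgue r \<rho> \<ge> 0" unfolding ip_cmult_right by simp
  ultimately show "ip lebesgue r \<rho> = 0" by simp
qed

text \<open>The projection \<open>f\<close> of \<open>u\<close> onto the closed range of
  \<open>helmholtz\<close> leaves a remainder orthogonal to that range, hence zero almost
  everywhere. The sequence approximating \<open>f\<close> already lies in the range and therefore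
  approximates \<open>u\<close>.\<close>

lemma helmholtz_dense:
  fixes u :: "real ^ 'd \<Rightarrow> real"
  assumes u: "u \<in> L2 lebesgue" and e: "e > 0"
  obtains \<psi> where "\<psi> \<in> test_functions UNIV" "nrm lebesgue (\<lambda>x. u x - helmholtz \<psi> x) < e"
proof -
  define S where "S = helmholtz ` (test_functions UNIV :: (real ^ 'd \<Rightarrow> real) set)"
  have SL: "S \<subseteq> L2 lebesgue" unfolding S_def using test_L2[OF test_helmholtz] by blast
  have helmholtz_add: "helmholtz (\<lambda>x. \<phi> x + \<psi> x) = (\<lambda>x. helmholtz \<phi> x + helmholtz \<psi> x)" if "smooth \<phi>" "smooth \<psi>" for \<phi> \<psi> :: "real ^ 'd \<Rightarrow> real"
    by (rule ext) (simp add: helmholtz_def partial_add smooth_partial that sum.distrib)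
  have helmholtz_cmult: "helmholtz (\<lambda>x. c * \<phi> x) = (\<lambda>x. c * helmholtz \<phi> x)" if "smooth \<phi>" for c and \<phi> :: "real ^ 'd \<Rightarrow> real"
    by (rule ext) (simp add: helmholtz_def partial_cmult smooth_partial that sum_distrib_left right_diff_distrib)
  have "\<exists>f \<sigma>. f \<in> L2 lebesgue \<and> (\<forall>n. \<sigma> n \<in> S) \<and> (\<lambda>n. nrm lebesgue (\<lambda>x. \<sigma> n x - f x)) \<longlonglongrightarrow> 0
    \<and> (\<forall>s\<in>S. ip lebesgue f s = ip lebesgue u s)"
  proof (rule L2_Riesz_subspace[OF SL])
    show "(\<lambda>x. 0) \<in> S" unfolding S_def
      using helmholtz_cmult[OF smooth_const, of 0 0] by (intro image_eqI[OF _ test_zero]) simp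
    show "(\<lambda>x. s x + t x) \<in> S" if "s \<in> S" "t \<in> S" for s t
      using that unfolding S_def by (auto simp: helmholtz_add[symmetric] test_smooth intro!: imageI test_add)
    show "(\<lambda>x. c * s x) \<in> S" if "s \<in> S" for c s
      using that unfolding S_def by (auto simp: helmholtz_cmult[symmetric] test_smooth intro!: imageI test_cmult)
    show "ip lebesgue u (\<lambda>x. s x + t x) = ip lebesgue u s + ip lebesgue u t" if "s \<in> S" "t \<in> S" for s t
      using that SL u by (intro ip_add_right) auto
    show "ip lebesgue u (\<lambda>x. c * s x) = c * ip lebesgue u s" for c s by (rule ip_cmult_right)
    show "\<bar>ip lebesgue u s\<bar> \<le> nrm lebesgue u * nrm lebesgue s" if "s \<in> S" for s
      using that SL u by (intro L2_Cauchy_Schwarz) auto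
  qed
  then obtain f \<sigma> where f: "f \<in> L2 lebesgue" "\<And>n. \<sigma> n \<in> S" "(\<lambda>n. nrm lebesgue (\<lambda>x. \<sigma> n x - f x)) \<longlonglongrightarrow> 0"
    "\<And>s. s \<in> S \<Longrightarrow> ip lebesgue f s = ip lebesgue u s" by blast
  have "AE x in lebesgue. u x - f x = 0"
  proof (rule orthogonal_to_helmholtz_imp_AE_0[OF L2_diff[OF u f(1)]])
    fix \<psi> :: "real ^ 'd \<Rightarrow> real" assume "\<psi> \<in> test_functions UNIV"
    then have "helmholtz \<psi> \<in> S" by (simp add: S_def)
    then show "ip lebesgue (\<lambda>x. u x - f x) (helmholtz \<psi>) = 0"
      using f(4) SL ip_diff_left[OF u f(1)] by auto
  qed
  then have eq: "nrm lebesgue (\<lambda>x. u x - \<sigma> n x) = nrm lebesgue (\<lambda>x. \<sigma> n x - f x)" for n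
    unfolding nrm_def ip_def using L2_measurable[OF L2_diff[OF u]] L2_measurable[OF L2_diff[OF _ f(1)]] f(2) SL
    by (intro arg_cong[where f=sqrt] integral_cong_AE borel_measurable_times) (auto simp: algebra_simps)
  have "\<forall>\<^sub>F n in sequentially. nrm lebesgue (\<lambda>x. \<sigma> n x - f x) < e"
    using order_tendstoD(2)[OF f(3) e] .
  then obtain n where "nrm lebesgue (\<lambda>x. u x - \<sigma> n x) < e"
    using eventually_happens'[OF sequentially_bot] unfolding eq by blast
  moreover obtain \<psi> where "\<psi> \<in> test_functions UNIV" "\<sigma> n = helmholtz \<psi>" using f(2)[of n] by (auto simp: S_def)
  ultimately show ?thesis using that by metis
qed


section \<open>Rellich's theorem\<close>

lemma L2_abs: "f \<in> L2 M \<Longrightarrow> (\<lambda>x. \<bar>f x\<bar>) \<in> L2 M"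
  by (simp add: L2_def borel_measurable_abs)

text \<open>Translation and Fubini are applied to Borel functions, while the given sequence is only
  Lebesgue measurable. The cutoff by the ball restores the pointwise vanishing outside, which an
  almost everywhere equality would lose.\<close>

lemma L2_AE_borel:
  fixes v :: "'a::euclidean_space \<Rightarrow> real"
  assumes v: "v \<in> L2 lebesgue" and R: "\<And>x. norm x > R \<Longrightarrow> v x = 0"
  obtains v' where "v' \<in> borel_measurable borel" "v' \<in> L2 lebesgue" "AE x in lebesgue. v x = v' x"
    "\<And>x. norm x > R \<Longrightarrow> v' x = 0"
proof -
  obtain w where w: "w \<in> borel_measurable lborel" and eq: "AE x in lborel. v x = w x"
    using completion_ex_borel_measurable_real[OF L2_measurable[OF v]] by blast
  define v' where "v' x = indicator (cball 0 R) x * w x" for x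
  have wb: "w \<in> borel_measurable borel" using w by simp
  have v'b: "v' \<in> borel_measurable borel" unfolding v'_def
    by (intro borel_measurable_times borel_measurable_indicator wb) auto
  then have v'l: "v' \<in> borel_measurable lebesgue" by (intro measurable_completion) simp
  have "AE x in lebesgue. v x = w x" using eq by (rule AE_completion)
  then have AE: "AE x in lebesgue. v x = v' x"
    by eventually_elim (use R in \<open>auto simp: v'_def indicator_def\<close>)
  have "integrable lebesgue (\<lambda>x. (v x)\<^sup>2) \<longleftrightarrow> integrable lebesgue (\<lambda>x. (v' x)\<^sup>2)"
    using AE L2_measurable[OF v] v'l by (intro integrable_cong_AE borel_measurable_power) auto
  then have "v' \<in> L2 lebesgue" using v v'l by (simp add: L2_def)
  moreover have "v' x = 0" if "norm x > R" for x using that by (simp add: v'_def)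
  ultimately show ?thesis using that[OF v'b _ AE] by blast
qed

lemma integral_lebesgue_lborel:
  fixes f :: "'a::euclidean_space \<Rightarrow> real"
  assumes "f \<in> borel_measurable borel"
  shows "integral\<^sup>L lebesgue f = integral\<^sup>L lborel f" "integrable lebesgue f \<longleftrightarrow> integrable lborel f"
  using assms by (simp_all add: integral_completion integrable_completion)

lemma integrable_lborel_translation:
  fixes f :: "'a::euclidean_space \<Rightarrow> real"
  assumes "f \<in> borel_measurable borel" "integrable lborel f"
  shows "integrable lborel (\<lambda>x. f (x + z))"
proof -
  have "integrable (distr lborel borel ((+) z)) f" using assms by (simp add: lborel_distr_plus)
  then show ?thesis using assms by (subst (asm) integrable_distr_eq) (auto simp: add.commute)
qed

text \<open>Averaging over translations by \<open>z \<in> ball 0 \<delta>\<close> moves the smoothing from \<open>X\<close> to \<open>V\<close>.\<close>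

lemma averaged_pairing:
  fixes X V :: "real ^ 'd \<Rightarrow> real"
  assumes X: "X \<in> test_functions UNIV" "H1 X \<le> B"
    and V: "V \<in> borel_measurable borel" "V \<in> L2 lebesgue" "nrm lebesgue V \<le> C"
    and \<delta>: "\<delta> > 0"
  defines "G \<equiv> \<lambda>y. ip lebesgue V (indicator (ball y \<delta>))"
  defines "m \<equiv> measure lebesgue (ball (0 :: real ^ 'd) \<delta>)"
  shows "\<bar>m * ip lebesgue X V - ip lebesgue X G\<bar> \<le> m * (\<delta> * sqrt B * C)" "G \<in> borel_measurable borel"
proof -
  define b where "b = ball (0 :: real ^ 'd) \<delta>"
  have [measurable]: "b \<in> sets borel" by (simp add: b_def)
  note [measurable] = V(1) smooth_borel[OF test_smooth[OF X(1)]]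
  have "C \<ge> 0" "B \<ge> 0" using nrm_nonneg[of lebesgue V] V(3) H1_nonneg[of X] X(2) by linarith+
  have bfin: "emeasure lborel b < \<infinity>" unfolding b_def by (intro emeasure_bounded_finite) auto
  have int_b: "integrable lborel (indicator b :: real ^ 'd \<Rightarrow> real)"
    using bfin by (intro integrable_real_indicator) auto
  have mb: "measure lborel b = m" by (simp add: m_def b_def)
  \<comment> \<open>Integrated first in \<open>z\<close> this gives \<open>X\<close> against the
    averages \<open>G\<close>, integrated first in \<open>y\<close> the pairings of \<open>V\<close>
    with translates of \<open>X\<close>. Fubini equates the two, and \<open>shift\<close> compares
    each translate with \<open>X\<close> itself.\<close>
  define f where "f z y = indicator b z * (X y * V (y + z))" for z y
  have VL: "integrable lborel (\<lambda>y. (V y)\<^sup>2)"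
    using V(2) by (simp add: L2_def integral_lebesgue_lborel)
  have VzL: "(\<lambda>y. V (y + z)) \<in> L2 lebesgue" for z
  proof -
    have m1: "(\<lambda>y. V (y + z)) \<in> borel_measurable borel" by measurable
    have "integrable lborel (\<lambda>y. (V (y + z))\<^sup>2)"
      using integrable_lborel_translation[OF _ VL, of z] by simp
    then have "integrable lebesgue (\<lambda>y. (V (y + z))\<^sup>2)" by (subst integral_lebesgue_lborel(2)) measurable
    moreover have "(\<lambda>y. V (y + z)) \<in> borel_measurable lebesgue"
      using m1 by (intro measurable_completion) simp
    ultimately show ?thesis by (simp add: L2_def)
  qed
  have Vz_nrm: "nrm lebesgue (\<lambda>y. V (y + z)) = nrm lebesgue V" for z
    unfolding nrm_def ip_def using integral_lebesgue_translation[of "\<lambda>y. V y * V y" z] by simp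
  note XL = test_L2[OF X(1)]
  have XVint: "integrable lborel (\<lambda>y. X y * V (y + z))" for z
  proof -
    have "integrable lebesgue (\<lambda>y. X y * V (y + z))" by (rule L2_integrable_mult[OF XL VzL])
    then show ?thesis by (subst (asm) integral_lebesgue_lborel(2)) measurable
  qed
  have inner: "(\<integral>y. X y * V (y + z) \<partial>lborel) = ip lebesgue (\<lambda>y. X (y + (- z))) V" for z
  proof -
    have "ip lebesgue (\<lambda>y. X (y + (- z))) V = (\<integral>y. X (y + (- z)) * V y \<partial>lebesgue)" by (simp add: ip_def)
    also have "\<dots> = (\<integral>y. X (y + z + (- z)) * V (y + z) \<partial>lebesgue)"
      using integral_lebesgue_translation[of "\<lambda>y. X (y + (- z)) * V y" z] by simp
    also have "\<dots> = (\<integral>y. X y * V (y + z) \<partial>lebesgue)" by simp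
    also have "\<dots> = (\<integral>y. X y * V (y + z) \<partial>lborel)" by (rule integral_lebesgue_lborel(1)) measurable
    finally show ?thesis by simp
  qed
  have shift: "\<bar>ip lebesgue (\<lambda>y. X (y + (- z))) V - ip lebesgue X V\<bar> \<le> \<delta> * sqrt B * C" if "z \<in> b" for z
  proof -
    have "ip lebesgue (\<lambda>y. X (y + (- z))) V - ip lebesgue X V = ip lebesgue (\<lambda>y. X (y + (- z)) - X y) V"
      by (rule ip_diff_left[symmetric]) (rule test_L2[OF test_translation[OF X(1)]] XL V(2))+
    also have "\<bar>\<dots>\<bar> \<le> nrm lebesgue (\<lambda>y. X (y + (- z)) - X y) * nrm lebesgue V"
      by (intro L2_Cauchy_Schwarz L2_diff V(2) XL) (rule test_L2[OF test_translation[OF X(1)]])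
    also have "\<dots> \<le> (\<delta> * sqrt B) * C"
    proof (rule mult_mono[OF _ V(3)])
      have "nrm lebesgue (\<lambda>y. X (y + (- z)) - X y) \<le> norm (- z) * sqrt (H1 X)" by (rule translation_norm_le_H1[OF X(1)])
      also have "\<dots> \<le> \<delta> * sqrt B" using that X(2) \<delta> H1_nonneg[of X] by (intro mult_mono) (auto simp: b_def)
      finally show "nrm lebesgue (\<lambda>y. X (y + (- z)) - X y) \<le> \<delta> * sqrt B" .
    qed (use \<delta> \<open>B \<ge> 0\<close> nrm_nonneg in auto)
    finally show ?thesis .
  qed
  have fm [measurable]: "case_prod f \<in> borel_measurable (lborel \<Otimes>\<^sub>M lborel)"
    unfolding f_def[abs_def] by measurable
  have fint: "integrable (lborel \<Otimes>\<^sub>M lborel) (case_prod f)"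
  proof (rule lborel_pair.Fubini_integrable[OF fm])
    show "AE z in lborel. integrable lborel (\<lambda>y. case_prod f (z, y))"
      using XVint by (auto simp: f_def)
    show "integrable lborel (\<lambda>z. \<integral>y. norm (case_prod f (z, y)) \<partial>lborel)"
    proof (rule Bochner_Integration.integrable_bound)
      show "integrable lborel (\<lambda>z. (nrm lebesgue X * C) * indicator b z)" using int_b by simp
      show "(\<lambda>z. \<integral>y. norm (case_prod f (z, y)) \<partial>lborel) \<in> borel_measurable lborel" by measurable
      have "(\<integral>y. norm (case_prod f (z, y)) \<partial>lborel) \<le> (nrm lebesgue X * C) * indicator b z" for z
      proof -
        have "(\<integral>y. \<bar>X y\<bar> * \<bar>V (y + z)\<bar> \<partial>lborel) = ip lebesgue (\<lambda>y. \<bar>X y\<bar>) (\<lambda>y. \<bar>V (y + z)\<bar>)"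
          unfolding ip_def by (rule integral_lebesgue_lborel(1)[symmetric]) measurable
        also have "\<dots> \<le> nrm lebesgue (\<lambda>y. \<bar>X y\<bar>) * nrm lebesgue (\<lambda>y. \<bar>V (y + z)\<bar>)"
          using L2_Cauchy_Schwarz[OF L2_abs[OF XL] L2_abs[OF VzL], of z] by linarith
        also have "\<dots> = nrm lebesgue X * nrm lebesgue V"
          using Vz_nrm[of z] by (simp add: nrm_def ip_def)
        also have "\<dots> \<le> nrm lebesgue X * C" using V(3) by (intro mult_left_mono nrm_nonneg)
        finally show ?thesis by (simp add: f_def abs_mult indicator_def)
      qed
      then show "AE z in lborel. norm (\<integral>y. norm (case_prod f (z, y)) \<partial>lborel) \<le> norm ((nrm lebesgue X * C) * indicator b z)"
        by (intro always_eventually allI) (simp add: order_trans[OF _ abs_ge_self])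
    qed
  qed
  have Geq: "G y = (\<integral>z. indicator b z * V (y + z) \<partial>lborel)" for y
  proof -
    have "G y = (\<integral>x. V x * indicator (ball y \<delta>) x \<partial>lebesgue)" by (simp add: G_def ip_def)
    also have "\<dots> = (\<integral>z. V (z + y) * indicator (ball y \<delta>) (z + y) \<partial>lebesgue)"
      by (rule integral_lebesgue_translation[symmetric], intro borel_measurable_times V(1) borel_measurable_indicator) auto
    also have "\<dots> = (\<integral>z. indicator b z * V (y + z) \<partial>lebesgue)"
      by (intro Bochner_Integration.integral_cong) (auto simp: indicator_def b_def dist_norm add.commute)
    also have "\<dots> = (\<integral>z. indicator b z * V (y + z) \<partial>lborel)" by (rule integral_lebesgue_lborel(1)) measurable
    finally show ?thesis .
  qed
  show Gm: "G \<in> borel_measurable borel"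
  proof -
    have "(\<lambda>y. \<integral>z. indicator b z * V (y + z) \<partial>lborel) \<in> borel_measurable borel" by measurable
    then show ?thesis using Geq by (simp add: fun_eq_iff[symmetric] cong: measurable_cong)
  qed
  have "ip lebesgue X G = (\<integral>y. X y * G y \<partial>lborel)"
    unfolding ip_def using Gm by (intro integral_lebesgue_lborel(1)) measurable
  also have "\<dots> = (\<integral>y. (\<integral>z. f z y \<partial>lborel) \<partial>lborel)"
    unfolding Geq f_def by (simp add: mult.left_commute)
  also have "\<dots> = (\<integral>z. (\<integral>y. f z y \<partial>lborel) \<partial>lborel)"
    by (rule lborel_pair.Fubini_integral[OF fint])
  also have "\<dots> = (\<integral>z. indicator b z * ip lebesgue (\<lambda>y. X (y + (- z))) V \<partial>lborel)"
    unfolding f_def by (simp add: inner del: add_uminus_conv_diff)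
  finally have XG: "ip lebesgue X G = (\<integral>z. indicator b z * ip lebesgue (\<lambda>y. X (y + (- z))) V \<partial>lborel)" .
  have int1: "integrable lborel (\<lambda>z. indicator b z * ip lebesgue (\<lambda>y. X (y + (- z))) V)"
  proof -
    have "integrable lborel (\<lambda>z. \<integral>y. f z y \<partial>lborel)" using lborel_pair.integrable_fst[OF fint] by simp
    then show ?thesis unfolding f_def by (simp add: inner del: add_uminus_conv_diff)
  qed
  have int2: "integrable lborel (\<lambda>z. indicator b z * ip lebesgue X V)" using int_b by simp
  have "m * ip lebesgue X V - ip lebesgue X G
      = (\<integral>z. indicator b z * ip lebesgue X V - indicator b z * ip lebesgue (\<lambda>y. X (y + (- z))) V \<partial>lborel)"
    using int1 int2 by (simp add: XG mb)
  also have "norm \<dots> \<le> (\<integral>z. indicator b z * (\<delta> * sqrt B * C) \<partial>lborel)"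
  proof (rule order_trans[OF integral_norm_bound integral_mono])
    show "integrable lborel (\<lambda>z. norm (indicator b z * ip lebesgue X V - indicator b z * ip lebesgue (\<lambda>y. X (y + (- z))) V))"
      using int1 int2 by simp
    show "integrable lborel (\<lambda>z. indicator b z * (\<delta> * sqrt B * C))" using int_b by simp
    show "norm (indicator b z * ip lebesgue X V - indicator b z * ip lebesgue (\<lambda>y. X (y + (- z))) V)
        \<le> indicator b z * (\<delta> * sqrt B * C)" for z
      using shift[of z] by (cases "z \<in> b") (simp_all add: abs_minus_commute)
  qed
  also have "\<dots> = m * (\<delta> * sqrt B * C)" using mb by simp
  finally show "\<bar>m * ip lebesgue X V - ip lebesgue X G\<bar> \<le> m * (\<delta> * sqrt B * C)" by simp
qed

text \<open>The ball averages \<open>G n\<close> of \<open>V n\<close> are pairings with indicators,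
  so they tend to 0 pointwise by weak convergence; bounded supports dominate them, and they tend to
  0 in \<open>L\<^sup>2\<close>. By \<open>averaged_pairing\<close>, replacing \<open>V n\<close> by
  its average costs at most \<open>\<delta> * sqrt B * C\<close>, uniformly in \<open>n\<close>. No
  convergent subsequence of \<open>X\<close> is extracted.\<close>

lemma rellich:
  fixes X V :: "nat \<Rightarrow> real ^ 'd \<Rightarrow> real"
  assumes X: "\<And>n. X n \<in> test_functions UNIV" "\<And>n. H1 (X n) \<le> B"
    and V: "\<And>n. V n \<in> L2 lebesgue" "\<And>n x. norm x > R \<Longrightarrow> V n x = 0" "\<And>n. nrm lebesgue (V n) \<le> C"
    and weak: "\<And>\<psi>. \<psi> \<in> L2 lebesgue \<Longrightarrow> (\<lambda>n. ip lebesgue (V n) \<psi>) \<longlonglongrightarrow> 0"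
  shows "(\<lambda>n. ip lebesgue (X n) (V n)) \<longlonglongrightarrow> 0"
proof -
  have "\<forall>n. \<exists>v'. v' \<in> borel_measurable borel \<and> v' \<in> L2 lebesgue \<and> (AE x in lebesgue. V n x = v' x) \<and> (\<forall>x. norm x > R \<longrightarrow> v' x = 0)"
  proof
    fix n
    obtain v' where "v' \<in> borel_measurable borel" "v' \<in> L2 lebesgue" "AE x in lebesgue. V n x = v' x" "\<And>x. norm x > R \<Longrightarrow> v' x = 0"
      using L2_AE_borel[OF V(1), of R n] V(2) by blast
    then show "\<exists>v'. v' \<in> borel_measurable borel \<and> v' \<in> L2 lebesgue \<and> (AE x in lebesgue. V n x = v' x) \<and> (\<forall>x. norm x > R \<longrightarrow> v' x = 0)"
      by blast
  qed
  then obtain W where W': "\<forall>n. W n \<in> borel_measurable borel \<and> W n \<in> L2 lebesgue \<and> (AE x in lebesgue. V n x = W n x) \<and> (\<forall>x. norm x > R \<longrightarrow> W n x = 0)"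
    by (rule choice[THEN exE])
  then have W: "W n \<in> borel_measurable borel" "W n \<in> L2 lebesgue" "AE x in lebesgue. V n x = W n x" "norm x > R \<Longrightarrow> W n x = 0" for n x
    by blast+
  have ip_W: "ip lebesgue (W n) \<psi> = ip lebesgue (V n) \<psi>" if "\<psi> \<in> L2 lebesgue" for n \<psi>
    unfolding ip_def using W(3)[of n] L2_measurable[OF W(2)[of n]] L2_measurable[OF V(1)[of n]] L2_measurable[OF that]
    by (intro integral_cong_AE borel_measurable_times) auto
  have nrm_W: "nrm lebesgue (W n) \<le> C" for n
    using V(3)[of n] unfolding nrm_def using ip_W[OF W(2)] ip_W[OF V(1)]
    by (metis ip_commute)
  have "C \<ge> 0" "B \<ge> 0" using nrm_nonneg[of lebesgue "V 0"] V(3)[of 0] H1_nonneg[of "X 0"] X(2)[of 0] by linarith+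
  have nrm_X: "nrm lebesgue (X n) \<le> sqrt B" for n
    unfolding nrm_def using order_trans[OF ip_le_H1 X(2)] by (rule real_sqrt_le_mono)
  have small: "\<forall>\<^sub>F n in sequentially. \<bar>ip lebesgue (X n) (V n)\<bar> < \<delta> * sqrt B * C + e"
    if \<delta>: "0 < \<delta>" "\<delta> \<le> 1" and e: "e > 0" for \<delta> e
  proof -
    define m where "m = measure lebesgue (ball (0 :: real ^ 'd) \<delta>)"
    have m: "m > 0" unfolding m_def using \<delta> by (simp add: content_ball_pos)
    define G where "G n y = ip lebesgue (W n) (indicator (ball y \<delta>))" for n y
    note avg = averaged_pairing[OF X(1) X(2) W(1) W(2) nrm_W \<delta>(1), folded m_def]
    have Gm: "G n \<in> borel_measurable lebesgue" for n
      using avg(2)[of n] unfolding G_def[abs_def] by (intro measurable_completion) simp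
    \<comment> \<open>As \<open>\<delta> \<le> 1\<close>, the averages vanish for norms beyond
      \<open>\<bar>R\<bar> + 1\<close>, and the remaining balls lie within radius
      \<open>\<bar>R\<bar> + 2\<close>. The absolute value covers a negative
      \<open>R\<close>.\<close>
    define K where "K = nrm lebesgue (indicator (cball (0 :: real ^ 'd) (\<bar>R\<bar> + 2)))"
    define D where "D = cball (0 :: real ^ 'd) (\<bar>R\<bar> + 1)"
    have G_bound: "\<bar>G n y\<bar> \<le> C * K * indicator D y" for n y
    proof (cases "y \<in> D")
      case True
      have sub: "ball y \<delta> \<subseteq> cball 0 (\<bar>R\<bar> + 2)"
      proof
        fix x assume "x \<in> ball y \<delta>"
        then have "norm (x - y) < 1" using \<delta> by (simp add: dist_norm norm_minus_commute)
        moreover have "norm x \<le> norm (x - y) + norm y" using norm_triangle_ineq[of "x - y" y] by simp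
        ultimately show "x \<in> cball 0 (\<bar>R\<bar> + 2)" using True by (simp add: D_def)
      qed
      have "\<bar>G n y\<bar> \<le> nrm lebesgue (W n) * nrm lebesgue (indicator (ball y \<delta>))"
        unfolding G_def by (intro L2_Cauchy_Schwarz W indicator_L2) auto
      also have "\<dots> \<le> C * K"
      proof (intro mult_mono nrm_W nrm_nonneg \<open>C \<ge> 0\<close>)
        show "nrm lebesgue (indicator (ball y \<delta>)) \<le> K"
          unfolding K_def using sub by (intro nrm_mono_abs indicator_L2) (auto simp: indicator_def)
      qed
      finally show ?thesis using True by simp
    next
      case False
      have "W n x * indicator (ball y \<delta>) x = 0" for x
      proof (cases "x \<in> ball y \<delta>")
        case True
        then have "norm (y - x) < 1" using \<delta> by (simp add: dist_norm)
        moreover have "norm y \<le> norm (y - x) + norm x" using norm_triangle_ineq[of "y - x" x] by simp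
        ultimately have "norm x > R" using False by (simp add: D_def)
        then show ?thesis using W(4) by simp
      qed simp
      then have "(\<lambda>x. W n x * indicator (ball y \<delta>) x) = (\<lambda>x. 0)" by (rule ext)
      then show ?thesis using False by (simp add: G_def ip_def)
    qed
    have "K \<ge> 0" unfolding K_def by (rule nrm_nonneg)
    have wL2: "(\<lambda>y. (C * K) * indicator D y) \<in> L2 lebesgue"
      by (intro L2_cmult indicator_L2) (auto simp: D_def)
    have GL2: "G n \<in> L2 lebesgue" for n
    proof -
      have "integrable lebesgue (\<lambda>y. (G n y)\<^sup>2)"
      proof (rule Bochner_Integration.integrable_bound)
        show "integrable lebesgue (\<lambda>y. (C * K * indicator D y)\<^sup>2)" using wL2 by (simp add: L2_def)
        show "(\<lambda>y. (G n y)\<^sup>2) \<in> borel_measurable lebesgue" using Gm by (rule borel_measurable_power)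
        have "(G n y)\<^sup>2 \<le> (C * K * indicator D y)\<^sup>2" for y
          using G_bound[of n y] \<open>C \<ge> 0\<close> \<open>K \<ge> 0\<close> by (intro abs_le_square_iff[THEN iffD1]) simp
        then show "AE y in lebesgue. norm ((G n y)\<^sup>2) \<le> norm ((C * K * indicator D y)\<^sup>2)" by simp
      qed
      then show ?thesis using Gm by (simp add: L2_def)
    qed
    have "(\<lambda>n. \<integral>y. G n y * G n y \<partial>lebesgue) \<longlonglongrightarrow> (\<integral>y. 0 \<partial>(lebesgue :: (real ^ 'd) measure))"
    proof (rule integral_dominated_convergence[where w="\<lambda>y. (C * K * indicator D y) * (C * K * indicator D y)"])
      show "integrable lebesgue (\<lambda>y. (C * K * indicator D y) * (C * K * indicator D y))"
        by (rule L2_integrable_mult[OF wL2 wL2])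
      show "(\<lambda>y. G n y * G n y) \<in> borel_measurable lebesgue" for n using Gm by (intro borel_measurable_times)
      have "(\<lambda>n. G n y) \<longlonglongrightarrow> 0" for y
        unfolding G_def using weak[of "indicator (ball y \<delta>)"] ip_W indicator_L2[of "ball y \<delta>"] by simp
      then have "(\<lambda>n. G n y * G n y) \<longlonglongrightarrow> 0 * 0" for y by (intro tendsto_mult)
      then show "AE y in lebesgue. (\<lambda>n. G n y * G n y) \<longlonglongrightarrow> 0" by simp
      show "AE y in lebesgue. norm (G n y * G n y) \<le> (C * K * indicator D y) * (C * K * indicator D y)" for n
        unfolding real_norm_def abs_mult
        by (intro always_eventually allI mult_mono G_bound abs_ge_zero order_trans[OF abs_ge_zero G_bound])
    qed auto
    then have "(\<lambda>n. nrm lebesgue (G n)) \<longlonglongrightarrow> sqrt 0"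
      unfolding nrm_def ip_def by (intro tendsto_real_sqrt) simp
    then have "(\<lambda>n. sqrt B * nrm lebesgue (G n) / m) \<longlonglongrightarrow> sqrt B * sqrt 0 / m"
      using m by (intro tendsto_intros) auto
    then have "\<forall>\<^sub>F n in sequentially. sqrt B * nrm lebesgue (G n) / m < e"
      using e by (intro order_tendstoD) auto
    then show ?thesis
    proof eventually_elim
      case (elim n)
      have "\<bar>ip lebesgue (X n) (G n)\<bar> \<le> nrm lebesgue (X n) * nrm lebesgue (G n)"
        by (intro L2_Cauchy_Schwarz test_L2[OF X(1)] GL2)
      also have "\<dots> \<le> sqrt B * nrm lebesgue (G n)" by (intro mult_right_mono nrm_X nrm_nonneg)
      also have "\<dots> < e * m" using elim m by (simp add: field_simps)
      finally have a: "\<bar>ip lebesgue (X n) (G n)\<bar> < e * m" .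
      have "\<bar>m * ip lebesgue (X n) (W n) - ip lebesgue (X n) (G n)\<bar> \<le> m * (\<delta> * sqrt B * C)"
        using avg(1)[of n n] by (simp add: G_def[abs_def])
      with a have "\<bar>m * ip lebesgue (X n) (W n)\<bar> < m * (\<delta> * sqrt B * C) + e * m" by linarith
      also have "\<dots> = m * (\<delta> * sqrt B * C + e)" by (simp add: algebra_simps)
      finally have "m * \<bar>ip lebesgue (X n) (W n)\<bar> < m * (\<delta> * sqrt B * C + e)" using m by (simp add: abs_mult)
      then have "\<bar>ip lebesgue (X n) (W n)\<bar> < \<delta> * sqrt B * C + e" using m by (simp only: mult_less_cancel_left_pos)
      then show ?case using ip_W[OF test_L2[OF X(1)], of n n] by (simp add: ip_commute[of lebesgue "X n"])
    qed
  qed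
  show ?thesis
  proof (rule LIMSEQ_I)
    fix e :: real assume e: "e > 0"
    \<comment> \<open>The averaging error is then at most \<open>e / 2\<close>; the added 1 prevents
      a zero denominator.\<close>
    define \<delta> where "\<delta> = min 1 (e / (2 * (sqrt B * C + 1)))"
    have p: "sqrt B * C + 1 > 0" using \<open>B \<ge> 0\<close> \<open>C \<ge> 0\<close> by (simp add: add_nonneg_pos)
    have \<delta>: "0 < \<delta>" "\<delta> \<le> 1" unfolding \<delta>_def using e p by auto
    have "\<delta> * (sqrt B * C + 1) \<le> e / (2 * (sqrt B * C + 1)) * (sqrt B * C + 1)"
      using p by (intro mult_right_mono) (auto simp: \<delta>_def)
    also have "\<dots> = e / 2"
    proof -
      have "e / (2 * P) * P = e / 2" if "P > 0" for P :: real using that by simp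
      then show ?thesis using p by blast
    qed
    finally have le: "\<delta> * sqrt B * C \<le> e / 2" using \<delta> by (simp add: distrib_left mult.assoc)
    have "\<forall>\<^sub>F n in sequentially. \<bar>ip lebesgue (X n) (V n)\<bar> < \<delta> * sqrt B * C + e / 2"
      using small[OF \<delta>, of "e / 2"] e by simp
    then have "\<forall>\<^sub>F n in sequentially. norm (ip lebesgue (X n) (V n) - 0) < e"
      by eventually_elim (use le in simp)
    then show "\<exists>N. \<forall>n\<ge>N. norm (ip lebesgue (X n) (V n) - 0) < e" by (simp add: eventually_sequentially)
  qed
qed


section \<open>The div-curl lemma on the whole space\<close>

lemma nrm_mult_bounded:
  assumes f: "f \<in> L2 M" and g: "g \<in> borel_measurable M" "\<And>x. \<bar>g x\<bar> \<le> B"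
  shows "nrm M (\<lambda>x. g x * f x) \<le> B * nrm M f"
proof -
  have B: "B \<ge> 0" using g(2) abs_ge_zero order_trans by blast
  have "nrm M (\<lambda>x. g x * f x) \<le> nrm M (\<lambda>x. B * f x)"
    using g(2) B by (intro nrm_mono_abs L2_mult_bounded[OF f g] L2_cmult f) (simp add: abs_mult mult_right_mono)
  then show ?thesis using B by (simp add: nrm_cmult)
qed

lemma nrm_le_sqrt_H1: "nrm lebesgue \<phi> \<le> sqrt (H1 \<phi>)"
  unfolding nrm_def by (intro real_sqrt_le_mono ip_le_H1)

lemma nrm_partial_le_sqrt_H1: "nrm lebesgue (partial_deriv j \<phi>) \<le> sqrt (H1 \<phi>)"
  unfolding nrm_def by (intro real_sqrt_le_mono ip_partial_le_H1)

lemma H1_leI: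
  fixes \<phi> :: "real ^ 'd \<Rightarrow> real"
  assumes "c \<ge> 0" "nrm lebesgue \<phi> \<le> c" "\<And>j. nrm lebesgue (partial_deriv j \<phi>) \<le> c"
  shows "H1 \<phi> \<le> (1 + real CARD('d)) * c\<^sup>2"
proof -
  have "(\<Sum>j\<in>UNIV. ip lebesgue (partial_deriv j \<phi>) (partial_deriv j \<phi>)) \<le> (\<Sum>j\<in>(UNIV :: 'd set). c\<^sup>2)"
    using assms by (intro sum_mono) (simp add: nrm_le_iff)
  moreover have "ip lebesgue \<phi> \<phi> \<le> c\<^sup>2" using assms by (simp add: nrm_le_iff)
  ultimately show ?thesis by (simp add: H1_def algebra_simps)
qed

text \<open>The constant depends on the cutoff only, so multiplication by \<phi> keeps an
  \<open>H\<^sup>1\<close>-bounded sequence bounded, as the curl condition demands.\<close>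

lemma H1_cutoff:
  fixes \<phi> :: "real ^ 'd \<Rightarrow> real"
  assumes \<phi>: "\<phi> \<in> test_functions \<Omega>"
  obtains K where "K \<ge> 0" "\<And>X. X \<in> test_functions UNIV \<Longrightarrow> H1 (\<lambda>x. \<phi> x * X x) \<le> K * H1 X"
proof -
  have "\<forall>j. \<exists>B. \<forall>x. \<bar>partial_deriv j \<phi> x\<bar> \<le> B" using test_bounded[OF test_partial[OF \<phi>]] by blast
  then obtain B where B: "\<forall>j x. \<bar>partial_deriv j \<phi> x\<bar> \<le> B j" by (rule choice[THEN exE])
  obtain B0 where B0: "B0 > 0" "\<And>x. \<bar>\<phi> x\<bar> \<le> B0" using test_bounded[OF \<phi>] by blast
  define c where "c = B0 + (\<Sum>j\<in>UNIV. B j)"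
  have Bnn: "B j \<ge> 0" for j using B[rule_format, of j 0] by linarith
  have Bj: "B0 + B j \<le> c" for j unfolding c_def using Bnn by (simp add: member_le_sum)
  have c: "c \<ge> 0" using Bj[of undefined] Bnn[of undefined] B0(1) by linarith
  have "H1 (\<lambda>x. \<phi> x * X x) \<le> ((1 + real CARD('d)) * c\<^sup>2) * H1 X" if X: "X \<in> test_functions UNIV" for X
  proof -
    have m: "\<phi> \<in> borel_measurable lebesgue" "partial_deriv j \<phi> \<in> borel_measurable lebesgue" for j
      using \<phi> by (intro smooth_lebesgue smooth_partial test_smooth[OF \<phi>])+
    have s: "sqrt (H1 X) \<ge> 0" using H1_nonneg by simp
    have "nrm lebesgue (\<lambda>x. \<phi> x * X x) \<le> B0 * nrm lebesgue X"
      by (intro nrm_mult_bounded test_L2[OF X] m B0)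
    also have "\<dots> \<le> c * sqrt (H1 X)"
      using B0 Bj[of undefined] Bnn[of undefined] by (intro mult_mono nrm_le_sqrt_H1 nrm_nonneg c) auto
    finally have 1: "nrm lebesgue (\<lambda>x. \<phi> x * X x) \<le> c * sqrt (H1 X)" .
    have 2: "nrm lebesgue (partial_deriv j (\<lambda>x. \<phi> x * X x)) \<le> c * sqrt (H1 X)" for j
    proof -
      have "nrm lebesgue (partial_deriv j (\<lambda>x. \<phi> x * X x))
         \<le> nrm lebesgue (\<lambda>x. partial_deriv j \<phi> x * X x) + nrm lebesgue (\<lambda>x. \<phi> x * partial_deriv j X x)"
        unfolding partial_mult[OF test_smooth[OF \<phi>] test_smooth[OF X]]
        by (intro nrm_triangle test_L2[OF test_mult_right[OF test_partial[OF \<phi>] test_smooth[OF X]]]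
            test_L2[OF test_mult_right[OF \<phi> smooth_partial[OF test_smooth[OF X]]]])
      also have "\<dots> \<le> B j * nrm lebesgue X + B0 * nrm lebesgue (partial_deriv j X)"
        using B by (intro add_mono nrm_mult_bounded test_L2[OF X] test_L2[OF test_partial[OF X]] m B0) auto
      also have "\<dots> \<le> B j * sqrt (H1 X) + B0 * sqrt (H1 X)"
        using Bnn B0 by (intro add_mono mult_left_mono nrm_le_sqrt_H1 nrm_partial_le_sqrt_H1) auto
      also have "\<dots> \<le> c * sqrt (H1 X)"
        using mult_right_mono[OF Bj[of j] s] by (simp add: algebra_simps)
      finally show ?thesis .
    qed
    have "H1 (\<lambda>x. \<phi> x * X x) \<le> (1 + real CARD('d)) * (c * sqrt (H1 X))\<^sup>2"
      using c s by (intro H1_leI 1 2) auto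
    then show ?thesis using H1_nonneg[of X] by (simp add: power_mult_distrib mult_ac)
  qed
  then show ?thesis by (intro that[of "(1 + real CARD('d)) * c\<^sup>2"]) auto
qed

lemma H1_diff_le:
  fixes f g :: "real ^ 'd \<Rightarrow> real"
  assumes f: "f \<in> test_functions \<Omega>" and g: "g \<in> test_functions \<Omega>" and B: "H1 f \<le> B" "H1 g \<le> B"
  shows "H1 (\<lambda>x. f x - g x) \<le> (1 + real CARD('d)) * (2 * sqrt B)\<^sup>2"
proof (rule H1_leI)
  have B0: "B \<ge> 0" using H1_nonneg B(1) order_trans by blast
  then show "0 \<le> 2 * sqrt B" by simp
  have s: "sqrt (H1 f) \<le> sqrt B" "sqrt (H1 g) \<le> sqrt B" using B by simp_all
  show "nrm lebesgue (\<lambda>x. f x - g x) \<le> 2 * sqrt B"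
    using nrm_triangle_diff[OF test_L2[OF f] test_L2[OF g]] nrm_le_sqrt_H1[of f] nrm_le_sqrt_H1[of g] s by linarith
  show "nrm lebesgue (partial_deriv j (\<lambda>x. f x - g x)) \<le> 2 * sqrt B" for j
    unfolding partial_diff[OF test_smooth[OF f] test_smooth[OF g]]
    using nrm_triangle_diff[OF test_L2[OF test_partial[OF f]] test_L2[OF test_partial[OF g]], of j j]
      nrm_partial_le_sqrt_H1[of j f] nrm_partial_le_sqrt_H1[of j g] s by linarith
qed

lemma partial_helmholtz:
  assumes "smooth \<psi>"
  shows "partial_deriv l (helmholtz \<psi>) = helmholtz (partial_deriv l \<psi>)"
proof -
  have "partial_deriv l (partial_deriv j (partial_deriv j \<psi>)) = partial_deriv j (partial_deriv j (partial_deriv l \<psi>))" for j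
    using assms by (metis partial_deriv_commute smooth_partial)
  then show ?thesis
    unfolding helmholtz_def[abs_def] using assms
    by (simp add: partial_diff partial_sum smooth_partial smooth_sum)
qed

lemma helmholtz_diff:
  assumes "smooth f" "smooth g"
  shows "helmholtz (\<lambda>x. f x - g x) = (\<lambda>x. helmholtz f x - helmholtz g x)"
  unfolding helmholtz_def[abs_def] using assms
  by (simp add: partial_diff smooth_partial sum_subtractf algebra_simps)

text \<open>Weak convergence to 0 comes with an explicit uniform bound, which the error estimates
  use.\<close>

definition null_seq :: "real \<Rightarrow> (nat \<Rightarrow> real ^ 'd \<Rightarrow> real) \<Rightarrow> bool" where
  "null_seq C v \<longleftrightarrow> (\<forall>n. v n \<in> L2 lebesgue \<and> nrm lebesgue (v n) \<le> C) \<and>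
     (\<forall>\<psi>\<in>L2 lebesgue. (\<lambda>n. ip lebesgue (v n) \<psi>) \<longlonglongrightarrow> 0)"

text \<open>Convergence to 0 of the curls in the dual of \<open>H\<^sup>1\<^sub>0(U)\<close>,
  phrased without a dual norm: the bounded test functions may vary with \<open>n\<close>. The
  difference is minus the distributional curl applied to \<open>\<theta> n\<close>.\<close>

definition curl_null :: "(real ^ 'd) set \<Rightarrow> (nat \<Rightarrow> 'd \<Rightarrow> real ^ 'd \<Rightarrow> real) \<Rightarrow> bool" where
  "curl_null U w \<longleftrightarrow> (\<forall>\<theta> B k l. (\<forall>n. \<theta> n \<in> test_functions U \<and> H1 (\<theta> n) \<le> B) \<longrightarrow>
     (\<lambda>n. ip lebesgue (w n l) (partial_deriv k (\<theta> n)) - ip lebesgue (w n k) (partial_deriv l (\<theta> n))) \<longlonglongrightarrow> 0)"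

lemma null_seq_cutoff:
  assumes v: "null_seq C v" and \<phi>: "\<phi> \<in> test_functions \<Omega>"
  obtains B where "B \<ge> 0" "\<And>n. (\<lambda>x. \<phi> x * v n x) \<in> L2 lebesgue" "\<And>n. nrm lebesgue (\<lambda>x. \<phi> x * v n x) \<le> B"
proof -
  obtain B0 where B0: "B0 > 0" "\<And>x. \<bar>\<phi> x\<bar> \<le> B0" using test_bounded[OF \<phi>] by blast
  have m: "\<phi> \<in> borel_measurable lebesgue" by (intro smooth_lebesgue test_smooth[OF \<phi>])
  have vL: "v n \<in> L2 lebesgue" "nrm lebesgue (v n) \<le> C" for n using v by (auto simp: null_seq_def)
  have C: "C \<ge> 0" using vL(2) nrm_nonneg order_trans by blast
  have "nrm lebesgue (\<lambda>x. \<phi> x * v n x) \<le> B0 * C" for n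
    using nrm_mult_bounded[OF vL(1) m B0(2), of n] mult_left_mono[OF vL(2), of B0 n] B0(1) by linarith
  moreover have "(\<lambda>x. \<phi> x * v n x) \<in> L2 lebesgue" for n by (rule L2_mult_bounded[OF vL(1) m B0(2)])
  ultimately show ?thesis using C B0(1) by (intro that[of "B0 * C"]) auto
qed

text \<open>The cutoff supplies the common bounded support that \<open>rellich\<close> asks for;
  weak convergence survives because \<phi> can be moved onto the fixed test vector.\<close>

lemma rellich_cutoff:
  assumes v: "null_seq C v" and \<phi>: "\<phi> \<in> test_functions \<Omega>"
    and X: "\<And>n. X n \<in> test_functions UNIV" "\<And>n. H1 (X n) \<le> B"
  shows "(\<lambda>n. ip lebesgue (X n) (\<lambda>x. \<phi> x * v n x)) \<longlonglongrightarrow> 0"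
proof -
  obtain B' where B': "B' \<ge> 0" "\<And>n. (\<lambda>x. \<phi> x * v n x) \<in> L2 lebesgue" "\<And>n. nrm lebesgue (\<lambda>x. \<phi> x * v n x) \<le> B'"
    using null_seq_cutoff[OF v \<phi>] by blast
  obtain R where R: "R > 0" "\<And>x. norm x > R \<Longrightarrow> \<phi> x = 0" using test_bounded_support[OF \<phi>] by blast
  show ?thesis
  proof (rule rellich[OF X B'(2) _ B'(3)])
    show "\<phi> x * v n x = 0" if "norm x > R" for n x using R(2)[OF that] by simp
    fix \<psi> :: "real ^ 'a \<Rightarrow> real" assume \<psi>: "\<psi> \<in> L2 lebesgue"
    obtain B0 where B0: "B0 > 0" "\<And>x. \<bar>\<phi> x\<bar> \<le> B0" using test_bounded[OF \<phi>] by blast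
    have "(\<lambda>x. \<phi> x * \<psi> x) \<in> L2 lebesgue"
      by (rule L2_mult_bounded[OF \<psi> smooth_lebesgue[OF test_smooth[OF \<phi>]] B0(2)])
    then have "(\<lambda>n. ip lebesgue (v n) (\<lambda>x. \<phi> x * \<psi> x)) \<longlonglongrightarrow> 0" using v by (simp add: null_seq_def)
    then show "(\<lambda>n. ip lebesgue (\<lambda>x. \<phi> x * v n x) \<psi>) \<longlonglongrightarrow> 0" by (simp add: ip_def mult_ac)
  qed
qed

text \<open>\<open>Y n\<close> need not be supported in \<open>U\<close>, so the curl condition is
  applied to \<open>\<phi> Y n\<close>. The terms in which the derivative falls on \<phi> pair
  \<open>Y n\<close> with a localised \<open>w n\<close> and vanish by Rellich.\<close>

lemma curl_null_swap:
  assumes w: "\<And>i. null_seq C (\<lambda>n. w n i)" "curl_null U w" and \<phi>: "\<phi> \<in> test_functions U"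
    and Y: "\<And>n. Y n \<in> test_functions UNIV" "\<And>n. H1 (Y n) \<le> B"
  shows "(\<lambda>n. ip lebesgue (\<lambda>x. \<phi> x * w n l x) (partial_deriv k (Y n))
     - ip lebesgue (\<lambda>x. \<phi> x * w n k x) (partial_deriv l (Y n))) \<longlonglongrightarrow> 0"
proof -
  obtain K where K: "K \<ge> 0" "\<And>X. X \<in> test_functions UNIV \<Longrightarrow> H1 (\<lambda>x. \<phi> x * X x) \<le> K * H1 X"
    using H1_cutoff[OF \<phi>] by blast
  have wL: "w n i \<in> L2 lebesgue" for n i using w(1) by (simp add: null_seq_def)
  have Z: "(\<lambda>x. \<phi> x * Y n x) \<in> test_functions U" "H1 (\<lambda>x. \<phi> x * Y n x) \<le> K * B" for n
    using test_mult_right[OF \<phi> test_smooth[OF Y(1)]] order_trans[OF K(2)[OF Y(1)] mult_left_mono[OF Y(2) K(1)]] by blast+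
  then have lim1: "(\<lambda>n. ip lebesgue (w n l) (partial_deriv k (\<lambda>x. \<phi> x * Y n x))
      - ip lebesgue (w n k) (partial_deriv l (\<lambda>x. \<phi> x * Y n x))) \<longlonglongrightarrow> 0"
    using w(2)[unfolded curl_null_def, rule_format, of "\<lambda>n x. \<phi> x * Y n x" "K * B"] by blast
  have lim2: "(\<lambda>n. ip lebesgue (Y n) (\<lambda>x. partial_deriv k \<phi> x * w n l x)) \<longlonglongrightarrow> 0" for k l
    by (rule rellich_cutoff[OF w(1) test_partial[OF \<phi>] Y])
  have eq: "ip lebesgue (\<lambda>x. \<phi> x * w n l x) (partial_deriv k (Y n))
     = ip lebesgue (w n l) (partial_deriv k (\<lambda>x. \<phi> x * Y n x)) - ip lebesgue (Y n) (\<lambda>x. partial_deriv k \<phi> x * w n l x)" for n k l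
  proof -
    have "ip lebesgue (w n l) (partial_deriv k (\<lambda>x. \<phi> x * Y n x))
      = ip lebesgue (w n l) (\<lambda>x. partial_deriv k \<phi> x * Y n x) + ip lebesgue (w n l) (\<lambda>x. \<phi> x * partial_deriv k (Y n) x)"
      unfolding partial_mult[OF test_smooth[OF \<phi>] test_smooth[OF Y(1)]]
      by (intro ip_add_right wL test_L2[OF test_mult_right[OF test_partial[OF \<phi>] test_smooth[OF Y(1)]]]
           test_L2[OF test_mult_right[OF \<phi> smooth_partial[OF test_smooth[OF Y(1)]]]])
    then show ?thesis by (simp add: ip_def mult_ac)
  qed
  have "(\<lambda>n. (ip lebesgue (w n l) (partial_deriv k (\<lambda>x. \<phi> x * Y n x)) - ip lebesgue (w n k) (partial_deriv l (\<lambda>x. \<phi> x * Y n x)))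
      - (ip lebesgue (Y n) (\<lambda>x. partial_deriv k \<phi> x * w n l x) - ip lebesgue (Y n) (\<lambda>x. partial_deriv l \<phi> x * w n k x))) \<longlonglongrightarrow> 0 - (0 - 0)"
    by (intro tendsto_diff lim1 lim2)
  then show ?thesis unfolding eq by (simp add: algebra_simps)
qed

text \<open>The main estimate: approximate \<open>\<eta> u\<^sub>k\<close> by \<open>\<Psi>\<^sub>k - \<Delta> \<Psi>\<^sub>k\<close> and move the Laplacian across with the
  curl condition on \<open>v\<close>; what remains is the curl \<open>\<theta>\<close> of \<open>\<Psi>\<close>, which tends to \<open>0\<close> in \<open>H\<^sup>1\<close> by the energy
  identity and the curl condition on \<open>u\<close>.\<close>

lemma div_curl_null:
  fixes u v :: "nat \<Rightarrow> 'd \<Rightarrow> real ^ 'd \<Rightarrow> real"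
  assumes u: "\<And>i. null_seq C (\<lambda>n. u n i)" "curl_null U u"
    and v: "\<And>i. null_seq C (\<lambda>n. v n i)" "curl_null U v"
    and \<eta>: "\<eta> \<in> test_functions U" and \<phi>: "\<phi> \<in> test_functions U"
  shows "(\<lambda>n. ip lebesgue (\<lambda>x. \<eta> x * u n k x) (\<lambda>x. \<phi> x * v n l x)
      - ip lebesgue (\<lambda>x. \<eta> x * u n l x) (\<lambda>x. \<phi> x * v n k x)) \<longlonglongrightarrow> 0"
proof -
  define a where "a n i x = \<eta> x * u n i x" for n i x
  define b where "b n i x = \<phi> x * v n i x" for n i x
  have "\<forall>i. \<exists>B. B \<ge> 0 \<and> (\<forall>n. a n i \<in> L2 lebesgue \<and> nrm lebesgue (a n i) \<le> B)"
    unfolding a_def[abs_def]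
  proof
    fix i
    obtain B where "B \<ge> 0" "\<And>n. (\<lambda>x. \<eta> x * u n i x) \<in> L2 lebesgue" "\<And>n. nrm lebesgue (\<lambda>x. \<eta> x * u n i x) \<le> B"
      using null_seq_cutoff[OF u(1)[of i] \<eta>] by blast
    then show "\<exists>B. B \<ge> 0 \<and> (\<forall>n. (\<lambda>x. \<eta> x * u n i x) \<in> L2 lebesgue \<and> nrm lebesgue (\<lambda>x. \<eta> x * u n i x) \<le> B)"
      by blast
  qed
  then obtain Ba where Ba: "\<forall>i. Ba i \<ge> 0 \<and> (\<forall>n. a n i \<in> L2 lebesgue \<and> nrm lebesgue (a n i) \<le> Ba i)"
    by (rule choice[THEN exE])
  have "\<forall>i. \<exists>B. B \<ge> 0 \<and> (\<forall>n. b n i \<in> L2 lebesgue \<and> nrm lebesgue (b n i) \<le> B)"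
    unfolding b_def[abs_def]
  proof
    fix i
    obtain B where "B \<ge> 0" "\<And>n. (\<lambda>x. \<phi> x * v n i x) \<in> L2 lebesgue" "\<And>n. nrm lebesgue (\<lambda>x. \<phi> x * v n i x) \<le> B"
      using null_seq_cutoff[OF v(1)[of i] \<phi>] by blast
    then show "\<exists>B. B \<ge> 0 \<and> (\<forall>n. (\<lambda>x. \<phi> x * v n i x) \<in> L2 lebesgue \<and> nrm lebesgue (\<lambda>x. \<phi> x * v n i x) \<le> B)"
      by blast
  qed
  then obtain Bb where Bb: "\<forall>i. Bb i \<ge> 0 \<and> (\<forall>n. b n i \<in> L2 lebesgue \<and> nrm lebesgue (b n i) \<le> Bb i)"
    by (rule choice[THEN exE])
  define c where "c = (\<Sum>i\<in>UNIV. Ba i) + (\<Sum>i\<in>UNIV. Bb i)"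
  have aL: "a n i \<in> L2 lebesgue" and bL: "b n i \<in> L2 lebesgue" for n i using Ba Bb by blast+
  have sums: "(\<Sum>i\<in>UNIV. Ba i) \<ge> 0" "(\<Sum>i\<in>UNIV. Bb i) \<ge> 0" using Ba Bb by (auto intro: sum_nonneg)
  have le_c: "nrm lebesgue (a n i) \<le> c" "nrm lebesgue (b n i) \<le> c" for n i
  proof -
    have "Ba i \<le> (\<Sum>i\<in>UNIV. Ba i)" "Bb i \<le> (\<Sum>i\<in>UNIV. Bb i)" using Ba Bb by (auto intro!: member_le_sum)
    then show "nrm lebesgue (a n i) \<le> c" "nrm lebesgue (b n i) \<le> c"
      using Ba[rule_format, of i] Bb[rule_format, of i] sums unfolding c_def by (meson add_increasing add_increasing2 order_trans)+
  qed
  have c: "c \<ge> 0" using sums by (simp add: c_def)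
  \<comment> \<open>The density error depends on \<open>n\<close> and tends to 0, so the remainders
    \<open>r n i\<close> vanish strongly against every bounded sequence.\<close>
  define \<delta> where "\<delta> n = 1 / real (Suc n)" for n
  have \<delta>: "\<delta> n > 0" "\<delta> n \<le> 1" for n by (auto simp: \<delta>_def)
  have \<delta>_lim: "\<delta> \<longlonglongrightarrow> 0" unfolding \<delta>_def by (rule LIMSEQ_Suc[OF lim_1_over_n])
  have "\<forall>p. \<exists>\<psi>. \<psi> \<in> test_functions UNIV \<and> nrm lebesgue (\<lambda>x. a (fst p) (snd p) x - helmholtz \<psi> x) < \<delta> (fst p)"
    using helmholtz_dense[OF aL \<delta>(1)] by metis
  then obtain \<Psi>' where \<Psi>': "\<forall>p. \<Psi>' p \<in> test_functions UNIV \<and> nrm lebesgue (\<lambda>x. a (fst p) (snd p) x - helmholtz (\<Psi>' p) x) < \<delta> (fst p)"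
    by (rule choice[THEN exE])
  define \<Psi> where "\<Psi> n i = \<Psi>' (n, i)" for n i
  have \<Psi>: "\<Psi> n i \<in> test_functions UNIV" "nrm lebesgue (\<lambda>x. a n i x - helmholtz (\<Psi> n i) x) < \<delta> n" for n i
    using \<Psi>'[rule_format, of "(n, i)"] by (auto simp: \<Psi>_def)
  define A where "A n i = helmholtz (\<Psi> n i)" for n i
  define r where "r n i x = a n i x - A n i x" for n i x
  have At: "A n i \<in> test_functions UNIV" for n i unfolding A_def by (intro test_helmholtz \<Psi>)
  note AL = test_L2[OF At]
  have rL: "r n i \<in> L2 lebesgue" for n i unfolding r_def[abs_def] by (intro L2_diff aL AL)
  have r: "nrm lebesgue (r n i) \<le> \<delta> n" for n i using \<Psi>(2)[of n i] by (simp add: r_def[abs_def] A_def)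
  have A_bound: "nrm lebesgue (A n i) \<le> c + 1" for n i
    using nrm_le_diff[OF AL aL, of n i n i] r[of n i] \<delta>(2)[of n] le_c(1)[of n i] nrm_minus_commute[of lebesgue "A n i" "a n i"]
    by (simp add: r_def[abs_def])
  define B where "B = (c + 1)\<^sup>2"
  have A_sq: "(nrm lebesgue (A n i))\<^sup>2 \<le> B" for n i
    unfolding B_def by (intro power_mono A_bound nrm_nonneg)
  have H\<Psi>: "H1 (\<Psi> n i) \<le> B" "H1 (partial_deriv m (\<Psi> n i)) \<le> B" for n i m
    using H1_le_helmholtz[OF \<Psi>(1)] H1_partial_le_helmholtz[OF \<Psi>(1)] A_sq[of n i] unfolding A_def by (meson order_trans)+
  note sm = test_smooth[OF \<Psi>(1)]
  note p\<Psi> = test_partial[OF \<Psi>(1)]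

  define \<theta> where "\<theta> n x = partial_deriv l (\<Psi> n k) x - partial_deriv k (\<Psi> n l) x" for n x
  have \<theta>: "\<theta> n \<in> test_functions UNIV" for n unfolding \<theta>_def[abs_def] by (intro test_diff p\<Psi>)
  define B' where "B' = (1 + real CARD('d)) * (2 * sqrt B)\<^sup>2"
  have H\<theta>: "H1 (\<theta> n) \<le> B'" for n
    unfolding \<theta>_def[abs_def] B'_def by (rule H1_diff_le[OF p\<Psi> p\<Psi> H\<Psi>(2) H\<Psi>(2)])
  \<comment> \<open>\<open>helmholtz\<close> commutes with derivatives, so on \<theta> it gives the
    curl of \<open>A\<close>. An integration by parts moves that curl onto \<theta>, and
    \<open>A = a - r\<close> separates the compact curl of the cut-off \<open>u\<close> from the
    density error.\<close>
  have \<theta>_energy: "H1 (\<theta> n) = (ip lebesgue (a n l) (partial_deriv k (\<theta> n)) - ip lebesgue (a n k) (partial_deriv l (\<theta> n)))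
      - (ip lebesgue (r n l) (partial_deriv k (\<theta> n)) - ip lebesgue (r n k) (partial_deriv l (\<theta> n)))" for n
  proof -
    note pt = test_L2[OF test_partial[OF \<theta>]]
    have "H1 (\<theta> n) = ip lebesgue (helmholtz (\<theta> n)) (\<theta> n)" using helmholtz_energy[OF \<theta>] by simp
    also have "helmholtz (\<theta> n) = (\<lambda>x. partial_deriv l (A n k) x - partial_deriv k (A n l) x)"
      unfolding \<theta>_def[abs_def] A_def by (simp add: helmholtz_diff smooth_partial sm partial_helmholtz)
    also have "ip lebesgue \<dots> (\<theta> n) = ip lebesgue (partial_deriv l (A n k)) (\<theta> n) - ip lebesgue (partial_deriv k (A n l)) (\<theta> n)"
      by (rule ip_diff_left) (rule test_L2[OF test_partial[OF At]] test_L2[OF \<theta>])+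
    also have "\<dots> = ip lebesgue (A n l) (partial_deriv k (\<theta> n)) - ip lebesgue (A n k) (partial_deriv l (\<theta> n))"
      using integration_by_parts[OF test_smooth[OF At] \<theta>] by simp
    finally have energy: "H1 (\<theta> n) = ip lebesgue (A n l) (partial_deriv k (\<theta> n)) - ip lebesgue (A n k) (partial_deriv l (\<theta> n))" .
    have split: "ip lebesgue (A n i) (partial_deriv j (\<theta> n)) = ip lebesgue (a n i) (partial_deriv j (\<theta> n)) - ip lebesgue (r n i) (partial_deriv j (\<theta> n))" for i j
      using ip_diff_left[OF aL AL pt, of n i n i j n] by (simp add: r_def[abs_def])
    show ?thesis unfolding energy split by simp
  qed
  have small: "(\<lambda>n. ip lebesgue (r n i) (w n)) \<longlonglongrightarrow> 0" if "\<And>n. w n \<in> L2 lebesgue" "\<And>n. nrm lebesgue (w n) \<le> D" for i w D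
  proof (rule tendsto_rabs_zero_cancel, rule tendsto_sandwich[OF _ _ tendsto_const])
    have "\<bar>ip lebesgue (r n i) (w n)\<bar> \<le> \<delta> n * D" for n
      using L2_Cauchy_Schwarz[OF rL that(1), of n i n] mult_mono[OF r that(2) _ nrm_nonneg, of n i n] \<delta>(1)[of n] by linarith
    then show "\<forall>\<^sub>F n in sequentially. \<bar>ip lebesgue (r n i) (w n)\<bar> \<le> \<delta> n * D" by simp
    show "(\<lambda>n. \<delta> n * D) \<longlonglongrightarrow> 0" using tendsto_mult_right[OF \<delta>_lim, of D] by simp
  qed auto
  have \<theta>_lim: "(\<lambda>n. H1 (\<theta> n)) \<longlonglongrightarrow> 0"
  proof -
    have 1: "(\<lambda>n. ip lebesgue (a n l) (partial_deriv k (\<theta> n)) - ip lebesgue (a n k) (partial_deriv l (\<theta> n))) \<longlonglongrightarrow> 0"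
      unfolding a_def[abs_def] by (rule curl_null_swap[OF u \<eta> \<theta> H\<theta>])
    have 2: "(\<lambda>n. ip lebesgue (r n i) (partial_deriv j (\<theta> n))) \<longlonglongrightarrow> 0" for i j
      by (rule small[OF test_L2[OF test_partial[OF \<theta>]]])
         (rule order_trans[OF nrm_partial_le_sqrt_H1 real_sqrt_le_mono[OF H\<theta>]])
    have "(\<lambda>n. (ip lebesgue (a n l) (partial_deriv k (\<theta> n)) - ip lebesgue (a n k) (partial_deriv l (\<theta> n)))
      - (ip lebesgue (r n l) (partial_deriv k (\<theta> n)) - ip lebesgue (r n k) (partial_deriv l (\<theta> n)))) \<longlonglongrightarrow> 0 - (0 - 0)"
      by (intro tendsto_diff 1 2)
    then show ?thesis unfolding \<theta>_energy by simp
  qed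

  have Ab: "ip lebesgue (A n i) (b n j) = ip lebesgue (\<Psi> n i) (b n j)
      - (\<Sum>m\<in>UNIV. ip lebesgue (b n j) (partial_deriv m (partial_deriv m (\<Psi> n i))))" for n i j
  proof -
    have "ip lebesgue (A n i) (b n j) = ip lebesgue (\<Psi> n i) (b n j) - ip lebesgue (\<lambda>x. \<Sum>m\<in>UNIV. partial_deriv m (partial_deriv m (\<Psi> n i)) x) (b n j)"
      unfolding A_def helmholtz_def[abs_def]
      by (rule ip_diff_left) (rule test_L2[OF \<Psi>(1)] L2_sum test_L2[OF test_partial[OF p\<Psi>]] bL)+
    also have "ip lebesgue (\<lambda>x. \<Sum>m\<in>UNIV. partial_deriv m (partial_deriv m (\<Psi> n i)) x) (b n j)
       = (\<Sum>m\<in>UNIV. ip lebesgue (partial_deriv m (partial_deriv m (\<Psi> n i))) (b n j))"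
      by (rule ip_sum_left) (rule test_L2[OF test_partial[OF p\<Psi>]] bL)+
    finally show ?thesis by (simp add: ip_commute[of lebesgue "b n j"])
  qed
  have ab: "ip lebesgue (a n i) (b n j) = ip lebesgue (A n i) (b n j) + ip lebesgue (r n i) (b n j)" for n i j
    using ip_diff_left[OF aL AL bL, of n i n i n j] by (simp add: r_def[abs_def])
  \<comment> \<open>The error of exchanging the index \<open>j\<close> of \<open>b\<close> with one
    of the two derivative indices \<open>m\<close>. It vanishes by the curl condition on
    \<open>v\<close>, tested against the \<open>H\<^sup>1\<close>-bounded
    \<open>\<partial>\<^sub>m \<Psi>\<^sub>i\<close>.\<close>
  define s where "s n m i j = ip lebesgue (b n j) (partial_deriv m (partial_deriv m (\<Psi> n i)))
      - ip lebesgue (b n m) (partial_deriv j (partial_deriv m (\<Psi> n i)))" for n m i j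
  have s_lim: "(\<lambda>n. s n m i j) \<longlonglongrightarrow> 0" for m i j
    unfolding s_def b_def[abs_def] by (rule curl_null_swap[OF v \<phi> p\<Psi> H\<Psi>(2)])
  have b\<theta>: "ip lebesgue (b n m) (partial_deriv m (\<theta> n)) = ip lebesgue (b n m) (partial_deriv l (partial_deriv m (\<Psi> n k)))
      - ip lebesgue (b n m) (partial_deriv k (partial_deriv m (\<Psi> n l)))" for n m
  proof -
    have "partial_deriv m (\<theta> n) = (\<lambda>x. partial_deriv l (partial_deriv m (\<Psi> n k)) x - partial_deriv k (partial_deriv m (\<Psi> n l)) x)"
      unfolding \<theta>_def[abs_def] partial_diff[OF smooth_partial[OF sm] smooth_partial[OF sm]]
        partial_deriv_commute[OF sm, of m l] partial_deriv_commute[OF sm, of m k] ..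
    then show ?thesis
      by (simp add: ip_diff_right bL test_L2[OF test_partial[OF p\<Psi>]])
  qed
  have b\<theta>_lim: "(\<lambda>n. ip lebesgue (b n m) (partial_deriv m (\<theta> n))) \<longlonglongrightarrow> 0" for m
  proof (rule tendsto_rabs_zero_cancel, rule tendsto_sandwich[OF _ _ tendsto_const])
    have "\<bar>ip lebesgue (b n m) (partial_deriv m (\<theta> n))\<bar> \<le> c * sqrt (H1 (\<theta> n))" for n
      using L2_Cauchy_Schwarz[OF bL test_L2[OF test_partial[OF \<theta>]], of n m m n]
        mult_mono[OF le_c(2) nrm_partial_le_sqrt_H1 c nrm_nonneg, of n m m "\<theta> n"] by linarith
    then show "\<forall>\<^sub>F n in sequentially. \<bar>ip lebesgue (b n m) (partial_deriv m (\<theta> n))\<bar> \<le> c * sqrt (H1 (\<theta> n))" by simp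
    show "(\<lambda>n. c * sqrt (H1 (\<theta> n))) \<longlonglongrightarrow> 0"
      using tendsto_mult_left[OF tendsto_real_sqrt[OF \<theta>_lim], of c] by simp
  qed auto
  have \<Psi>_lim: "(\<lambda>n. ip lebesgue (\<Psi> n i) (b n j)) \<longlonglongrightarrow> 0" for i j
    unfolding b_def[abs_def] by (rule rellich_cutoff[OF v(1) \<phi> \<Psi>(1) H\<Psi>(1)])
  have rb_lim: "(\<lambda>n. ip lebesgue (r n i) (b n j)) \<longlonglongrightarrow> 0" for i j
    by (rule small[OF bL le_c(2)])
  \<comment> \<open>After the exchange the Laplacian terms pair \<open>b\<^sub>m\<close> with
    \<open>\<partial>\<^sub>l \<partial>\<^sub>m \<Psi>\<^sub>k - \<partial>\<^sub>k
    \<partial>\<^sub>m \<Psi>\<^sub>l\<close>, which is \<open>\<partial>\<^sub>m \<theta>\<close>.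
    Every other summand is an error already known to vanish.\<close>
  have "ip lebesgue (a n k) (b n l) - ip lebesgue (a n l) (b n k)
      = (ip lebesgue (r n k) (b n l) - ip lebesgue (r n l) (b n k))
       + (ip lebesgue (\<Psi> n k) (b n l) - ip lebesgue (\<Psi> n l) (b n k))
       - (\<Sum>m\<in>UNIV. s n m k l - s n m l k + ip lebesgue (b n m) (partial_deriv m (\<theta> n)))" for n
  proof -
    have "(\<Sum>m\<in>UNIV. s n m k l - s n m l k + ip lebesgue (b n m) (partial_deriv m (\<theta> n)))
      = (\<Sum>m\<in>UNIV. ip lebesgue (b n l) (partial_deriv m (partial_deriv m (\<Psi> n k))) - ip lebesgue (b n k) (partial_deriv m (partial_deriv m (\<Psi> n l))))"
      by (intro sum.cong refl) (simp add: s_def b\<theta>)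
    then show ?thesis by (simp add: ab Ab sum_subtractf)
  qed
  moreover have "(\<lambda>n. (ip lebesgue (r n k) (b n l) - ip lebesgue (r n l) (b n k))
       + (ip lebesgue (\<Psi> n k) (b n l) - ip lebesgue (\<Psi> n l) (b n k))
       - (\<Sum>m\<in>UNIV. s n m k l - s n m l k + ip lebesgue (b n m) (partial_deriv m (\<theta> n))))
      \<longlonglongrightarrow> (0 - 0) + (0 - 0) - (\<Sum>m\<in>(UNIV :: 'd set). 0 - 0 + 0)"
    by (intro tendsto_intros rb_lim \<Psi>_lim s_lim b\<theta>_lim)
  ultimately show ?thesis by (simp add: a_def[abs_def] b_def[abs_def])
qed


section \<open>Compactness in negative Sobolev spaces\<close>

text \<open>Translations and the operator \<open>helmholtz\<close> act on the whole space, so fields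
  given on \<Omega> are carried there. No regularity across the boundary is claimed, since all tests
  are supported inside.\<close>

definition zero_ext :: "'a set \<Rightarrow> ('a \<Rightarrow> real) \<Rightarrow> 'a \<Rightarrow> real" where
  "zero_ext \<Omega> f x = indicator \<Omega> x * f x"

lemma in_L2_iff: "in_L2 \<Omega> f \<longleftrightarrow> f \<in> L2 (lebesgue_on \<Omega>)"
  by (simp add: in_L2_def L2_def)

lemma weakly_in_L2_iff: "weakly_in_L2 \<Omega> f f' \<longleftrightarrow> weakly_L2 (lebesgue_on \<Omega>) f f'"
  by (auto simp: weakly_in_L2_def weakly_L2_def in_L2_iff ip_def)

lemma zero_ext_L2:
  assumes "\<Omega> \<in> sets lebesgue" "f \<in> L2 (lebesgue_on \<Omega>)"
  shows "zero_ext \<Omega> f \<in> L2 lebesgue"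
proof -
  have "(\<lambda>x. indicator \<Omega> x *\<^sub>R f x) \<in> borel_measurable lebesgue"
    using assms by (subst borel_measurable_restrict_space_iff[symmetric]) (auto simp: L2_def)
  moreover have "integrable lebesgue (\<lambda>x. indicator \<Omega> x *\<^sub>R (f x)\<^sup>2)"
    using assms by (subst integrable_restrict_space[symmetric]) (auto simp: L2_def)
  moreover have "(\<lambda>x. (zero_ext \<Omega> f x)\<^sup>2) = (\<lambda>x. indicator \<Omega> x *\<^sub>R (f x)\<^sup>2)"
    by (auto simp: zero_ext_def indicator_def)
  ultimately show ?thesis by (simp add: L2_def zero_ext_def[abs_def])
qed

lemma ip_zero_ext:
  assumes "\<Omega> \<in> sets lebesgue"
  shows "ip lebesgue (zero_ext \<Omega> f) g = ip (lebesgue_on \<Omega>) f g"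
    "ip lebesgue (zero_ext \<Omega> f) (zero_ext \<Omega> g) = ip (lebesgue_on \<Omega>) f g"
proof -
  have "(\<lambda>x. zero_ext \<Omega> f x * g x) = (\<lambda>x. indicator \<Omega> x *\<^sub>R (f x * g x))"
    "(\<lambda>x. zero_ext \<Omega> f x * zero_ext \<Omega> g x) = (\<lambda>x. indicator \<Omega> x *\<^sub>R (f x * g x))"
    by (auto simp: zero_ext_def indicator_def)
  then show "ip lebesgue (zero_ext \<Omega> f) g = ip (lebesgue_on \<Omega>) f g"
    "ip lebesgue (zero_ext \<Omega> f) (zero_ext \<Omega> g) = ip (lebesgue_on \<Omega>) f g"
    unfolding ip_def using assms by (simp_all add: integral_restrict_space)
qed

lemma L2_restrict:
  assumes "\<Omega> \<in> sets lebesgue" "g \<in> L2 lebesgue" shows "g \<in> L2 (lebesgue_on \<Omega>)"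
proof -
  have "integrable lebesgue (\<lambda>x. indicator \<Omega> x *\<^sub>R (g x)\<^sup>2)"
    using assms by (intro integrable_mult_indicator) (auto simp: L2_def)
  then have "integrable (lebesgue_on \<Omega>) (\<lambda>x. (g x)\<^sup>2)"
    using assms by (subst integrable_restrict_space) auto
  then show ?thesis using assms by (auto simp: L2_def intro: measurable_restrict_space1)
qed

lemma test_L2_on: "\<Omega> \<in> sets lebesgue \<Longrightarrow> \<phi> \<in> test_functions U \<Longrightarrow> \<phi> \<in> L2 (lebesgue_on \<Omega>)"
  by (intro L2_restrict test_L2)

lemma regular_dist_eq:
  assumes "\<phi> \<in> test_functions \<Omega>"
  shows "regular_dist \<Omega> f \<phi> = ip (lebesgue_on \<Omega>) f \<phi>"
  using assms by (simp add: regular_dist_def ip_def)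

text \<open>The sign of the distributional derivative reverses the order of the two terms.\<close>

lemma curl_dist_eq:
  assumes "\<phi> \<in> test_functions \<Omega>"
  shows "curl_dist \<Omega> k u l v \<phi> = ip (lebesgue_on \<Omega>) v (partial_deriv l \<phi>) - ip (lebesgue_on \<Omega>) u (partial_deriv k \<phi>)"
  using assms test_partial[OF assms] by (simp add: curl_dist_def dist_deriv_def regular_dist_eq)

lemma H1_norm_eq:
  assumes U: "U \<in> sets lebesgue" and \<phi>: "\<phi> \<in> test_functions U"
  shows "H1_norm U \<phi> = sqrt (H1 \<phi>)"
proof -
  note p = test_partial[OF \<phi>]
  have i: "integrable lebesgue (\<lambda>x. \<phi> x * \<phi> x)" "integrable lebesgue (\<lambda>x. partial_deriv j \<phi> x * partial_deriv j \<phi> x)" for j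
    by (intro L2_integrable_mult test_L2[OF \<phi>] test_L2[OF p])+
  have "integral\<^sup>L (lebesgue_on U) (\<lambda>x. (\<phi> x)\<^sup>2 + (\<Sum>j\<in>UNIV. (partial_deriv j \<phi> x)\<^sup>2))
    = (\<integral>x. indicator U x *\<^sub>R ((\<phi> x)\<^sup>2 + (\<Sum>j\<in>UNIV. (partial_deriv j \<phi> x)\<^sup>2)) \<partial>lebesgue)"
    using U by (simp add: integral_restrict_space)
  also have "\<dots> = (\<integral>x. \<phi> x * \<phi> x + (\<Sum>j\<in>UNIV. partial_deriv j \<phi> x * partial_deriv j \<phi> x) \<partial>lebesgue)"
    using test_outside[OF \<phi>] test_outside[OF p]
    by (intro Bochner_Integration.integral_cong) (auto simp: indicator_def power2_eq_square)
  also have "\<dots> = H1 \<phi>" using i by (simp add: H1_def ip_def)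
  finally show ?thesis by (simp add: H1_norm_def)
qed

text \<open>\<open>Hneg1_norm\<close> is a real supremum and bounds its members only over a set
  bounded above; membership of \<open>S\<close> and \<open>T\<close> in the dual provides that
  bound.\<close>

lemma Hneg1_ball_bound:
  assumes S: "in_Hneg1 U S" and T: "in_Hneg1 U T" and \<phi>: "\<phi> \<in> test_functions U" "H1_norm U \<phi> \<le> 1"
  shows "\<bar>S \<phi> - T \<phi>\<bar> \<le> Hneg1_norm U (S - T)"
proof -
  obtain B1 B2 where B: "\<And>\<phi>. \<phi> \<in> test_functions U \<Longrightarrow> \<bar>S \<phi>\<bar> \<le> B1 * H1_norm U \<phi>"
     "\<And>\<phi>. \<phi> \<in> test_functions U \<Longrightarrow> \<bar>T \<phi>\<bar> \<le> B2 * H1_norm U \<phi>"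
    using S T unfolding in_Hneg1_def by blast
  have "bdd_above ((\<lambda>\<phi>. \<bar>(S - T) \<phi>\<bar>) ` {\<phi> \<in> test_functions U. H1_norm U \<phi> \<le> 1})"
  proof (rule bdd_aboveI2)
    fix \<phi> assume \<phi>: "\<phi> \<in> {\<phi> \<in> test_functions U. H1_norm U \<phi> \<le> 1}"
    have nn: "0 \<le> H1_norm U \<phi>" by (auto simp: H1_norm_def intro!: integral_nonneg_AE add_nonneg_nonneg sum_nonneg)
    have "B * H1_norm U \<phi> \<le> \<bar>B\<bar>" for B
      using \<phi> nn mult_mono[of B "\<bar>B\<bar>" "H1_norm U \<phi>" 1] by auto
    then have "\<bar>S \<phi>\<bar> \<le> \<bar>B1\<bar>" "\<bar>T \<phi>\<bar> \<le> \<bar>B2\<bar>" using B \<phi> order_trans by blast+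
    then show "\<bar>(S - T) \<phi>\<bar> \<le> \<bar>B1\<bar> + \<bar>B2\<bar>" by simp
  qed
  then show ?thesis
    unfolding Hneg1_norm_def using \<phi> by (intro cSUP_upper2[of _ _ \<phi>]) auto
qed

text \<open>A compact set is totally bounded for each seminorm, and on a totally bounded set
  pointwise convergence is convergence in the seminorm.\<close>

lemma Hneg1_compact_convergence:
  fixes T :: "nat \<Rightarrow> 'd::finite functional"
  assumes K: "compactin (Hneg1_loc_topology \<Omega>) K" and TK: "\<And>n. T n \<in> K"
    and U: "inner_subdomain U \<Omega>"
    and lim: "\<And>\<phi>. \<phi> \<in> test_functions U \<Longrightarrow> (\<lambda>n. T n \<phi>) \<longlonglongrightarrow> T' \<phi>"
    and \<theta>: "\<And>n. \<theta> n \<in> test_functions U" "\<And>n. H1_norm U (\<theta> n) \<le> B"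
  shows "(\<lambda>n. T n (\<theta> n) - T' (\<theta> n)) \<longlonglongrightarrow> 0"
proof -
  have topsp: "topspace (Hneg1_loc_topology \<Omega>) \<subseteq> Hneg1_loc \<Omega>"
    unfolding Hneg1_loc_topology_def topology_generated_by_topspace by auto
  have KH: "K \<subseteq> Hneg1_loc \<Omega>" using compactin_subset_topspace[OF K] topsp by blast
  have Uo: "open U" "U \<subseteq> \<Omega>" using U closure_subset by (auto simp: inner_subdomain_def)
  then have Us: "U \<in> sets lebesgue" by auto
  have H: "in_Hneg1 U S" "linear_functional \<Omega> S" if "S \<in> Hneg1_loc \<Omega>" for S
    using that U by (auto simp: Hneg1_loc_def distribution_def)
  have T\<Omega>: "\<phi> \<in> test_functions \<Omega>" if "\<phi> \<in> test_functions U" for \<phi>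
    using that Uo by (auto simp: test_functions_iff)
  have scale: "S (\<lambda>x. c * \<phi> x) = c * S \<phi>" if "S \<in> Hneg1_loc \<Omega>" "\<phi> \<in> test_functions U" for S c \<phi>
    using H(2)[OF that(1)] T\<Omega>[OF that(2)] by (simp add: linear_functional_def)
  \<comment> \<open>\<open>T'\<close> is known only as a pointwise limit, from which it inherits
    homogeneity on test functions of \<open>U\<close>.\<close>
  have scale': "T' (\<lambda>x. c * \<phi> x) = c * T' \<phi>" if "\<phi> \<in> test_functions U" for c \<phi>
  proof -
    have "(\<lambda>n. T n (\<lambda>x. c * \<phi> x)) \<longlonglongrightarrow> c * T' \<phi>"
      using tendsto_mult_left[OF lim[OF that], of c] scale[OF _ that] KH TK by (simp add: subset_iff)
    with lim[OF test_cmult[OF that]] show ?thesis by (rule LIMSEQ_unique)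
  qed
  have unit: "\<forall>\<^sub>F n in sequentially. \<forall>\<phi>\<in>test_functions U. H1_norm U \<phi> \<le> 1 \<longrightarrow> \<bar>T n \<phi> - T' \<phi>\<bar> \<le> 2 * r"
    if r: "r > 0" for r
  proof -
    define ball where "ball S = {S' \<in> Hneg1_loc \<Omega>. Hneg1_norm U (S' - S) < r}" for S
    have op: "openin (Hneg1_loc_topology \<Omega>) (ball S)" if "S \<in> Hneg1_loc \<Omega>" for S
      unfolding Hneg1_loc_topology_def ball_def using U that r by (intro topology_generated_by_Basis) blast
    have self: "S \<in> ball S" if "S \<in> Hneg1_loc \<Omega>" for S
    proof -
      \<comment> \<open>The supremum of zeros is 0 only over a nonempty set, and the zero function
        is in it.\<close>
      have "(\<lambda>x. 0) \<in> {\<phi> \<in> test_functions U. H1_norm U \<phi> \<le> 1}"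
        by (simp add: test_zero H1_norm_def partial_deriv_const)
      then have "{\<phi> \<in> test_functions U. H1_norm U \<phi> \<le> 1} \<noteq> {}" by blast
      from cSUP_const[OF this, of "0::real"] have "Hneg1_norm U (S - S) = 0"
        unfolding Hneg1_norm_def by simp
      then show ?thesis using that r by (simp add: ball_def)
    qed
    have "K \<subseteq> \<Union> (ball ` Hneg1_loc \<Omega>)" using self KH by blast
    then obtain F where F: "finite F" "F \<subseteq> ball ` Hneg1_loc \<Omega>" "K \<subseteq> \<Union> F"
      using K op unfolding compactin_def by (metis (no_types, lifting) imageE)
    have "\<forall>\<^sub>F n in sequentially. T n \<in> W \<longrightarrow> (\<forall>\<phi>\<in>test_functions U. H1_norm U \<phi> \<le> 1 \<longrightarrow> \<bar>T n \<phi> - T' \<phi>\<bar> \<le> 2 * r)"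
      if WF: "W \<in> F" for W
    \<comment> \<open>A ball visited only finitely often imposes nothing for large \<open>n\<close>.
      If it is visited infinitely often, closeness to its centre \<open>S\<close> passes to the
      pointwise limit \<open>T'\<close>, and the triangle inequality through \<open>S\<close> yields
      \<open>2 * r\<close>.\<close>
    proof (cases "\<exists>\<^sub>F n in sequentially. T n \<in> W")
      case True
      obtain S where S: "S \<in> Hneg1_loc \<Omega>" "W = ball S" using F(2) WF by blast
      have near: "\<bar>T n \<phi> - S \<phi>\<bar> \<le> r" if "T n \<in> W" "\<phi> \<in> test_functions U" "H1_norm U \<phi> \<le> 1" for n \<phi>
        using Hneg1_ball_bound[OF H(1) H(1)[OF S(1)] that(2,3), of "T n"] that(1) S by (auto simp: ball_def)
      have "\<bar>T' \<phi> - S \<phi>\<bar> \<le> r" if \<phi>: "\<phi> \<in> test_functions U" "H1_norm U \<phi> \<le> 1" for \<phi>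
      proof (rule ccontr)
        assume "\<not> \<bar>T' \<phi> - S \<phi>\<bar> \<le> r"
        moreover have "(\<lambda>n. \<bar>T n \<phi> - S \<phi>\<bar>) \<longlonglongrightarrow> \<bar>T' \<phi> - S \<phi>\<bar>" by (intro tendsto_intros lim \<phi>)
        ultimately have "\<forall>\<^sub>F n in sequentially. \<bar>T n \<phi> - S \<phi>\<bar> > r" by (intro order_tendstoD(1)) auto
        then have "\<forall>\<^sub>F n in sequentially. T n \<notin> W" by eventually_elim (use near \<phi> in force)
        with True show False by (simp add: frequently_def)
      qed
      then have "T n \<in> W \<longrightarrow> (\<forall>\<phi>\<in>test_functions U. H1_norm U \<phi> \<le> 1 \<longrightarrow> \<bar>T n \<phi> - T' \<phi>\<bar> \<le> 2 * r)" for n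
        using near by (smt (verit))
      then show ?thesis by simp
    next
      case False
      then show ?thesis by (auto simp: frequently_def elim: eventually_mono)
    qed
    then have "\<forall>\<^sub>F n in sequentially. \<forall>W\<in>F. T n \<in> W \<longrightarrow> (\<forall>\<phi>\<in>test_functions U. H1_norm U \<phi> \<le> 1 \<longrightarrow> \<bar>T n \<phi> - T' \<phi>\<bar> \<le> 2 * r)"
      using F(1) by (intro eventually_ball_finite) auto
    then show ?thesis by eventually_elim (use F(3) TK in blast)
  qed
  have nn: "H1_norm U \<phi> \<ge> 0" for \<phi>
    by (auto simp: H1_norm_def intro!: integral_nonneg_AE add_nonneg_nonneg sum_nonneg)
  have B: "B \<ge> 0" using \<theta>(2) nn order_trans by blast
  \<comment> \<open>This factor scales every \<open>\<theta> n\<close> into the unit ball of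
    \<open>H1_norm U\<close>; \<open>B + 1\<close> allows \<open>B = 0\<close>.\<close>
  define c where "c = 1 / (B + 1)"
  have c: "c > 0" using B by (simp add: c_def)
  show ?thesis
  proof (rule LIMSEQ_I)
    fix e :: real assume e: "e > 0"
    have "c * e / 4 > 0" using c e by simp
    from unit[OF this] have "\<forall>\<^sub>F n in sequentially. norm (T n (\<theta> n) - T' (\<theta> n) - 0) < e"
    proof eventually_elim
      case (elim n)
      have ct: "(\<lambda>x. c * \<theta> n x) \<in> test_functions U" by (intro test_cmult \<theta>)
      have "H1_norm U (\<lambda>x. c * \<theta> n x) = c * H1_norm U (\<theta> n)"
      proof -
        have "H1 (\<lambda>x. c * \<theta> n x) = c\<^sup>2 * H1 (\<theta> n)"
          by (simp add: H1_def partial_cmult[OF test_smooth[OF \<theta>(1)]] ip_cmult_left ip_cmult_right power2_eq_square algebra_simps sum_distrib_left)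
        then show ?thesis using c by (simp add: H1_norm_eq[OF Us] \<theta> ct real_sqrt_mult)
      qed
      also have "\<dots> \<le> c * (B + 1)" using c \<theta>(2)[of n] by (intro mult_left_mono) auto
      also have "\<dots> = 1" using B by (simp add: c_def)
      finally have "\<bar>T n (\<lambda>x. c * \<theta> n x) - T' (\<lambda>x. c * \<theta> n x)\<bar> \<le> c * e / 2" using elim ct by auto
      moreover have "T n (\<lambda>x. c * \<theta> n x) - T' (\<lambda>x. c * \<theta> n x) = c * (T n (\<theta> n) - T' (\<theta> n))"
        using scale[OF _ \<theta>(1)] scale'[OF \<theta>(1)] KH TK by (simp add: subset_iff right_diff_distrib)
      ultimately have "c * \<bar>T n (\<theta> n) - T' (\<theta> n)\<bar> \<le> c * (e / 2)" using c by (simp add: abs_mult)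
      then have "\<bar>T n (\<theta> n) - T' (\<theta> n)\<bar> \<le> e / 2" using c by simp
      then show ?case using e by simp
    qed
    then show "\<exists>N. \<forall>n\<ge>N. norm (T n (\<theta> n) - T' (\<theta> n) - 0) < e" by (simp add: eventually_sequentially)
  qed
qed


section \<open>The div-curl lemma on a domain\<close>

text \<open>Weak convergence is tested against the limit itself, and Cauchy-Schwarz is divided by
  the norm of the limit.\<close>

lemma weakly_L2_nrm_le:
  assumes w: "weakly_L2 M f f'" and C: "\<And>n. nrm M (f n) \<le> C"
  shows "nrm M f' \<le> C"
proof (cases "nrm M f' = 0")
  case True
  then show ?thesis using order_trans[OF nrm_nonneg C] by simp
next
  case False
  then have pos: "nrm M f' > 0" using nrm_nonneg[of M f'] by linarith
  have f: "f n \<in> L2 M" "f' \<in> L2 M" for n using w by (auto simp: weakly_L2_def)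
  have "(\<lambda>n. ip M (f n) f') \<longlonglongrightarrow> ip M f' f'" using w f by (auto simp: weakly_L2_def)
  moreover have "ip M (f n) f' \<le> C * nrm M f'" for n
    using L2_Cauchy_Schwarz[OF f, of n] mult_right_mono[OF C nrm_nonneg, of n M f'] by linarith
  ultimately have "ip M f' f' \<le> C * nrm M f'" by (intro LIMSEQ_le_const2) auto
  then have "nrm M f' * nrm M f' \<le> C * nrm M f'" by (simp add: power2_eq_square flip: nrm_sq)
  then show ?thesis using pos by simp
qed

text \<open>The weak limit obeys the same bound as the sequence, hence the factor 2 for the
  difference.\<close>

lemma null_seq_zero_ext:
  fixes w :: "nat \<Rightarrow> real ^ 'd \<Rightarrow> real"
  assumes \<Omega>: "\<Omega> \<in> sets lebesgue" and w: "weakly_L2 (lebesgue_on \<Omega>) w w'"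
    and C: "\<And>n. nrm (lebesgue_on \<Omega>) (w n) \<le> C"
  shows "null_seq (2 * C) (\<lambda>n. zero_ext \<Omega> (\<lambda>x. w n x - w' x))"
  unfolding null_seq_def
proof (intro conjI allI ballI)
  have wL: "w n \<in> L2 (lebesgue_on \<Omega>)" "w' \<in> L2 (lebesgue_on \<Omega>)" for n using w by (auto simp: weakly_L2_def)
  show "zero_ext \<Omega> (\<lambda>x. w n x - w' x) \<in> L2 lebesgue" for n
    by (intro zero_ext_L2 \<Omega> L2_diff wL)
  have "nrm lebesgue (zero_ext \<Omega> (\<lambda>x. w n x - w' x)) = nrm (lebesgue_on \<Omega>) (\<lambda>x. w n x - w' x)" for n
    by (simp add: nrm_def ip_zero_ext(2)[OF \<Omega>])
  then show "nrm lebesgue (zero_ext \<Omega> (\<lambda>x. w n x - w' x)) \<le> 2 * C" for n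
    using nrm_triangle_diff[OF wL, of n] C[of n] weakly_L2_nrm_le[OF w C] by simp
  fix \<psi> :: "real ^ 'd \<Rightarrow> real" assume "\<psi> \<in> L2 lebesgue"
  then have \<psi>: "\<psi> \<in> L2 (lebesgue_on \<Omega>)" by (rule L2_restrict[OF \<Omega>])
  have "(\<lambda>n. ip (lebesgue_on \<Omega>) (w n) \<psi> - ip (lebesgue_on \<Omega>) w' \<psi>) \<longlonglongrightarrow> ip (lebesgue_on \<Omega>) w' \<psi> - ip (lebesgue_on \<Omega>) w' \<psi>"
    using w \<psi> by (intro tendsto_intros) (auto simp: weakly_L2_def)
  then show "(\<lambda>n. ip lebesgue (zero_ext \<Omega> (\<lambda>x. w n x - w' x)) \<psi>) \<longlonglongrightarrow> 0"
    by (simp add: ip_zero_ext(1)[OF \<Omega>] ip_diff_left wL \<psi>)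
qed

text \<open>Weak convergence of the fields identifies the pointwise limit of their curls as the curl
  of \<open>w'\<close>; compactness then upgrades this to convergence against bounded, moving test
  functions.\<close>

lemma curl_null_zero_ext:
  fixes w :: "nat \<Rightarrow> 'd \<Rightarrow> real ^ 'd \<Rightarrow> real"
  assumes \<Omega>: "\<Omega> \<in> sets lebesgue" and U: "inner_subdomain U \<Omega>"
    and w: "\<And>i. weakly_L2 (lebesgue_on \<Omega>) (\<lambda>n. w n i) (w' i)"
    and K: "\<And>k l. \<exists>K. compactin (Hneg1_loc_topology \<Omega>) K \<and> (\<forall>n. curl_dist \<Omega> k (w n l) l (w n k) \<in> K)"
  shows "curl_null U (\<lambda>n i. zero_ext \<Omega> (\<lambda>x. w n i x - w' i x))"
  unfolding curl_null_def
proof (intro allI impI)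
  fix \<theta> :: "nat \<Rightarrow> real ^ 'd \<Rightarrow> real" and B k l
  assume \<theta>': "\<forall>n. \<theta> n \<in> test_functions U \<and> H1 (\<theta> n) \<le> B"
  then have \<theta>: "\<theta> n \<in> test_functions U" for n by blast
  have wL: "w n i \<in> L2 (lebesgue_on \<Omega>)" "w' i \<in> L2 (lebesgue_on \<Omega>)" for n i
    using w by (auto simp: weakly_L2_def)
  have Uo: "open U" "U \<subseteq> \<Omega>" using U closure_subset by (auto simp: inner_subdomain_def)
  then have Us: "U \<in> sets lebesgue" by auto
  have t\<Omega>: "\<phi> \<in> test_functions \<Omega>" if "\<phi> \<in> test_functions U" for \<phi>
    using that Uo by (auto simp: test_functions_iff)
  note pL = test_L2_on[OF \<Omega> test_partial]
  obtain K where K: "compactin (Hneg1_loc_topology \<Omega>) K" "\<And>n. curl_dist \<Omega> k (w n l) l (w n k) \<in> K"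
    using K[of k l] by blast
  have lim: "(\<lambda>n. curl_dist \<Omega> k (w n l) l (w n k) \<phi>) \<longlonglongrightarrow> curl_dist \<Omega> k (w' l) l (w' k) \<phi>"
    if "\<phi> \<in> test_functions U" for \<phi>
    unfolding curl_dist_eq[OF t\<Omega>[OF that]]
    using w pL[OF that] by (intro tendsto_diff) (auto simp: weakly_L2_def)
  have "H1_norm U (\<theta> n) \<le> sqrt B" for n
    using \<theta>' by (simp add: H1_norm_eq[OF Us])
  from Hneg1_compact_convergence[OF K U lim \<theta> this]
  have "(\<lambda>n. curl_dist \<Omega> k (w n l) l (w n k) (\<theta> n) - curl_dist \<Omega> k (w' l) l (w' k) (\<theta> n)) \<longlonglongrightarrow> 0" .
  from tendsto_minus[OF this]
  show "(\<lambda>n. ip lebesgue (zero_ext \<Omega> (\<lambda>x. w n l x - w' l x)) (partial_deriv k (\<theta> n))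
      - ip lebesgue (zero_ext \<Omega> (\<lambda>x. w n k x - w' k x)) (partial_deriv l (\<theta> n))) \<longlonglongrightarrow> 0"
    unfolding curl_dist_eq[OF t\<Omega>[OF \<theta>]]
    by (simp add: ip_zero_ext(1)[OF \<Omega>] ip_diff_left wL pL[OF \<theta>] algebra_simps)
qed

text \<open>The data that the div-curl lemma asks of one vector field. The index \<open>i\<close> is
  the one in which the curl is taken; for a tensor the other indices are fixed parameters.\<close>

locale weak_curl_compact =
  fixes \<Omega> :: "(real ^ 'd) set" and w :: "nat \<Rightarrow> 'd \<Rightarrow> real ^ 'd \<Rightarrow> real" and w' :: "'d \<Rightarrow> real ^ 'd \<Rightarrow> real"
    and C :: real
  assumes open_domain: "open \<Omega>"
    and weak: "\<And>i. weakly_L2 (lebesgue_on \<Omega>) (\<lambda>n. w n i) (w' i)"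
    and bound: "\<And>n i. nrm (lebesgue_on \<Omega>) (w n i) \<le> C"
    and compact_curl: "\<And>k l. \<exists>K. compactin (Hneg1_loc_topology \<Omega>) K \<and> (\<forall>n. curl_dist \<Omega> k (w n l) l (w n k) \<in> K)"
begin

lemma domain_sets: "\<Omega> \<in> sets lebesgue"
  using open_domain by auto

lemma field_L2: "w n i \<in> L2 (lebesgue_on \<Omega>)" "w' i \<in> L2 (lebesgue_on \<Omega>)"
  using weak by (auto simp: weakly_L2_def)

lemma limit_bound: "nrm (lebesgue_on \<Omega>) (w' i) \<le> C"
  using weakly_L2_nrm_le[OF weak bound] .

end

text \<open>Both factors are split into limit plus difference. Terms containing a limit factor
  converge by weak convergence, as the cutoffs can be absorbed into that factor; the antisymmetric
  product of the two differences is \<open>div_curl_null\<close>.\<close>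

lemma div_curl_test_product:
  fixes u v :: "nat \<Rightarrow> 'd \<Rightarrow> real ^ 'd \<Rightarrow> real"
  assumes u: "weak_curl_compact \<Omega> u u' C" and v: "weak_curl_compact \<Omega> v v' C"
    and U: "inner_subdomain U \<Omega>" and \<phi>: "\<phi> \<in> test_functions U" and \<psi>: "\<psi> \<in> test_functions U"
  shows "(\<lambda>n. \<integral>x. (\<phi> x * \<psi> x) * (u n k x * v n l x - u n l x * v n k x) \<partial>lebesgue_on \<Omega>)
    \<longlonglongrightarrow> (\<integral>x. (\<phi> x * \<psi> x) * (u' k x * v' l x - u' l x * v' k x) \<partial>lebesgue_on \<Omega>)"
proof -
  interpret u: weak_curl_compact \<Omega> u u' C by (rule u)
  interpret v: weak_curl_compact \<Omega> v v' C by (rule v)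
  note \<Omega> = u.domain_sets
  define M where "M = lebesgue_on \<Omega>"
  obtain B1 where B1: "B1 > 0" "\<And>x. \<bar>\<phi> x\<bar> \<le> B1" using test_bounded[OF \<phi>] by blast
  obtain B2 where B2: "B2 > 0" "\<And>x. \<bar>\<psi> x\<bar> \<le> B2" using test_bounded[OF \<psi>] by blast
  have m: "\<phi> \<in> borel_measurable M" "\<psi> \<in> borel_measurable M"
    unfolding M_def using test_L2_on[OF \<Omega> \<phi>] test_L2_on[OF \<Omega> \<psi>] L2_measurable by blast+
  have \<phi>L: "(\<lambda>x. \<phi> x * f x) \<in> L2 M" if "f \<in> L2 M" for f by (rule L2_mult_bounded[OF that m(1) B1(2)])
  have \<psi>L: "(\<lambda>x. \<psi> x * f x) \<in> L2 M" if "f \<in> L2 M" for f by (rule L2_mult_bounded[OF that m(2) B2(2)])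
  note uL = u.field_L2[folded M_def] and vL = v.field_L2[folded M_def]
  define P where "P f g = ip M (\<lambda>x. \<phi> x * f x) (\<lambda>x. \<psi> x * g x)" for f g
  have P_int: "P f g - P f' g' = (\<integral>x. (\<phi> x * \<psi> x) * (f x * g x - f' x * g' x) \<partial>M)"
    if "f \<in> L2 M" "g \<in> L2 M" "f' \<in> L2 M" "g' \<in> L2 M" for f g f' g'
  proof -
    have "P f g - P f' g' = (\<integral>x. (\<phi> x * f x) * (\<psi> x * g x) - (\<phi> x * f' x) * (\<psi> x * g' x) \<partial>M)"
      unfolding P_def ip_def
      by (rule Bochner_Integration.integral_diff[symmetric]) (intro L2_integrable_mult \<phi>L \<psi>L that)+
    also have "\<dots> = (\<integral>x. (\<phi> x * \<psi> x) * (f x * g x - f' x * g' x) \<partial>M)"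
      by (intro Bochner_Integration.integral_cong) (auto simp: algebra_simps)
    finally show ?thesis .
  qed
  have P_split: "P f g = P (\<lambda>x. f x - f' x) (\<lambda>x. g x - g' x) + P f' g + P f g' - P f' g'"
    if "f \<in> L2 M" "g \<in> L2 M" "f' \<in> L2 M" "g' \<in> L2 M" for f g f' g'
  proof -
    have "P (\<lambda>x. f x - f' x) (\<lambda>x. g x - g' x)
        = ip M (\<lambda>x. \<phi> x * f x - \<phi> x * f' x) (\<lambda>x. \<psi> x * g x - \<psi> x * g' x)"
      by (simp add: P_def right_diff_distrib)
    also have "\<dots> = (P f g - P f g') - (P f' g - P f' g')"
      unfolding P_def using that by (simp add: ip_diff_left ip_diff_right \<phi>L \<psi>L L2_diff)
    finally show ?thesis by simp
  qed
  have lim1: "(\<lambda>n. P (u' i) (v n j)) \<longlonglongrightarrow> P (u' i) (v' j)" for i j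
  proof -
    have "P (u' i) g = ip M g (\<lambda>x. \<psi> x * (\<phi> x * u' i x))" for g by (simp add: P_def ip_def mult_ac)
    moreover have "(\<lambda>n. ip M (v n j) (\<lambda>x. \<psi> x * (\<phi> x * u' i x))) \<longlonglongrightarrow> ip M (v' j) (\<lambda>x. \<psi> x * (\<phi> x * u' i x))"
      using v.weak[of j] \<psi>L[OF \<phi>L[OF uL(2)[of i]]] unfolding weakly_L2_def M_def by blast
    ultimately show ?thesis by simp
  qed
  have lim2: "(\<lambda>n. P (u n i) (v' j)) \<longlonglongrightarrow> P (u' i) (v' j)" for i j
  proof -
    have "P f (v' j) = ip M f (\<lambda>x. \<phi> x * (\<psi> x * v' j x))" for f by (simp add: P_def ip_def mult_ac)
    moreover have "(\<lambda>n. ip M (u n i) (\<lambda>x. \<phi> x * (\<psi> x * v' j x))) \<longlonglongrightarrow> ip M (u' i) (\<lambda>x. \<phi> x * (\<psi> x * v' j x))"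
      using u.weak[of i] \<phi>L[OF \<psi>L[OF vL(2)[of j]]] unfolding weakly_L2_def M_def by blast
    ultimately show ?thesis by simp
  qed
  define Z where "Z n i j = P (\<lambda>x. u n i x - u' i x) (\<lambda>x. v n j x - v' j x)" for n i j
  have Z_eq: "Z n i j = ip lebesgue (\<lambda>x. \<phi> x * zero_ext \<Omega> (\<lambda>x. u n i x - u' i x) x) (\<lambda>x. \<psi> x * zero_ext \<Omega> (\<lambda>x. v n j x - v' j x) x)" for n i j
  proof -
    have "(\<lambda>x. \<phi> x * zero_ext \<Omega> f x) = zero_ext \<Omega> (\<lambda>x. \<phi> x * f x)" "(\<lambda>x. \<psi> x * zero_ext \<Omega> f x) = zero_ext \<Omega> (\<lambda>x. \<psi> x * f x)" for f
      by (auto simp: zero_ext_def)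
    then show ?thesis by (simp add: Z_def P_def M_def ip_zero_ext(2)[OF \<Omega>])
  qed
  have lim0: "(\<lambda>n. Z n k l - Z n l k) \<longlonglongrightarrow> 0"
    unfolding Z_eq
    by (rule div_curl_null[OF null_seq_zero_ext[OF \<Omega> u.weak u.bound] curl_null_zero_ext[OF \<Omega> U u.weak u.compact_curl]
        null_seq_zero_ext[OF \<Omega> v.weak v.bound] curl_null_zero_ext[OF \<Omega> U v.weak v.compact_curl] \<phi> \<psi>])
  have "(\<lambda>n. (Z n k l - Z n l k) + (P (u' k) (v n l) + P (u n k) (v' l) - P (u' k) (v' l))
        - (P (u' l) (v n k) + P (u n l) (v' k) - P (u' l) (v' k)))
      \<longlonglongrightarrow> 0 + (P (u' k) (v' l) + P (u' k) (v' l) - P (u' k) (v' l)) - (P (u' l) (v' k) + P (u' l) (v' k) - P (u' l) (v' k))"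
    by (intro tendsto_intros lim0 lim1 lim2)
  moreover have "(Z n k l - Z n l k) + (P (u' k) (v n l) + P (u n k) (v' l) - P (u' k) (v' l))
        - (P (u' l) (v n k) + P (u n l) (v' k) - P (u' l) (v' k)) = P (u n k) (v n l) - P (u n l) (v n k)" for n
    using P_split[OF uL(1) vL(1) uL(2) vL(2), of n k n l k l] P_split[OF uL(1) vL(1) uL(2) vL(2), of n l n k l k]
    by (simp add: Z_def)
  ultimately have "(\<lambda>n. P (u n k) (v n l) - P (u n l) (v n k)) \<longlonglongrightarrow> P (u' k) (v' l) - P (u' l) (v' k)" by simp
  then show ?thesis by (simp add: P_int uL vL flip: M_def)
qed

text \<open>Compactness selects finitely many open boxes covering \<open>K\<close> with closures in
  \<Omega>; their bumps are nonnegative, so they add up without cancellation.\<close>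

lemma positive_test_function:
  assumes "open \<Omega>" "compact K" "K \<subseteq> \<Omega>"
  obtains S where "S \<in> test_functions \<Omega>" "\<And>x. x \<in> K \<Longrightarrow> S x > 0"
proof -
  have "\<forall>x\<in>K. \<exists>c. cbox (fst c) (snd c) \<subseteq> \<Omega> \<and> x \<in> box (fst c) (snd c)"
  proof
    fix x assume "x \<in> K"
    then have "x \<in> \<Omega>" using assms(3) by blast
    from open_contains_cbox[OF assms(1) this] obtain a b where "cbox a b \<subseteq> \<Omega>" "x \<in> box a b" .
    then show "\<exists>c. cbox (fst c) (snd c) \<subseteq> \<Omega> \<and> x \<in> box (fst c) (snd c)" by (intro exI[of _ "(a, b)"]) simp
  qed
  then obtain c where c: "\<forall>x\<in>K. cbox (fst (c x)) (snd (c x)) \<subseteq> \<Omega> \<and> x \<in> box (fst (c x)) (snd (c x))"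
    by (rule bchoice[THEN exE])
  define a b where "a x = fst (c x)" and "b x = snd (c x)" for x
  have ab: "\<And>x. x \<in> K \<Longrightarrow> cbox (a x) (b x) \<subseteq> \<Omega>" "\<And>x. x \<in> K \<Longrightarrow> x \<in> box (a x) (b x)"
    using c by (auto simp: a_def b_def)
  have "K \<subseteq> (\<Union>x\<in>K. box (a x) (b x))" using ab by blast
  moreover have "open (box (a x) (b x))" for x by (rule open_box)
  ultimately obtain F where F: "F \<subseteq> K" "finite F" "K \<subseteq> (\<Union>x\<in>F. box (a x) (b x))"
    using compactE_image[OF assms(2), of K "\<lambda>x. box (a x) (b x)" thesis] by meson
  show ?thesis
  proof (rule that[of "\<lambda>y. \<Sum>x\<in>F. box_bump (a x) (b x) y"])
    show "(\<lambda>y. \<Sum>x\<in>F. box_bump (a x) (b x) y) \<in> test_functions \<Omega>"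
      using F ab by (intro test_sum box_bump_test) blast
    fix y assume "y \<in> K"
    then obtain x where "x \<in> F" "y \<in> box (a x) (b x)" using F by blast
    then show "(\<Sum>x\<in>F. box_bump (a x) (b x) y) > 0"
      using F by (intro sum_pos2[of F x] box_bump_pos box_bump_nonneg)
  qed
qed

lemma inner_subdomain_around:
  assumes "open \<Omega>" "compact K" "K \<subseteq> \<Omega>"
  obtains U where "inner_subdomain U \<Omega>" "K \<subseteq> U"
proof -
  obtain S where S: "S \<in> test_functions \<Omega>" "\<And>x. x \<in> K \<Longrightarrow> S x > 0" using positive_test_function[OF assms] by blast
  have "open {x. S x \<noteq> 0}"
    using smooth_continuous[OF test_smooth[OF S(1)], of UNIV] by (intro open_Collect_neq continuous_on_const)
  moreover have "closure {x. S x \<noteq> 0} = support S" by (simp add: support_def)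
  ultimately show ?thesis
    using S by (intro that[of "{x. S x \<noteq> 0}"]) (force simp: inner_subdomain_def test_functions_iff)+
qed

text \<open>The products \<open>P n\<close> are bounded in \<open>L\<^sup>1\<close> only, which is
  why the multipliers have to be approximated uniformly.\<close>

lemma tendsto_integral_uniform_approx:
  fixes P :: "nat \<Rightarrow> 'a \<Rightarrow> real" and P' f :: "'a \<Rightarrow> real"
  assumes P: "\<And>n. integrable M (P n)" "integrable M P'" and D: "\<And>n. (\<integral>x. \<bar>P n x\<bar> \<partial>M) \<le> D" "(\<integral>x. \<bar>P' x\<bar> \<partial>M) \<le> D"
    and f: "f \<in> borel_measurable M" "\<And>x. \<bar>f x\<bar> \<le> B"
    and approx: "\<And>e. e > 0 \<Longrightarrow> \<exists>g. g \<in> borel_measurable M \<and> (\<forall>x. \<bar>f x - g x\<bar> \<le> e) \<and>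
       (\<lambda>n. \<integral>x. g x * P n x \<partial>M) \<longlonglongrightarrow> (\<integral>x. g x * P' x \<partial>M)"
  shows "(\<lambda>n. \<integral>x. f x * P n x \<partial>M) \<longlonglongrightarrow> (\<integral>x. f x * P' x \<partial>M)"
proof (rule LIMSEQ_I)
  fix e :: real assume e: "e > 0"
  have int: "integrable M (\<lambda>x. g x * Q x)" if "g \<in> borel_measurable M" "\<And>x. \<bar>g x\<bar> \<le> b" "integrable M Q" for g Q :: "_ \<Rightarrow> real" and b
  proof (rule Bochner_Integration.integrable_bound)
    show "integrable M (\<lambda>x. b * Q x)" using that by simp
    show "(\<lambda>x. g x * Q x) \<in> borel_measurable M" using that by (intro borel_measurable_times) auto
    have "\<bar>g x\<bar> \<le> \<bar>b\<bar>" for x using that(2)[of x] by linarith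
    then show "AE x in M. norm (g x * Q x) \<le> norm (b * Q x)" by (simp add: abs_mult mult_right_mono)
  qed
  have "0 \<le> (\<integral>x. \<bar>P' x\<bar> \<partial>M)" by simp
  then have D0: "D \<ge> 0" using D(2) by linarith
  \<comment> \<open>Replacing \<open>f\<close> by \<open>g\<close> costs at most
    \<open>e / 4\<close>, once for \<open>P n\<close> and once for the limit; convergence with
    \<open>g\<close> takes another \<open>e / 4\<close>.\<close>
  define r where "r = e / (4 * (D + 1))"
  have r: "r > 0" using e D0 by (simp add: r_def)
  obtain g where g: "g \<in> borel_measurable M" "\<And>x. \<bar>f x - g x\<bar> \<le> r"
    "(\<lambda>n. \<integral>x. g x * P n x \<partial>M) \<longlonglongrightarrow> (\<integral>x. g x * P' x \<partial>M)" using approx[OF r] by blast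
  have gb: "\<bar>g x\<bar> \<le> B + r" for x using g(2)[of x] f(2)[of x] by linarith
  have close: "\<bar>(\<integral>x. f x * Q x \<partial>M) - (\<integral>x. g x * Q x \<partial>M)\<bar> \<le> e / 4" if "integrable M Q" "(\<integral>x. \<bar>Q x\<bar> \<partial>M) \<le> D" for Q
  proof -
    have "(\<integral>x. f x * Q x \<partial>M) - (\<integral>x. g x * Q x \<partial>M) = (\<integral>x. (f x - g x) * Q x \<partial>M)"
      using int[OF f that(1)] int[OF g(1) gb that(1)] by (simp add: left_diff_distrib)
    also have "norm \<dots> \<le> (\<integral>x. r * \<bar>Q x\<bar> \<partial>M)"
    proof (rule order_trans[OF integral_norm_bound integral_mono])
      show "integrable M (\<lambda>x. norm ((f x - g x) * Q x))"
        using int[OF f that(1)] int[OF g(1) gb that(1)] by (simp add: left_diff_distrib)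
      show "norm ((f x - g x) * Q x) \<le> r * \<bar>Q x\<bar>" for x using g(2)[of x] by (simp add: abs_mult mult_right_mono)
    qed (use that in simp)
    also have "\<dots> \<le> r * D" using that r by (simp add: mult_left_mono)
    also have "\<dots> \<le> r * (D + 1)" using r by simp
    also have "\<dots> = e / 4"
    proof -
      have *: "e / (4 * X) * X = e / 4" if "X > 0" for X :: real using that by simp
      show ?thesis unfolding r_def by (rule *) (use D0 in simp)
    qed
    finally show ?thesis by simp
  qed
  have "\<forall>\<^sub>F n in sequentially. dist (\<integral>x. g x * P n x \<partial>M) (\<integral>x. g x * P' x \<partial>M) < e / 4"
    using tendstoD[OF g(3), of "e / 4"] e by simp
  then have "\<forall>\<^sub>F n in sequentially. norm ((\<integral>x. f x * P n x \<partial>M) - (\<integral>x. f x * P' x \<partial>M)) < e"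
  proof eventually_elim
    case (elim n)
    then show ?case using close[OF P(1) D(1), of n] close[OF P(2) D(2)] e unfolding dist_real_def real_norm_def by linarith
  qed
  then show "\<exists>N. \<forall>n\<ge>N. norm ((\<integral>x. f x * P n x \<partial>M) - (\<integral>x. f x * P' x \<partial>M)) < e"
    by (simp add: eventually_sequentially)
qed

lemma continuous_compact_support_bounded:
  fixes f :: "'a::euclidean_space \<Rightarrow> real"
  assumes "continuous_on \<Omega> f" "compact K" "K \<subseteq> \<Omega>" "\<And>x. x \<notin> K \<Longrightarrow> f x = 0"
  obtains B where "B \<ge> 0" "\<And>x. \<bar>f x\<bar> \<le> B"
proof -
  have "compact (f ` K)" using assms by (intro compact_continuous_image continuous_on_subset[OF assms(1)])
  then obtain B where B: "B > 0" "\<And>y. y \<in> f ` K \<Longrightarrow> norm y \<le> B" using compact_imp_bounded[of "f ` K"] unfolding bounded_pos by blast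
  have "\<bar>f x\<bar> \<le> B" for x using B assms(4)[of x] by (cases "x \<in> K") auto
  then show ?thesis using B(1) by (intro that[of B]) auto
qed

text \<open>A continuous multiplier with compact support is a uniform limit of products \<open>S (S q)\<close> with
  \<open>S\<close> a test function positive on the support and \<open>q\<close> a polynomial approximating \<open>f / S\<^sup>2\<close>. This
  provides the two separate cutoffs that the preceding lemma asks for.\<close>

lemma div_curl:
  fixes u v :: "nat \<Rightarrow> 'd \<Rightarrow> real ^ 'd \<Rightarrow> real"
  assumes u: "weak_curl_compact \<Omega> u u' C" and v: "weak_curl_compact \<Omega> v v' C"
    and f: "continuous_on \<Omega> f" "compact K" "K \<subseteq> \<Omega>" "\<And>x. x \<notin> K \<Longrightarrow> f x = 0"
  shows "(\<lambda>n. \<integral>x. f x * (u n k x * v n l x - u n l x * v n k x) \<partial>lebesgue_on \<Omega>)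
    \<longlonglongrightarrow> (\<integral>x. f x * (u' k x * v' l x - u' l x * v' k x) \<partial>lebesgue_on \<Omega>)"
proof -
  interpret u: weak_curl_compact \<Omega> u u' C by (rule u)
  interpret v: weak_curl_compact \<Omega> v v' C by (rule v)
  note \<Omega> = u.domain_sets
  define M where "M = lebesgue_on \<Omega>"
  note uL = u.field_L2[folded M_def] and vL = v.field_L2[folded M_def]
  have C: "C \<ge> 0" using u.limit_bound nrm_nonneg order_trans by blast
  have P: "integrable M (\<lambda>x. a x * d x - b x * c x)" "(\<integral>x. \<bar>a x * d x - b x * c x\<bar> \<partial>M) \<le> 2 * C\<^sup>2"
    if L: "a \<in> L2 M" "b \<in> L2 M" "c \<in> L2 M" "d \<in> L2 M"
      and N: "nrm M a \<le> C" "nrm M b \<le> C" "nrm M c \<le> C" "nrm M d \<le> C" for a b c d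
  proof -
    show i: "integrable M (\<lambda>x. a x * d x - b x * c x)"
      by (intro Bochner_Integration.integrable_diff L2_integrable_mult L)
    have ab: "(\<integral>x. \<bar>p x\<bar> * \<bar>q x\<bar> \<partial>M) \<le> C\<^sup>2" if "p \<in> L2 M" "q \<in> L2 M" "nrm M p \<le> C" "nrm M q \<le> C" for p q
    proof -
      have "ip M (\<lambda>x. \<bar>p x\<bar>) (\<lambda>x. \<bar>q x\<bar>) \<le> nrm M (\<lambda>x. \<bar>p x\<bar>) * nrm M (\<lambda>x. \<bar>q x\<bar>)"
        using L2_Cauchy_Schwarz[OF L2_abs[OF that(1)] L2_abs[OF that(2)]] by linarith
      also have "\<dots> = nrm M p * nrm M q" by (simp add: nrm_def ip_def)
      also have "\<dots> \<le> C\<^sup>2" using that C by (simp add: power2_eq_square mult_mono nrm_nonneg)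
      finally show ?thesis by (simp add: ip_def)
    qed
    have "(\<integral>x. \<bar>a x * d x - b x * c x\<bar> \<partial>M) \<le> (\<integral>x. \<bar>a x\<bar> * \<bar>d x\<bar> + \<bar>b x\<bar> * \<bar>c x\<bar> \<partial>M)"
    proof (rule integral_mono)
      show "integrable M (\<lambda>x. \<bar>a x\<bar> * \<bar>d x\<bar> + \<bar>b x\<bar> * \<bar>c x\<bar>)"
        by (intro Bochner_Integration.integrable_add L2_integrable_mult L2_abs L)
      show "\<bar>a x * d x - b x * c x\<bar> \<le> \<bar>a x\<bar> * \<bar>d x\<bar> + \<bar>b x\<bar> * \<bar>c x\<bar>" for x
        using abs_triangle_ineq4[of "a x * d x" "b x * c x"] by (simp add: abs_mult)
    qed (use i in simp)
    also have "\<dots> = (\<integral>x. \<bar>a x\<bar> * \<bar>d x\<bar> \<partial>M) + (\<integral>x. \<bar>b x\<bar> * \<bar>c x\<bar> \<partial>M)"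
      by (intro Bochner_Integration.integral_add L2_integrable_mult L2_abs L)
    also have "\<dots> \<le> 2 * C\<^sup>2" using ab[OF L(1,4) N(1,4)] ab[OF L(2,3) N(2,3)] by simp
    finally show "(\<integral>x. \<bar>a x * d x - b x * c x\<bar> \<partial>M) \<le> 2 * C\<^sup>2" .
  qed
  note ub = u.bound[folded M_def] and vb = v.bound[folded M_def]
  note ub' = u.limit_bound[folded M_def] and vb' = v.limit_bound[folded M_def]
  obtain B where B: "B \<ge> 0" "\<And>x. \<bar>f x\<bar> \<le> B" using continuous_compact_support_bounded[OF f] by blast
  have fm: "f \<in> borel_measurable M"
    unfolding M_def by (rule continuous_imp_measurable_on_sets_lebesgue[OF f(1) \<Omega>])
  obtain S where S: "S \<in> test_functions \<Omega>" "\<And>x. x \<in> K \<Longrightarrow> S x > 0"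
    using positive_test_function[OF u.open_domain f(2,3)] by blast
  have sS: "compact (support S)" "support S \<subseteq> \<Omega>" using S(1) by (auto simp: test_functions_iff)
  \<comment> \<open>All products of \<open>S\<close> with polynomials are supported in this one
    inner subdomain, whatever the accuracy.\<close>
  obtain U where U: "inner_subdomain U \<Omega>" "support S \<subseteq> U"
    using inner_subdomain_around[OF u.open_domain sS] by blast
  have SU: "S \<in> test_functions U" using test_mono[OF S(1) U(2)] .
  obtain B' where B': "B' > 0" "\<And>x. \<bar>S x\<bar> \<le> B'" using test_bounded[OF S(1)] by blast
  have Scont: "continuous_on A S" for A by (rule smooth_continuous[OF test_smooth[OF S(1)]])
  have KS: "K \<subseteq> support S" using S(2) not_in_support[of _ S] by force
  \<comment> \<open>Off \<open>K\<close> this is 0, also where \<open>S\<close> vanishes, because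
    the numerator is 0. Continuity is checked on the two open sets where \<open>S \<noteq> 0\<close>
    and where \<open>x \<notin> K\<close>; they cover \<Omega> since \<open>S\<close> is positive on
    \<open>K\<close>.\<close>
  define F where "F x = f x / (S x)\<^sup>2" for x
  have F_cont: "continuous_on \<Omega> F"
  proof -
    have "continuous_on (\<Omega> \<inter> {x. S x \<noteq> 0}) F"
      unfolding F_def by (intro continuous_intros continuous_on_subset[OF f(1)] Scont) auto
    moreover have "continuous_on (\<Omega> \<inter> - K) F"
      using f(4) by (auto simp: F_def intro!: continuous_on_eq[OF continuous_on_const[of _ 0]])
    moreover have "open (\<Omega> \<inter> {x. S x \<noteq> 0})" "open (\<Omega> \<inter> - K)"
      using u.open_domain Scont[of UNIV] f(2)
      by (auto intro!: open_Int open_Collect_neq continuous_on_const simp: compact_imp_closed open_Compl)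
    ultimately have "continuous_on ((\<Omega> \<inter> {x. S x \<noteq> 0}) \<union> (\<Omega> \<inter> - K)) F" by (intro continuous_on_open_Un)
    moreover have "(\<Omega> \<inter> {x. S x \<noteq> 0}) \<union> (\<Omega> \<inter> - K) = \<Omega>" using S(2) by force
    ultimately show ?thesis by simp
  qed
  have "(\<lambda>n. \<integral>x. f x * (u n k x * v n l x - u n l x * v n k x) \<partial>M)
    \<longlonglongrightarrow> (\<integral>x. f x * (u' k x * v' l x - u' l x * v' k x) \<partial>M)"
  proof (rule tendsto_integral_uniform_approx[where D="2 * C\<^sup>2", OF P(1) P(1) P(2) P(2) fm B(2)])
    fix e :: real assume e: "e > 0"
    define r where "r = e / B'\<^sup>2"
    have r: "r > 0" using e B' by (simp add: r_def)
    obtain q where q: "real_polynomial_function q" "\<And>x. x \<in> support S \<Longrightarrow> \<bar>F x - q x\<bar> < r"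
      using Stone_Weierstrass_real_polynomial_function[OF sS(1) continuous_on_subset[OF F_cont sS(2)] r] by blast
    have Sq: "(\<lambda>x. S x * q x) \<in> test_functions U" by (rule test_mult_right[OF SU smooth_polynomial[OF q(1)]])
    have "\<bar>f x - S x * (S x * q x)\<bar> \<le> e" for x
    proof (cases "x \<in> support S")
      case True
      have "f x = (S x)\<^sup>2 * F x" using S(2)[of x] f(4)[of x] by (cases "x \<in> K") (auto simp: F_def)
      then have "f x - S x * (S x * q x) = (S x)\<^sup>2 * (F x - q x)"
        by (simp add: power2_eq_square algebra_simps)
      then have "\<bar>f x - S x * (S x * q x)\<bar> = (S x)\<^sup>2 * \<bar>F x - q x\<bar>"
        by (simp add: abs_mult)
      also have "\<dots> \<le> B'\<^sup>2 * r"
        using q(2)[OF True] B' r by (intro mult_mono) (auto simp: abs_le_square_iff[symmetric])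
      also have "\<dots> = e" using B' by (simp add: r_def)
      finally show ?thesis .
    next
      case False
      then have "f x = 0" using KS f(4) by blast
      then show ?thesis using e not_in_support[OF False] by simp
    qed
    moreover have "(\<lambda>x. S x * (S x * q x)) \<in> borel_measurable M"
      unfolding M_def by (intro L2_measurable test_L2_on[OF \<Omega> test_mult_right[OF SU test_smooth[OF Sq]]])
    moreover note div_curl_test_product[OF u v U(1) SU Sq, of k l, folded M_def]
    ultimately show "\<exists>g. g \<in> borel_measurable M \<and> (\<forall>x. \<bar>f x - g x\<bar> \<le> e) \<and>
       (\<lambda>n. \<integral>x. g x * (u n k x * v n l x - u n l x * v n k x) \<partial>M)
         \<longlonglongrightarrow> (\<integral>x. g x * (u' k x * v' l x - u' l x * v' k x) \<partial>M)"
      by blast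
  qed (rule uL vL ub vb ub' vb')+
  then show ?thesis by (simp add: M_def)
qed


section \<open>Coefficients, fields and weak limits\<close>

lemma multiplier_L2:
  fixes f :: "real ^ 'd \<Rightarrow> real"
  assumes \<Omega>: "\<Omega> \<in> sets lebesgue" and f: "continuous_on \<Omega> f" "compact K" "K \<subseteq> \<Omega>" "\<And>x. x \<notin> K \<Longrightarrow> f x = 0"
  shows "f \<in> L2 (lebesgue_on \<Omega>)"
proof -
  obtain B where B: "B \<ge> 0" "\<And>x. \<bar>f x\<bar> \<le> B" using continuous_compact_support_bounded[OF f] by blast
  have "(\<lambda>x. f x * indicator K x) \<in> L2 (lebesgue_on \<Omega>)"
    using f(2) B by (intro L2_mult_bounded[where B=B] L2_restrict[OF \<Omega>] indicator_L2 continuous_imp_measurable_on_sets_lebesgue[OF f(1) \<Omega>])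
      (auto simp: compact_imp_bounded fmeasurableD lmeasurable_compact)
  moreover have "(\<lambda>x. f x * indicator K x) = f" using f(4) by (intro ext) (auto simp: indicator_def)
  ultimately show ?thesis by simp
qed

lemma test_multiplier:
  assumes "\<phi> \<in> test_functions \<Omega>" "continuous_on \<Omega> c"
  shows "continuous_on \<Omega> (\<lambda>x. c x * \<phi> x)" "compact (support \<phi>)" "support \<phi> \<subseteq> \<Omega>"
    "\<And>x. x \<notin> support \<phi> \<Longrightarrow> c x * \<phi> x = 0"
proof -
  show "continuous_on \<Omega> (\<lambda>x. c x * \<phi> x)"
    by (intro continuous_on_mult assms smooth_continuous test_smooth[OF assms(1)])
qed (use assms(1) not_in_support[of _ \<phi>] in \<open>auto simp: test_functions_iff\<close>)

text \<open>A coefficient \<open>c t\<close> that is merely continuous on \<Omega> is absorbed into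
  the multiplier \<open>c t x * \<phi> x\<close>, which has compact support. In this way the inverse
  metric enters the Ricci equation.\<close>

lemma div_curl_sum:
  fixes u v :: "'t \<Rightarrow> nat \<Rightarrow> 'd \<Rightarrow> real ^ 'd \<Rightarrow> real"
  assumes u: "\<And>t. t \<in> A \<Longrightarrow> weak_curl_compact \<Omega> (u t) (u' t) C" and v: "\<And>t. t \<in> A \<Longrightarrow> weak_curl_compact \<Omega> (v t) (v' t) C"
    and c: "\<And>t. t \<in> A \<Longrightarrow> continuous_on \<Omega> (c t)" and \<phi>: "\<phi> \<in> test_functions \<Omega>"
  shows "(\<lambda>n. \<integral>x. (\<Sum>t\<in>A. c t x * \<phi> x * (u t n k x * v t n l x - u t n l x * v t n k x)) \<partial>lebesgue_on \<Omega>)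
    \<longlonglongrightarrow> (\<integral>x. (\<Sum>t\<in>A. c t x * \<phi> x * (u' t k x * v' t l x - u' t l x * v' t k x)) \<partial>lebesgue_on \<Omega>)"
proof -
  define M where "M = lebesgue_on \<Omega>"
  have int: "integrable M (\<lambda>x. c t x * \<phi> x * (p x * q x - p' x * q' x))"
    if "t \<in> A" "p \<in> L2 M" "q \<in> L2 M" "p' \<in> L2 M" "q' \<in> L2 M" for t p q p' q'
  proof -
    interpret weak_curl_compact \<Omega> "u t" "u' t" C by (rule u[OF that(1)])
    note f = test_multiplier[OF \<phi> c[OF that(1)]]
    obtain B where B: "B \<ge> 0" "\<And>x. \<bar>c t x * \<phi> x\<bar> \<le> B" using continuous_compact_support_bounded[OF f] by blast
    have m: "(\<lambda>x. c t x * \<phi> x) \<in> borel_measurable M"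
      unfolding M_def by (rule continuous_imp_measurable_on_sets_lebesgue[OF f(1) domain_sets])
    have "integrable M (\<lambda>x. (c t x * \<phi> x * p x) * q x - (c t x * \<phi> x * p' x) * q' x)"
      by (intro Bochner_Integration.integrable_diff L2_integrable_mult that L2_mult_bounded[OF _ m B(2)])
    then show ?thesis by (simp add: algebra_simps)
  qed
  have L: "u t n i \<in> L2 M" "v t n i \<in> L2 M" "u' t i \<in> L2 M" "v' t i \<in> L2 M" if "t \<in> A" for t n i
    using weak_curl_compact.field_L2[OF u[OF that]] weak_curl_compact.field_L2[OF v[OF that]] by (simp_all add: M_def)
  have "(\<lambda>n. \<Sum>t\<in>A. \<integral>x. c t x * \<phi> x * (u t n k x * v t n l x - u t n l x * v t n k x) \<partial>M)
     \<longlonglongrightarrow> (\<Sum>t\<in>A. \<integral>x. c t x * \<phi> x * (u' t k x * v' t l x - u' t l x * v' t k x) \<partial>M)"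
    unfolding M_def by (intro tendsto_sum div_curl[OF u v test_multiplier[OF \<phi> c]])
  then show ?thesis
    unfolding M_def[symmetric] by (simp add: Bochner_Integration.integral_sum int L)
qed

text \<open>Pairing the relation with its own defect in the limit shows that this defect has norm 0.
  The constants 1 and -1 transfer the symmetry of \<open>h\<close> and the antisymmetry of \<kappa>
  to the limit.\<close>

lemma weakly_L2_AE_unique:
  assumes f: "weakly_L2 M f f'" and g: "weakly_L2 M g g'" and eq: "\<And>n. AE x in M. f n x = c * g n x"
  shows "AE x in M. f' x = c * g' x"
proof -
  have L: "f n \<in> L2 M" "g n \<in> L2 M" "f' \<in> L2 M" "g' \<in> L2 M" for n using f g by (auto simp: weakly_L2_def)
  define d where "d x = f' x - c * g' x" for x
  have d: "d \<in> L2 M" unfolding d_def by (intro L2_diff L2_cmult L)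
  have "ip M (f n) d = c * ip M (g n) d" for n
    unfolding ip_cmult_left[symmetric] unfolding ip_def
    using eq[of n] L2_measurable[OF L(1)[of n]] L2_measurable[OF L(2)[of n]] L2_measurable[OF d]
    by (intro integral_cong_AE borel_measurable_times) auto
  moreover have "(\<lambda>n. ip M (f n) d) \<longlonglongrightarrow> ip M f' d" "(\<lambda>n. c * ip M (g n) d) \<longlonglongrightarrow> c * ip M g' d"
    using f g d by (auto simp: weakly_L2_def intro!: tendsto_intros)
  ultimately have "ip M f' d = c * ip M g' d" using LIMSEQ_unique by simp
  then have "ip M d d = 0"
    unfolding d_def[abs_def] using L d[unfolded d_def[abs_def]]
    by (subst ip_diff_left) (auto simp: ip_cmult_left L2_cmult)
  then have "AE x in M. d x * d x = 0"
    unfolding ip_def using L2_integrable_mult[OF d d] by (subst (asm) integral_nonneg_eq_0_iff_AE) auto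
  then show ?thesis by eventually_elim (simp add: d_def)
qed

section \<open>Continuity of the metric coefficients\<close>

lemma Ck_on_2_continuous:
  assumes "Ck_on 2 \<Omega> f"
  shows "continuous_on \<Omega> f" "continuous_on \<Omega> (partial_deriv j f)"
  using assms by (auto simp: numeral_2_eq_2 differentiable_imp_continuous_on)

lemma continuous_on_det:
  fixes A :: "'a::topological_space \<Rightarrow> real ^ 'n ^ 'n"
  assumes "\<And>i j. continuous_on S (\<lambda>x. A x $ i $ j)"
  shows "continuous_on S (\<lambda>x. det (A x))"
  unfolding det_def by (intro continuous_intros assms)

text \<open>Cramer's rule exhibits the entries of the inverse as quotients of determinants, from
  which their continuity is read off.\<close>

lemma matrix_inv_cramer:
  fixes A :: "real ^ 'n ^ 'n"
  assumes "det A \<noteq> 0"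
  shows "matrix_inv A $ m $ n = det (\<chi> i j. if j = m then axis n 1 $ i else A $ i $ j) / det A"
proof -
  have "A ** matrix_inv A = mat 1"
    using assms unfolding invertible_det_nz[symmetric] invertible_def matrix_inv_def by (metis (mono_tags, lifting) someI_ex)
  then have "A *v (matrix_inv A *v axis n 1) = axis n 1" by (simp add: matrix_vector_mul_assoc)
  then have "matrix_inv A *v axis n 1 = (\<chi> k. det (\<chi> i j. if j = k then axis n 1 $ i else A $ i $ j) / det A)"
    by (simp add: cramer[OF assms])
  moreover have "(matrix_inv A *v axis n 1) $ m = matrix_inv A $ m $ n"
    by (simp add: matrix_vector_mult_basis column_def)
  ultimately show ?thesis by simp
qed

lemma continuous_on_matrix_inv:
  assumes g: "riemannian_metric \<Omega> g"
  shows "continuous_on \<Omega> (\<lambda>x. matrix_inv (g x) $ m $ n)"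
proof -
  \<comment> \<open>A kernel vector would contradict positive definiteness.\<close>
  have det: "det (g x) \<noteq> 0" if "x \<in> \<Omega>" for x
  proof
    assume "det (g x) = 0"
    then have "\<not> invertible (g x)" by (simp add: invertible_det_nz)
    then obtain v where "v \<noteq> 0" "g x *v v = 0"
      using matrix_left_invertible_ker[of "g x"] invertible_left_inverse[of "g x"] by blast
    moreover have "v \<bullet> (g x *v v) > 0" using g that \<open>v \<noteq> 0\<close> by (simp add: riemannian_metric_def)
    ultimately show False by simp
  qed
  have gc: "continuous_on \<Omega> (\<lambda>x. g x $ i $ j)" for i j
    using g Ck_on_2_continuous(1)[of \<Omega> "\<lambda>x. g x $ i $ j"] by (simp add: riemannian_metric_def)
  have "continuous_on \<Omega> (\<lambda>x. det (\<chi> i j. if j = m then axis n 1 $ i else g x $ i $ j) / det (g x))"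
  proof (intro continuous_on_divide continuous_on_det)
    show "continuous_on \<Omega> (\<lambda>x. (\<chi> i j. if j = m then axis n 1 $ i else g x $ i $ j) $ i $ j)" for i j
      using gc by (cases "j = m") (auto intro: continuous_intros)
  qed (use gc det in auto)
  then show ?thesis
    by (rule continuous_on_eq) (simp add: matrix_inv_cramer det)
qed

lemma continuous_on_christoffel:
  assumes g: "riemannian_metric \<Omega> g"
  shows "continuous_on \<Omega> (christoffel g k i j)"
proof -
  have "continuous_on \<Omega> (partial_deriv l (\<lambda>y. g y $ i $ j))" for l i j
    using g Ck_on_2_continuous(2)[of \<Omega> "\<lambda>x. g x $ i $ j" l] by (simp add: riemannian_metric_def)
  then show ?thesis
    unfolding christoffel_def[abs_def] by (intro continuous_intros continuous_on_matrix_inv[OF g])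
qed

section \<open>Norms and weak limits of fields\<close>

lemma integral_sum3:
  fixes f :: "'i \<Rightarrow> 'j \<Rightarrow> 'k \<Rightarrow> 'a \<Rightarrow> real"
  assumes "\<And>i j k. i \<in> I \<Longrightarrow> j \<in> J \<Longrightarrow> k \<in> K \<Longrightarrow> integrable M (f i j k)"
  shows "(\<integral>x. (\<Sum>i\<in>I. \<Sum>j\<in>J. \<Sum>k\<in>K. f i j k x) \<partial>M) = (\<Sum>i\<in>I. \<Sum>j\<in>J. \<Sum>k\<in>K. \<integral>x. f i j k x \<partial>M)"
    "integrable M (\<lambda>x. \<Sum>i\<in>I. \<Sum>j\<in>J. \<Sum>k\<in>K. f i j k x)"
proof -
  show "integrable M (\<lambda>x. \<Sum>i\<in>I. \<Sum>j\<in>J. \<Sum>k\<in>K. f i j k x)"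
    by (intro Bochner_Integration.integrable_sum assms)
  have "(\<integral>x. (\<Sum>i\<in>I. \<Sum>j\<in>J. \<Sum>k\<in>K. f i j k x) \<partial>M) = (\<Sum>i\<in>I. \<integral>x. (\<Sum>j\<in>J. \<Sum>k\<in>K. f i j k x) \<partial>M)"
    by (intro Bochner_Integration.integral_sum Bochner_Integration.integrable_sum assms)
  also have "\<dots> = (\<Sum>i\<in>I. \<Sum>j\<in>J. \<integral>x. (\<Sum>k\<in>K. f i j k x) \<partial>M)"
    by (intro sum.cong refl Bochner_Integration.integral_sum Bochner_Integration.integrable_sum assms)
  also have "\<dots> = (\<Sum>i\<in>I. \<Sum>j\<in>J. \<Sum>k\<in>K. \<integral>x. f i j k x \<partial>M)"
    by (intro sum.cong refl Bochner_Integration.integral_sum assms)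
  finally show "(\<integral>x. (\<Sum>i\<in>I. \<Sum>j\<in>J. \<Sum>k\<in>K. f i j k x) \<partial>M) = (\<Sum>i\<in>I. \<Sum>j\<in>J. \<Sum>k\<in>K. \<integral>x. f i j k x \<partial>M)" .
qed

lemma L2_field_norm_eq:
  assumes "L2_field \<Omega> p h \<kappa>"
  shows "L2_field_norm \<Omega> p h \<kappa> = sqrt (
    (\<Sum>a\<in>{1..p}. \<Sum>i\<in>UNIV. \<Sum>j\<in>UNIV. ip (lebesgue_on \<Omega>) (h a i j) (h a i j)) +
    (\<Sum>a\<in>{1..p}. \<Sum>l\<in>UNIV. \<Sum>b\<in>{1..p}. ip (lebesgue_on \<Omega>) (\<kappa> a l b) (\<kappa> a l b)))"
proof -
  have h: "integrable (lebesgue_on \<Omega>) (\<lambda>x. (h a i j x)\<^sup>2)" if "a \<in> {1..p}" for a i j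
    using assms that by (simp add: L2_field_def in_L2_def)
  have \<kappa>: "integrable (lebesgue_on \<Omega>) (\<lambda>x. (\<kappa> a l b x)\<^sup>2)" if "a \<in> {1..p}" "b \<in> {1..p}" for a l b
    using assms that by (simp add: L2_field_def in_L2_def)
  have H: "integrable (lebesgue_on \<Omega>) (\<lambda>x. \<Sum>a\<in>{1..p}. \<Sum>i\<in>UNIV. \<Sum>j\<in>UNIV. (h a i j x)\<^sup>2)"
    "(\<integral>x. (\<Sum>a\<in>{1..p}. \<Sum>i\<in>UNIV. \<Sum>j\<in>UNIV. (h a i j x)\<^sup>2) \<partial>lebesgue_on \<Omega>)
      = (\<Sum>a\<in>{1..p}. \<Sum>i\<in>UNIV. \<Sum>j\<in>UNIV. \<integral>x. (h a i j x)\<^sup>2 \<partial>lebesgue_on \<Omega>)"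
    by (rule integral_sum3; use h in simp)+
  have K: "integrable (lebesgue_on \<Omega>) (\<lambda>x. \<Sum>a\<in>{1..p}. \<Sum>l\<in>UNIV. \<Sum>b\<in>{1..p}. (\<kappa> a l b x)\<^sup>2)"
    "(\<integral>x. (\<Sum>a\<in>{1..p}. \<Sum>l\<in>UNIV. \<Sum>b\<in>{1..p}. (\<kappa> a l b x)\<^sup>2) \<partial>lebesgue_on \<Omega>)
      = (\<Sum>a\<in>{1..p}. \<Sum>l\<in>UNIV. \<Sum>b\<in>{1..p}. \<integral>x. (\<kappa> a l b x)\<^sup>2 \<partial>lebesgue_on \<Omega>)"
    by (rule integral_sum3; use \<kappa> in simp)+
  show ?thesis
    unfolding L2_field_norm_def ip_def power2_eq_square[symmetric]
    by (simp only: Bochner_Integration.integral_add[OF H(1) K(1)] H(2) K(2))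
qed

lemma L2_field_norm_component:
  assumes f: "L2_field \<Omega> p h \<kappa>" and C: "L2_field_norm \<Omega> p h \<kappa> \<le> C"
  shows "a \<in> {1..p} \<Longrightarrow> nrm (lebesgue_on \<Omega>) (h a i j) \<le> C"
    "a \<in> {1..p} \<Longrightarrow> b \<in> {1..p} \<Longrightarrow> nrm (lebesgue_on \<Omega>) (\<kappa> a l b) \<le> C"
proof -
  let ?H = "\<Sum>a\<in>{1..p}. \<Sum>i\<in>UNIV. \<Sum>j\<in>UNIV. ip (lebesgue_on \<Omega>) (h a i j) (h a i j)"
  let ?K = "\<Sum>a\<in>{1..p}. \<Sum>l\<in>UNIV. \<Sum>b\<in>{1..p}. ip (lebesgue_on \<Omega>) (\<kappa> a l b) (\<kappa> a l b)"
  have HK: "?H \<ge> 0" "?K \<ge> 0" by (intro sum_nonneg ip_nonneg)+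
  have sq: "sqrt (?H + ?K) \<le> C" using C by (simp add: L2_field_norm_eq[OF f])
  show "nrm (lebesgue_on \<Omega>) (h a i j) \<le> C" if a: "a \<in> {1..p}" for a i j
  proof -
    have "ip (lebesgue_on \<Omega>) (h a i j) (h a i j) \<le> (\<Sum>j\<in>UNIV. ip (lebesgue_on \<Omega>) (h a i j) (h a i j))"
      by (rule member_le_sum) (auto intro: ip_nonneg)
    also have "\<dots> \<le> (\<Sum>i\<in>UNIV. \<Sum>j\<in>UNIV. ip (lebesgue_on \<Omega>) (h a i j) (h a i j))"
      by (rule member_le_sum[where f="\<lambda>i. \<Sum>j\<in>UNIV. ip (lebesgue_on \<Omega>) (h a i j) (h a i j)"]) (auto intro: ip_nonneg sum_nonneg)
    also have "\<dots> \<le> ?H"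
      using a by (intro member_le_sum[where f="\<lambda>a. \<Sum>i\<in>UNIV. \<Sum>j\<in>UNIV. ip (lebesgue_on \<Omega>) (h a i j) (h a i j)"]) (auto intro!: ip_nonneg sum_nonneg)
    also have "\<dots> \<le> ?H + ?K" using HK by simp
    finally show ?thesis using sq unfolding nrm_def by (meson order_trans real_sqrt_le_mono)
  qed
  show "nrm (lebesgue_on \<Omega>) (\<kappa> a l b) \<le> C" if a: "a \<in> {1..p}" "b \<in> {1..p}" for a b l
  proof -
    have "ip (lebesgue_on \<Omega>) (\<kappa> a l b) (\<kappa> a l b) \<le> (\<Sum>b\<in>{1..p}. ip (lebesgue_on \<Omega>) (\<kappa> a l b) (\<kappa> a l b))"
      using a by (intro member_le_sum[where f="\<lambda>b. ip (lebesgue_on \<Omega>) (\<kappa> a l b) (\<kappa> a l b)"]) (auto intro: ip_nonneg)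
    also have "\<dots> \<le> (\<Sum>l\<in>UNIV. \<Sum>b\<in>{1..p}. ip (lebesgue_on \<Omega>) (\<kappa> a l b) (\<kappa> a l b))"
      by (rule member_le_sum[where f="\<lambda>l. \<Sum>b\<in>{1..p}. ip (lebesgue_on \<Omega>) (\<kappa> a l b) (\<kappa> a l b)"]) (auto intro: ip_nonneg sum_nonneg)
    also have "\<dots> \<le> ?K"
      using a by (intro member_le_sum[where f="\<lambda>a. \<Sum>l\<in>UNIV. \<Sum>b\<in>{1..p}. ip (lebesgue_on \<Omega>) (\<kappa> a l b) (\<kappa> a l b)"]) (auto intro!: ip_nonneg sum_nonneg)
    also have "\<dots> \<le> ?H + ?K" using HK by simp
    finally show ?thesis using sq unfolding nrm_def by (meson order_trans real_sqrt_le_mono)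
  qed
qed

text \<open>Weak lower semicontinuity of the whole norm with the same \<open>C\<close>; bounds for
  single components would not add up to it. The inequality
  \<open>2 <f, g> - <g, g> \<le> <f, f>\<close>, with \<open>g\<close> the limit component, is
  affine in \<open>f\<close> on the left, so it can be summed and passed to the limit.\<close>

lemma L2_field_norm_weak_limit:
  assumes h: "\<And>a i j. a \<in> {1..p} \<Longrightarrow> weakly_L2 (lebesgue_on \<Omega>) (\<lambda>n. h n a i j) (h' a i j)"
    and \<kappa>: "\<And>a b l. a \<in> {1..p} \<Longrightarrow> b \<in> {1..p} \<Longrightarrow> weakly_L2 (lebesgue_on \<Omega>) (\<lambda>n. \<kappa> n a l b) (\<kappa>' a l b)"
    and C: "\<And>n. L2_field_norm \<Omega> p (h n) (\<kappa> n) \<le> C" "C > 0"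
  shows "L2_field_norm \<Omega> p h' \<kappa>' \<le> C"
proof -
  define M where "M = lebesgue_on \<Omega>"
  define S where "S h \<kappa> h' \<kappa>' = (\<Sum>a\<in>{1..p}. \<Sum>i\<in>UNIV. \<Sum>j\<in>UNIV. ip M (h a i j) (h' a i j)) +
      (\<Sum>a\<in>{1..p}. \<Sum>l\<in>UNIV. \<Sum>b\<in>{1..p}. ip M (\<kappa> a l b) (\<kappa>' a l b))"
    for h h' :: "'a second_form" and \<kappa> \<kappa>' :: "'a normal_form"
  note h = h[folded M_def] and \<kappa> = \<kappa>[folded M_def]
  have hL: "h n a i j \<in> L2 M" "h' a i j \<in> L2 M" if "a \<in> {1..p}" for n a i j
    using h[OF that] by (auto simp: weakly_L2_def)
  have \<kappa>L: "\<kappa> n a l b \<in> L2 M" "\<kappa>' a l b \<in> L2 M" if "a \<in> {1..p}" "b \<in> {1..p}" for n a l b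
    using \<kappa>[OF that] by (auto simp: weakly_L2_def)
  have F: "L2_field \<Omega> p (h n) (\<kappa> n)" "L2_field \<Omega> p h' \<kappa>'" for n
    using hL \<kappa>L by (auto simp: L2_field_def in_L2_iff M_def)
  have Sn: "S (h n) (\<kappa> n) (h n) (\<kappa> n) \<le> C\<^sup>2" for n
  proof -
    have "sqrt (S (h n) (\<kappa> n) (h n) (\<kappa> n)) \<le> sqrt (C\<^sup>2)"
      using C(1)[of n] C(2) unfolding L2_field_norm_eq[OF F(1)] by (simp add: S_def M_def)
    then show ?thesis by (simp only: real_sqrt_le_iff)
  qed
  have lower: "2 * ip M f g - ip M g g \<le> ip M f f" if "f \<in> L2 M" "g \<in> L2 M" for f g
    using ip_diff_diff[OF that, of 1] ip_nonneg[of M "\<lambda>x. f x - 1 * g x"] by simp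
  have "2 * S (h n) (\<kappa> n) h' \<kappa>' - S h' \<kappa>' h' \<kappa>' \<le> S (h n) (\<kappa> n) (h n) (\<kappa> n)" for n
    unfolding S_def distrib_left sum_distrib_left add_diff_add sum_subtractf[symmetric]
    by (intro add_mono sum_mono lower hL \<kappa>L)
  then have le: "2 * S (h n) (\<kappa> n) h' \<kappa>' - S h' \<kappa>' h' \<kappa>' \<le> C\<^sup>2" for n using Sn order_trans by blast
  have "(\<lambda>n. 2 * S (h n) (\<kappa> n) h' \<kappa>' - S h' \<kappa>' h' \<kappa>') \<longlonglongrightarrow> 2 * S h' \<kappa>' h' \<kappa>' - S h' \<kappa>' h' \<kappa>'"
    unfolding S_def using h \<kappa> hL \<kappa>L by (intro tendsto_intros) (auto simp: weakly_L2_def)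
  then have "2 * S h' \<kappa>' h' \<kappa>' - S h' \<kappa>' h' \<kappa>' \<le> C\<^sup>2" by (rule LIMSEQ_le_const2) (use le in auto)
  then have "sqrt (S h' \<kappa>' h' \<kappa>') \<le> sqrt (C\<^sup>2)" by (intro real_sqrt_le_mono) simp
  then show ?thesis unfolding L2_field_norm_eq[OF F(2)] using C(2) by (simp add: S_def M_def)
qed

lemma field_weakly_compact:
  fixes h :: "nat \<Rightarrow> 'd::finite second_form" and \<kappa> :: "nat \<Rightarrow> 'd normal_form"
  assumes f: "\<And>n. L2_field \<Omega> p (h n) (\<kappa> n)" and C: "\<And>n. L2_field_norm \<Omega> p (h n) (\<kappa> n) \<le> C"
  obtains r h' \<kappa>' where "strict_mono (r :: nat \<Rightarrow> nat)"
    "\<And>a i j. a \<in> {1..p} \<Longrightarrow> weakly_L2 (lebesgue_on \<Omega>) (\<lambda>n. h (r n) a i j) (h' a i j)"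
    "\<And>a b l. a \<in> {1..p} \<Longrightarrow> b \<in> {1..p} \<Longrightarrow> weakly_L2 (lebesgue_on \<Omega>) (\<lambda>n. \<kappa> (r n) a l b) (\<kappa>' a l b)"
proof -
  \<comment> \<open>One finite index set for all components of \<open>h\<close> and \<kappa> makes a
    single subsequence serve them all.\<close>
  define I where "I = Inl ` ({1..p} \<times> (UNIV :: 'd set) \<times> (UNIV :: 'd set)) \<union> Inr ` ({1..p} \<times> (UNIV :: 'd set) \<times> {1..p})"
  define F where "F t n = (case t of Inl (a, i, j) \<Rightarrow> h n a i j | Inr (a, l, b) \<Rightarrow> \<kappa> n a l b)"
    for t :: "nat \<times> 'd \<times> 'd + nat \<times> 'd \<times> nat" and n
  have "\<exists>r f'. strict_mono r \<and> (\<forall>t\<in>I. weakly_L2 (lebesgue_on \<Omega>) (\<lambda>n. F t (r n)) (f' t))"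
  proof (rule L2_weakly_compact_finite)
    show "finite I" by (simp add: I_def)
    show "F t n \<in> L2 (lebesgue_on \<Omega>)" if "t \<in> I" for t n
      using that f[of n] by (auto simp: I_def F_def L2_field_def in_L2_iff)
    show "nrm (lebesgue_on \<Omega>) (F t n) \<le> C" if "t \<in> I" for t n
      using that L2_field_norm_component(1)[OF f C] L2_field_norm_component(2)[OF f C] by (auto simp: I_def F_def)
  qed
  then obtain r f' where r: "strict_mono r" "\<And>t. t \<in> I \<Longrightarrow> weakly_L2 (lebesgue_on \<Omega>) (\<lambda>n. F t (r n)) (f' t)" by blast
  show ?thesis
  proof (rule that[OF r(1), of "\<lambda>a i j. f' (Inl (a, i, j))" "\<lambda>a l b. f' (Inr (a, l, b))"])
    show "weakly_L2 (lebesgue_on \<Omega>) (\<lambda>n. h (r n) a i j) (f' (Inl (a, i, j)))" if "a \<in> {1..p}" for a i j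
      using r(2)[of "Inl (a, i, j)"] that by (simp add: I_def F_def)
    show "weakly_L2 (lebesgue_on \<Omega>) (\<lambda>n. \<kappa> (r n) a l b) (f' (Inr (a, l, b)))" if "a \<in> {1..p}" "b \<in> {1..p}" for a b l
      using r(2)[of "Inr (a, l, b)"] that by (simp add: I_def F_def)
  qed
qed


section \<open>The Gauss-Codazzi-Ricci system\<close>

text \<open>Derivatives and Christoffel symbols are moved onto the test function, so the linear
  terms become pairings with fixed \<open>L\<^sup>2\<close> functions and converge weakly.\<close>

lemma codazzi_lhs_eq:
  fixes \<phi> :: "real ^ 'd \<Rightarrow> real"
  assumes \<Omega>: "open \<Omega>" and g: "riemannian_metric \<Omega> g" and a: "a \<in> {1..p}"
    and f: "L2_field \<Omega> p h \<kappa>" and \<phi>: "\<phi> \<in> test_functions \<Omega>"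
  shows "codazzi_lhs \<Omega> g p h \<kappa> a j k l \<phi> =
    (ip (lebesgue_on \<Omega>) (h a k j) (partial_deriv l \<phi>) - ip (lebesgue_on \<Omega>) (h a l j) (partial_deriv k \<phi>))
    + ((\<Sum>m\<in>UNIV. ip (lebesgue_on \<Omega>) (h a k m) (\<lambda>x. christoffel g m l j x * \<phi> x))
      - (\<Sum>m\<in>UNIV. ip (lebesgue_on \<Omega>) (h a l m) (\<lambda>x. christoffel g m k j x * \<phi> x)))
    + regular_dist \<Omega> (codazzi_quad p h \<kappa> a j k l) \<phi>"
proof -
  define M where "M = lebesgue_on \<Omega>"
  have \<Omega>s: "\<Omega> \<in> sets lebesgue" using \<Omega> by auto
  have hL: "h a i m \<in> L2 M" for i m using f a by (simp add: L2_field_def in_L2_iff M_def)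
  have \<Gamma>L: "(\<lambda>x. christoffel g m i j x * \<phi> x) \<in> L2 M" for m i
    unfolding M_def by (rule multiplier_L2[OF \<Omega>s test_multiplier[OF \<phi> continuous_on_christoffel[OF g]]])
  have int: "integrable M (\<lambda>x. h a i m x * (christoffel g m i' j x * \<phi> x))" for i i' m
    by (rule L2_integrable_mult[OF hL \<Gamma>L])
  have "regular_dist \<Omega> (\<lambda>x. (\<Sum>m\<in>UNIV. christoffel g m l j x * h a k m x) - (\<Sum>m\<in>UNIV. christoffel g m k j x * h a l m x)) \<phi>
    = (\<integral>x. (\<Sum>m\<in>UNIV. h a k m x * (christoffel g m l j x * \<phi> x)) - (\<Sum>m\<in>UNIV. h a l m x * (christoffel g m k j x * \<phi> x)) \<partial>M)"
    unfolding regular_dist_eq[OF \<phi>] ip_def M_def[symmetric]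
    by (intro Bochner_Integration.integral_cong refl) (simp add: left_diff_distrib right_diff_distrib sum_distrib_left sum_distrib_right mult_ac)
  also have "\<dots> = (\<Sum>m\<in>UNIV. ip M (h a k m) (\<lambda>x. christoffel g m l j x * \<phi> x))
      - (\<Sum>m\<in>UNIV. ip M (h a l m) (\<lambda>x. christoffel g m k j x * \<phi> x))"
    unfolding ip_def
    by (simp only: Bochner_Integration.integral_diff[OF Bochner_Integration.integrable_sum[OF int] Bochner_Integration.integrable_sum[OF int]]
        Bochner_Integration.integral_sum[OF int])
  finally show ?thesis
    by (simp add: codazzi_lhs_def curl_dist_eq[OF \<phi>] M_def)
qed

lemma ricci_lhs_eq:
  assumes "\<phi> \<in> test_functions \<Omega>"
  shows "ricci_lhs \<Omega> g p h \<kappa> a b k l \<phi> =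
    (ip (lebesgue_on \<Omega>) (\<kappa> a k b) (partial_deriv l \<phi>) - ip (lebesgue_on \<Omega>) (\<kappa> a l b) (partial_deriv k \<phi>))
    - regular_dist \<Omega> (ricci_quad_h g h a b k l) \<phi> + regular_dist \<Omega> (ricci_quad_\<kappa> p \<kappa> a b k l) \<phi>"
  by (simp add: ricci_lhs_def curl_dist_eq[OF assms])

text \<open>The symmetry of \<open>h\<close> puts the index of the curl first, as \<open>div_curl_sum\<close> needs.\<close>

lemma ricci_quad_h_symmetric:
  fixes \<phi> :: "real ^ 'd \<Rightarrow> real"
  assumes \<Omega>: "open \<Omega>" and g: "riemannian_metric \<Omega> g" and ab: "a \<in> {1..p}" "b \<in> {1..p}"
    and f: "L2_field \<Omega> p h \<kappa>" and s: "symmetric_field \<Omega> p h \<kappa>" and \<phi>: "\<phi> \<in> test_functions \<Omega>"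
  shows "regular_dist \<Omega> (ricci_quad_h g h a b k l) \<phi> =
    (\<integral>x. (\<Sum>t\<in>UNIV. matrix_inv (g x) $ fst t $ snd t * \<phi> x * (h a l (fst t) x * h b k (snd t) x - h a k (fst t) x * h b l (snd t) x)) \<partial>lebesgue_on \<Omega>)"
proof -
  define M where "M = lebesgue_on \<Omega>"
  have \<Omega>s: "\<Omega> \<in> sets lebesgue" using \<Omega> by auto
  have hm: "h c i m \<in> borel_measurable M" if "c \<in> {1..p}" for c i m
    using f that by (simp add: L2_field_def in_L2_def M_def)
  have gm: "(\<lambda>x. matrix_inv (g x) $ m $ n) \<in> borel_measurable M" for m n
    unfolding M_def by (rule continuous_imp_measurable_on_sets_lebesgue[OF continuous_on_matrix_inv[OF g] \<Omega>s])
  have \<phi>m: "\<phi> \<in> borel_measurable M" unfolding M_def by (rule L2_measurable[OF test_L2_on[OF \<Omega>s \<phi>]])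
  have "AE x in M. h c m i x = h c i m x" if "c \<in> {1..p}" for c m i
    using s that unfolding symmetric_field_def M_def by blast
  then have "AE x in M. \<forall>m\<in>UNIV. \<forall>i\<in>UNIV. h c m i x = h c i m x" if "c \<in> {1..p}" for c
    using that by (intro AE_finite_allI) auto
  from this[OF ab(1)] this[OF ab(2)]
  have "AE x in M. ricci_quad_h g h a b k l x * \<phi> x =
      (\<Sum>t\<in>UNIV. matrix_inv (g x) $ fst t $ snd t * \<phi> x * (h a l (fst t) x * h b k (snd t) x - h a k (fst t) x * h b l (snd t) x))"
  proof eventually_elim
    case (elim x)
    have "ricci_quad_h g h a b k l x * \<phi> x = (\<Sum>m\<in>UNIV. \<Sum>n\<in>UNIV. matrix_inv (g x) $ m $ n * \<phi> x * (h a l m x * h b k n x - h a k m x * h b l n x))"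
      unfolding ricci_quad_h_def sum_distrib_right using elim by (intro sum.cong refl) (simp add: mult_ac)
    then show ?case by (simp add: sum.cartesian_product case_prod_unfold)
  qed
  then show ?thesis
    unfolding regular_dist_eq[OF \<phi>] ip_def M_def[symmetric]
  proof (rule integral_cong_AE[rotated 2])
    show "(\<lambda>x. ricci_quad_h g h a b k l x * \<phi> x) \<in> borel_measurable M"
      unfolding ricci_quad_h_def
      by (intro borel_measurable_times borel_measurable_sum borel_measurable_diff gm \<phi>m hm ab)
    show "(\<lambda>x. \<Sum>t\<in>UNIV. matrix_inv (g x) $ fst t $ snd t * \<phi> x * (h a l (fst t) x * h b k (snd t) x - h a k (fst t) x * h b l (snd t) x)) \<in> borel_measurable M"
      by (intro borel_measurable_times borel_measurable_sum borel_measurable_diff gm \<phi>m hm ab)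
  qed
qed

theorem theorem3p2:
  fixes \<Omega> :: "(real ^ 'd) set"
    and g :: "real ^ 'd \<Rightarrow> real ^ 'd ^ 'd"
    and N p :: nat
    and h :: "real \<Rightarrow> 'd second_form"
    and \<kappa> :: "real \<Rightarrow> 'd normal_form"
    and o1 :: "real \<Rightarrow> nat \<Rightarrow> 'd \<Rightarrow> 'd \<Rightarrow> 'd \<Rightarrow> 'd functional"
    and o2 :: "real \<Rightarrow> nat \<Rightarrow> nat \<Rightarrow> 'd \<Rightarrow> 'd \<Rightarrow> 'd functional"
    and o3 :: "real \<Rightarrow> 'd \<Rightarrow> 'd \<Rightarrow> 'd \<Rightarrow> 'd \<Rightarrow> 'd functional"
    and C :: real
  assumes dim: "CARD('d) \<ge> 3"
    and codim: "N = CARD('d) + p"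
    and domain: "open \<Omega>" "bounded \<Omega>"
    and metric: "riemannian_metric \<Omega> g"
    and sym: "\<And>\<epsilon>. \<epsilon> > 0 \<Longrightarrow> symmetric_field \<Omega> p (h \<epsilon>) (\<kappa> \<epsilon>)"
    and A1: "C > 0" "\<And>\<epsilon>. \<epsilon> > 0 \<Longrightarrow> L2_field \<Omega> p (h \<epsilon>) (\<kappa> \<epsilon>)"
      "\<And>\<epsilon>. \<epsilon> > 0 \<Longrightarrow> L2_field_norm \<Omega> p (h \<epsilon>) (\<kappa> \<epsilon>) \<le> C"
    and A2_h: "\<And>a j k l. a \<in> {1..p} \<Longrightarrow> \<exists>K. compactin (Hneg1_loc_topology \<Omega>) K \<and>
      (\<forall>\<epsilon>>0. curl_dist \<Omega> k (h \<epsilon> a l j) l (h \<epsilon> a k j) \<in> K)"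
    and A2_\<kappa>: "\<And>a b k l. a \<in> {1..p} \<Longrightarrow> b \<in> {1..p} \<Longrightarrow>
      \<exists>K. compactin (Hneg1_loc_topology \<Omega>) K \<and>
      (\<forall>\<epsilon>>0. curl_dist \<Omega> k (\<kappa> \<epsilon> a l b) l (\<kappa> \<epsilon> a k b) \<in> K)"
    and A3_o1: "\<And>a j k l. a \<in> {1..p} \<Longrightarrow>
      (\<forall>\<epsilon>>0. distribution \<Omega> (o1 \<epsilon> a j k l)) \<and>
      dist_tendsto \<Omega> (\<lambda>\<epsilon>. o1 \<epsilon> a j k l) 0 (at_right 0)"
    and A3_o2: "\<And>a b k l. a \<in> {1..p} \<Longrightarrow> b \<in> {1..p} \<Longrightarrow>
      (\<forall>\<epsilon>>0. distribution \<Omega> (o2 \<epsilon> a b k l)) \<and>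
      dist_tendsto \<Omega> (\<lambda>\<epsilon>. o2 \<epsilon> a b k l) 0 (at_right 0)"
    and A3_o3: "\<And>i j k l. (\<forall>\<epsilon>>0. distribution \<Omega> (o3 \<epsilon> i j k l)) \<and>
      dist_tendsto \<Omega> (\<lambda>\<epsilon>. o3 \<epsilon> i j k l) 0 (at_right 0)"
    and A3_codazzi: "\<And>\<epsilon> a j k l. \<epsilon> > 0 \<Longrightarrow> a \<in> {1..p} \<Longrightarrow>
      codazzi_lhs \<Omega> g p (h \<epsilon>) (\<kappa> \<epsilon>) a j k l = o1 \<epsilon> a j k l"
    and A3_ricci: "\<And>\<epsilon> a b k l. \<epsilon> > 0 \<Longrightarrow> a \<in> {1..p} \<Longrightarrow> b \<in> {1..p} \<Longrightarrow>
      ricci_lhs \<Omega> g p (h \<epsilon>) (\<kappa> \<epsilon>) a b k l = o2 \<epsilon> a b k l"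
    and A3_gauss: "\<And>\<epsilon> i j k l. \<epsilon> > 0 \<Longrightarrow>
      regular_dist \<Omega> (gauss_quad p (h \<epsilon>) i j k l)
        = regular_dist \<Omega> (riemann g i j k l) + o3 \<epsilon> i j k l"
  shows "\<exists>(e :: nat \<Rightarrow> real) (h' :: 'd second_form) (\<kappa>' :: 'd normal_form).
    (\<forall>n. e n > 0) \<and> (\<forall>n. e (Suc n) < e n) \<and> e \<longlonglongrightarrow> 0 \<and>
    (\<forall>a\<in>{1..p}. \<forall>i j. weakly_in_L2 \<Omega> (\<lambda>n. h (e n) a i j) (h' a i j)) \<and>
    (\<forall>a\<in>{1..p}. \<forall>b\<in>{1..p}. \<forall>l. weakly_in_L2 \<Omega> (\<lambda>n. \<kappa> (e n) a l b) (\<kappa>' a l b)) \<and>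
    L2_field \<Omega> p h' \<kappa>' \<and> L2_field_norm \<Omega> p h' \<kappa>' \<le> C \<and>
    (\<forall>i j k l. dist_tendsto \<Omega> (\<lambda>n. regular_dist \<Omega> (gauss_quad p (h (e n)) i j k l))
       (regular_dist \<Omega> (gauss_quad p h' i j k l)) sequentially) \<and>
    (\<forall>a\<in>{1..p}. \<forall>j k l.
       dist_tendsto \<Omega> (\<lambda>n. regular_dist \<Omega> (codazzi_quad p (h (e n)) (\<kappa> (e n)) a j k l))
         (regular_dist \<Omega> (codazzi_quad p h' \<kappa>' a j k l)) sequentially) \<and>
    (\<forall>a\<in>{1..p}. \<forall>b\<in>{1..p}. \<forall>k l.
       dist_tendsto \<Omega> (\<lambda>n. regular_dist \<Omega> (ricci_quad_h g (h (e n)) a b k l))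
         (regular_dist \<Omega> (ricci_quad_h g h' a b k l)) sequentially) \<and>
    (\<forall>a\<in>{1..p}. \<forall>b\<in>{1..p}. \<forall>k l.
       dist_tendsto \<Omega> (\<lambda>n. regular_dist \<Omega> (ricci_quad_\<kappa> p (\<kappa> (e n)) a b k l))
         (regular_dist \<Omega> (ricci_quad_\<kappa> p \<kappa>' a b k l)) sequentially) \<and>
    weak_solution_GCR \<Omega> g p h' \<kappa>'"
proof -

  \<comment> \<open>Extraction of the subsequence\<close>
  define M where "M = lebesgue_on \<Omega>"
  have \<Omega>s: "\<Omega> \<in> sets lebesgue" using domain(1) by auto
  define e0 where "e0 n = 1 / real (Suc n)" for n
  have e0: "e0 n > 0" for n by (simp add: e0_def)
  obtain r h' \<kappa>' where r: "strict_mono r"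
    and h: "\<And>a i j. a \<in> {1..p} \<Longrightarrow> weakly_L2 M (\<lambda>n. h (e0 (r n)) a i j) (h' a i j)"
    and \<kappa>: "\<And>a b l. a \<in> {1..p} \<Longrightarrow> b \<in> {1..p} \<Longrightarrow> weakly_L2 M (\<lambda>n. \<kappa> (e0 (r n)) a l b) (\<kappa>' a l b)"
    using field_weakly_compact[of \<Omega> p "\<lambda>n. h (e0 n)" "\<lambda>n. \<kappa> (e0 n)" C] A1 e0 unfolding M_def by blast
  define e where "e n = e0 (r n)" for n
  note h = h[folded e_def] and \<kappa> = \<kappa>[folded e_def]
  have e_pos: "e n > 0" for n by (simp add: e_def e0)
  have e_dec: "e (Suc n) < e n" for n
  proof -
    have "r n < r (Suc n)" using r by (simp add: strict_mono_Suc_iff)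
    then show ?thesis by (simp add: e_def e0_def frac_less2)
  qed
  have "e0 \<longlonglongrightarrow> 0" unfolding e0_def by (rule LIMSEQ_Suc[OF lim_1_over_n])
  from LIMSEQ_subseq_LIMSEQ[OF this r] have e_lim: "e \<longlonglongrightarrow> 0" by (simp add: o_def e_def[abs_def])
  have e_right: "filterlim e (at_right 0) sequentially"
  proof -
    have "e n \<noteq> 0" for n using e_pos[of n] by simp
    then show ?thesis using e_lim e_pos by (simp add: filterlim_at)
  qed

  have field: "L2_field \<Omega> p (h (e n)) (\<kappa> (e n))" for n using A1(2)[OF e_pos] .
  have norm_le: "L2_field_norm \<Omega> p (h (e n)) (\<kappa> (e n)) \<le> C" for n using A1(3)[OF e_pos] .
  have field': "L2_field \<Omega> p h' \<kappa>'"
    using h \<kappa> by (simp add: L2_field_def in_L2_iff weakly_L2_def M_def)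
  have norm': "L2_field_norm \<Omega> p h' \<kappa>' \<le> C"
    by (rule L2_field_norm_weak_limit[OF h[unfolded M_def] \<kappa>[unfolded M_def] norm_le A1(1)])
  \<comment> \<open>For fixed \<open>a\<close> and \<open>j\<close> the first lower index of
    \<open>h\<close> is the vector index whose curl (A.2) controls.\<close>
  have wc_h: "weak_curl_compact \<Omega> (\<lambda>n i. h (e n) a i j) (\<lambda>i. h' a i j) C" if "a \<in> {1..p}" for a j
  proof
    show "\<exists>K. compactin (Hneg1_loc_topology \<Omega>) K \<and> (\<forall>n. curl_dist \<Omega> k (h (e n) a l j) l (h (e n) a k j) \<in> K)" for k l
      using A2_h[OF that, where j=j and k=k and l=l] e_pos by blast
  qed (use domain h[OF that] L2_field_norm_component(1)[OF field norm_le that] in \<open>simp_all add: M_def\<close>)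
  have wc_\<kappa>: "weak_curl_compact \<Omega> (\<lambda>n l. \<kappa> (e n) a l b) (\<lambda>l. \<kappa>' a l b) C" if "a \<in> {1..p}" "b \<in> {1..p}" for a b
  proof
    show "\<exists>K. compactin (Hneg1_loc_topology \<Omega>) K \<and> (\<forall>n. curl_dist \<Omega> k (\<kappa> (e n) a l b) l (\<kappa> (e n) a k b) \<in> K)" for k l
      using A2_\<kappa>[OF that, where k=k and l=l] e_pos by blast
  qed (use domain \<kappa>[OF that] L2_field_norm_component(2)[OF field norm_le that] in \<open>simp_all add: M_def\<close>)
  have sym': "symmetric_field \<Omega> p h' \<kappa>'"
  proof -
    \<comment> \<open>The factor 1, and -1 below, matches the constant in
      \<open>weakly_L2_AE_unique\<close>.\<close>
    have "AE x in M. h (e n) a i j x = 1 * h (e n) a j i x" if "a \<in> {1..p}" for n a i j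
      using sym[OF e_pos, of n] that unfolding symmetric_field_def M_def mult_1 by blast
    then have "AE x in M. h' a i j x = 1 * h' a j i x" if "a \<in> {1..p}" for a i j
      using that by (intro weakly_L2_AE_unique[OF h[OF that] h[OF that]])
    moreover have "AE x in M. \<kappa> (e n) a k b x = - 1 * \<kappa> (e n) b k a x" if "a \<in> {1..p}" "b \<in> {1..p}" for n a b k
      using sym[OF e_pos, of n] that unfolding symmetric_field_def M_def mult_minus1 by blast
    then have "AE x in M. \<kappa>' a k b x = - 1 * \<kappa>' b k a x" if "a \<in> {1..p}" "b \<in> {1..p}" for a b k
      using that by (intro weakly_L2_AE_unique[OF \<kappa>[OF that] \<kappa>[OF that(2,1)]])
    ultimately show ?thesis unfolding symmetric_field_def M_def mult_1 mult_minus1 by blast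
  qed

  \<comment> \<open>Weak continuity of the quadratic terms\<close>
  have gauss: "dist_tendsto \<Omega> (\<lambda>n. regular_dist \<Omega> (gauss_quad p (h (e n)) i j k l))
       (regular_dist \<Omega> (gauss_quad p h' i j k l)) sequentially" for i j k l
    unfolding dist_tendsto_def
  proof
    fix \<phi> assume \<phi>: "\<phi> \<in> test_functions \<Omega>"
    have eq: "regular_dist \<Omega> (gauss_quad p h i j k l) \<phi>
      = (\<integral>x. (\<Sum>a\<in>{1..p}. 1 * \<phi> x * (h a j i x * h a k l x - h a k i x * h a j l x)) \<partial>lebesgue_on \<Omega>)" for h
      unfolding regular_dist_eq[OF \<phi>] ip_def
      by (intro Bochner_Integration.integral_cong refl)
        (simp add: gauss_quad_def sum_subtractf right_diff_distrib left_diff_distrib sum_distrib_left sum_distrib_right mult_ac)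
    \<comment> \<open>For each \<open>a\<close> the two vector fields are the columns
      \<open>i\<close> and \<open>l\<close> of \<open>h\<close>; the antisymmetric pair of indices
      is \<open>j\<close>, \<open>k\<close>.\<close>
    show "(\<lambda>n. regular_dist \<Omega> (gauss_quad p (h (e n)) i j k l) \<phi>) \<longlonglongrightarrow> regular_dist \<Omega> (gauss_quad p h' i j k l) \<phi>"
      unfolding eq
      by (rule div_curl_sum[of _ \<Omega> "\<lambda>a n m. h (e n) a m i" "\<lambda>a m. h' a m i" C "\<lambda>a n m. h (e n) a m l" "\<lambda>a m. h' a m l", OF wc_h wc_h continuous_on_const \<phi>])
  qed
  have codazzi: "dist_tendsto \<Omega> (\<lambda>n. regular_dist \<Omega> (codazzi_quad p (h (e n)) (\<kappa> (e n)) a j k l))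
         (regular_dist \<Omega> (codazzi_quad p h' \<kappa>' a j k l)) sequentially" if a: "a \<in> {1..p}" for a j k l
    unfolding dist_tendsto_def
  proof
    fix \<phi> assume \<phi>: "\<phi> \<in> test_functions \<Omega>"
    have eq: "regular_dist \<Omega> (codazzi_quad p h \<kappa> a j k l) \<phi>
      = (\<integral>x. (\<Sum>b\<in>{1..p}. 1 * \<phi> x * (\<kappa> a k b x * h b l j x - \<kappa> a l b x * h b k j x)) \<partial>lebesgue_on \<Omega>)" for h \<kappa>
      unfolding regular_dist_eq[OF \<phi>] ip_def
      by (intro Bochner_Integration.integral_cong refl)
        (simp add: codazzi_quad_def sum_subtractf right_diff_distrib left_diff_distrib sum_distrib_left sum_distrib_right mult_ac)
    \<comment> \<open>The fields are \<kappa> with fixed \<open>a\<close>, \<open>b\<close> and the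
      column \<open>j\<close> of \<open>h\<close> for \<open>b\<close>, summed over
      \<open>b\<close>.\<close>
    show "(\<lambda>n. regular_dist \<Omega> (codazzi_quad p (h (e n)) (\<kappa> (e n)) a j k l) \<phi>) \<longlonglongrightarrow> regular_dist \<Omega> (codazzi_quad p h' \<kappa>' a j k l) \<phi>"
      unfolding eq
      by (rule div_curl_sum[of _ \<Omega> "\<lambda>b n m. \<kappa> (e n) a m b" "\<lambda>b m. \<kappa>' a m b" C "\<lambda>b n m. h (e n) b m j" "\<lambda>b m. h' b m j", OF wc_\<kappa>[OF a] wc_h continuous_on_const \<phi>])
  qed
  have ricci_h: "dist_tendsto \<Omega> (\<lambda>n. regular_dist \<Omega> (ricci_quad_h g (h (e n)) a b k l))
         (regular_dist \<Omega> (ricci_quad_h g h' a b k l)) sequentially" if ab: "a \<in> {1..p}" "b \<in> {1..p}" for a b k l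
    unfolding dist_tendsto_def
  proof
    fix \<phi> assume \<phi>: "\<phi> \<in> test_functions \<Omega>"
    note eq = ricci_quad_h_symmetric[OF domain(1) metric ab _ _ \<phi>]
    \<comment> \<open>A pair \<open>t\<close> of tangential indices numbers the summands, the
      inverse metric being the coefficient; \<open>l\<close> and \<open>k\<close> enter in the
      opposite order to the other equations.\<close>
    show "(\<lambda>n. regular_dist \<Omega> (ricci_quad_h g (h (e n)) a b k l) \<phi>) \<longlonglongrightarrow> regular_dist \<Omega> (ricci_quad_h g h' a b k l) \<phi>"
      unfolding eq[OF field sym[OF e_pos]] eq[OF field' sym']
      by (rule div_curl_sum[of _ \<Omega> "\<lambda>t n m. h (e n) a m (fst t)" "\<lambda>t m. h' a m (fst t)" C "\<lambda>t n m. h (e n) b m (snd t)" "\<lambda>t m. h' b m (snd t)",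
            OF wc_h[OF ab(1)] wc_h[OF ab(2)] continuous_on_matrix_inv[OF metric] \<phi>])
  qed
  have ricci_\<kappa>: "dist_tendsto \<Omega> (\<lambda>n. regular_dist \<Omega> (ricci_quad_\<kappa> p (\<kappa> (e n)) a b k l))
         (regular_dist \<Omega> (ricci_quad_\<kappa> p \<kappa>' a b k l)) sequentially" if ab: "a \<in> {1..p}" "b \<in> {1..p}" for a b k l
    unfolding dist_tendsto_def
  proof
    fix \<phi> assume \<phi>: "\<phi> \<in> test_functions \<Omega>"
    have eq: "regular_dist \<Omega> (ricci_quad_\<kappa> p \<kappa> a b k l) \<phi>
      = (\<integral>x. (\<Sum>c\<in>{1..p}. 1 * \<phi> x * (\<kappa> a k c x * \<kappa> c l b x - \<kappa> a l c x * \<kappa> c k b x)) \<partial>lebesgue_on \<Omega>)" for \<kappa>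
      unfolding regular_dist_eq[OF \<phi>] ip_def
      by (intro Bochner_Integration.integral_cong refl)
        (simp add: ricci_quad_\<kappa>_def sum_subtractf right_diff_distrib left_diff_distrib sum_distrib_left sum_distrib_right mult_ac)
    show "(\<lambda>n. regular_dist \<Omega> (ricci_quad_\<kappa> p (\<kappa> (e n)) a b k l) \<phi>) \<longlonglongrightarrow> regular_dist \<Omega> (ricci_quad_\<kappa> p \<kappa>' a b k l) \<phi>"
      unfolding eq
      by (rule div_curl_sum[of _ \<Omega> "\<lambda>c n m. \<kappa> (e n) a m c" "\<lambda>c m. \<kappa>' a m c" C "\<lambda>c n m. \<kappa> (e n) c m b" "\<lambda>c m. \<kappa>' c m b",
            OF wc_\<kappa>[OF ab(1)] wc_\<kappa>[OF _ ab(2)] continuous_on_const \<phi>])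
  qed

  have weak_h: "(\<lambda>n. ip M (h (e n) a i j) \<psi>) \<longlonglongrightarrow> ip M (h' a i j) \<psi>" if "a \<in> {1..p}" "\<psi> \<in> L2 M" for a i j \<psi>
    using h[OF that(1)] that(2) by (simp add: weakly_L2_def)
  have weak_\<kappa>: "(\<lambda>n. ip M (\<kappa> (e n) a l b) \<psi>) \<longlonglongrightarrow> ip M (\<kappa>' a l b) \<psi>" if "a \<in> {1..p}" "b \<in> {1..p}" "\<psi> \<in> L2 M" for a l b \<psi>
    using \<kappa>[OF that(1,2)] that(3) by (simp add: weakly_L2_def)
  have o_lim: "(\<lambda>n. o' (e n) \<phi>) \<longlonglongrightarrow> 0" if "dist_tendsto \<Omega> o' 0 (at_right 0)" "\<phi> \<in> test_functions \<Omega>" for o' :: "real \<Rightarrow> 'd functional" and \<phi>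
    using that filterlim_compose[OF _ e_right, of "\<lambda>\<epsilon>. o' \<epsilon> \<phi>" "nhds 0"] by (simp add: dist_tendsto_def)
  \<comment> \<open>The limit equations are equalities of functions on all arguments, so arguments
    that are not test functions need this separate case.\<close>
  have outside: "regular_dist \<Omega> f \<phi> = 0" "curl_dist \<Omega> k f l f' \<phi> = 0" if "\<phi> \<notin> test_functions \<Omega>" for f f' k l \<phi>
    using that by (simp_all add: regular_dist_def curl_dist_def dist_deriv_def)

  \<comment> \<open>The equations for the limit\<close>
  have "regular_dist \<Omega> (gauss_quad p h' i j k l) = regular_dist \<Omega> (riemann g i j k l)" for i j k l
  proof
    fix \<phi>
    show "regular_dist \<Omega> (gauss_quad p h' i j k l) \<phi> = regular_dist \<Omega> (riemann g i j k l) \<phi>"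
    proof (cases "\<phi> \<in> test_functions \<Omega>")
      case True
      \<comment> \<open>The same sequence converges once because the error \<open>o3\<close>
        vanishes and once by weak continuity; uniqueness of limits gives the equation.\<close>
      have "(\<lambda>n. regular_dist \<Omega> (riemann g i j k l) \<phi> + o3 (e n) i j k l \<phi>) \<longlonglongrightarrow> regular_dist \<Omega> (riemann g i j k l) \<phi> + 0"
        using A3_o3 True by (intro tendsto_add tendsto_const o_lim) auto
      moreover have "(\<lambda>n. regular_dist \<Omega> (riemann g i j k l) \<phi> + o3 (e n) i j k l \<phi>) \<longlonglongrightarrow> regular_dist \<Omega> (gauss_quad p h' i j k l) \<phi>"
        using gauss[of i j k l] True unfolding dist_tendsto_def A3_gauss[OF e_pos] by simp
      ultimately show ?thesis using LIMSEQ_unique by fastforce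
    qed (simp add: outside)
  qed
  moreover have "codazzi_lhs \<Omega> g p h' \<kappa>' a j k l = 0" if a: "a \<in> {1..p}" for a j k l
  proof
    fix \<phi>
    show "codazzi_lhs \<Omega> g p h' \<kappa>' a j k l \<phi> = 0 \<phi>"
    proof (cases "\<phi> \<in> test_functions \<Omega>")
      case True
      note eq = codazzi_lhs_eq[OF domain(1) metric a _ True]
      have \<Gamma>L: "(\<lambda>x. christoffel g m i j x * \<phi> x) \<in> L2 M" for m i
        unfolding M_def by (rule multiplier_L2[OF \<Omega>s test_multiplier[OF True continuous_on_christoffel[OF metric]]])
      have pL: "partial_deriv i \<phi> \<in> L2 M" for i unfolding M_def by (rule test_L2_on[OF \<Omega>s test_partial[OF True]])
      have "(\<lambda>n. codazzi_lhs \<Omega> g p (h (e n)) (\<kappa> (e n)) a j k l \<phi>) \<longlonglongrightarrow> codazzi_lhs \<Omega> g p h' \<kappa>' a j k l \<phi>"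
        unfolding eq[OF field] eq[OF field'] M_def[symmetric]
        using codazzi[OF a, of j k l] True
        by (intro tendsto_add tendsto_diff tendsto_sum weak_h a \<Gamma>L pL) (simp add: dist_tendsto_def)
      moreover have "(\<lambda>n. codazzi_lhs \<Omega> g p (h (e n)) (\<kappa> (e n)) a j k l \<phi>) \<longlonglongrightarrow> 0"
        unfolding A3_codazzi[OF e_pos a] using A3_o1[OF a] True by (intro o_lim[of "\<lambda>\<epsilon>. o1 \<epsilon> a j k l"]) auto
      ultimately show ?thesis using LIMSEQ_unique by (simp add: zero_fun_def)
    qed (simp add: outside codazzi_lhs_def)
  qed
  moreover have "ricci_lhs \<Omega> g p h' \<kappa>' a b k l = 0" if ab: "a \<in> {1..p}" "b \<in> {1..p}" for a b k l
  proof
    fix \<phi>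
    show "ricci_lhs \<Omega> g p h' \<kappa>' a b k l \<phi> = 0 \<phi>"
    proof (cases "\<phi> \<in> test_functions \<Omega>")
      case True
      have pL: "partial_deriv i \<phi> \<in> L2 M" for i unfolding M_def by (rule test_L2_on[OF \<Omega>s test_partial[OF True]])
      have "(\<lambda>n. ricci_lhs \<Omega> g p (h (e n)) (\<kappa> (e n)) a b k l \<phi>) \<longlonglongrightarrow> ricci_lhs \<Omega> g p h' \<kappa>' a b k l \<phi>"
        unfolding ricci_lhs_eq[OF True] M_def[symmetric]
        using ricci_h[OF ab, of k l] ricci_\<kappa>[OF ab, of k l] True
        by (intro tendsto_add tendsto_diff weak_\<kappa> ab pL) (simp_all add: dist_tendsto_def)
      moreover have "(\<lambda>n. ricci_lhs \<Omega> g p (h (e n)) (\<kappa> (e n)) a b k l \<phi>) \<longlonglongrightarrow> 0"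
        unfolding A3_ricci[OF e_pos ab] using A3_o2[OF ab] True by (intro o_lim[of "\<lambda>\<epsilon>. o2 \<epsilon> a b k l"]) auto
      ultimately show ?thesis using LIMSEQ_unique by (simp add: zero_fun_def)
    qed (simp add: outside ricci_lhs_def)
  qed
  ultimately have solution: "weak_solution_GCR \<Omega> g p h' \<kappa>'"
    using sym' by (simp add: weak_solution_GCR_def)
  show ?thesis
    using h \<kappa>
    by (intro exI[of _ e] exI[of _ h'] exI[of _ \<kappa>'] conjI allI ballI e_pos e_dec e_lim field' norm' gauss codazzi ricci_h ricci_\<kappa> solution)
       (auto simp: weakly_in_L2_iff M_def)
qed

end
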